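(* Let $\mathfrak{g}$ be a (possibly infinite-dimensional) Lie algebra over $\mathbb{K}$ and let $z\in\mathbb{K}$. Then the three maps $\star_z,\ \widehat{\star}_z,\ \ast_z\colon \mathrm{S}^\bullet(\mathfrak{g})\times \mathrm{S}^\bullet(\mathfrak{g})\to \mathrm{S}^\bullet(\mathfrak{g})$ defined in the context coincide, and they define star products on $\mathrm{S}^\bullet(\mathfrak{g})$. That is: the product is bilinear and associative, it has the form $f\star_z g=\sum_{n\ge 0} z^n C_n(f,g)$ (a finite sum) with bilinear maps $C_n$ independent of $z$, $C_0(f,g)=fg$ is the symmetric product, $C_1(f,g)-C_1(g,f)=\{f,g\}$, and $1\star_z f=f\star_z 1=f$, for all $f,g\in \mathrm{S}^\bullet(\mathfrak{g})$.
   Context: $\mathbb{K}$ is $\mathbb{R}$ or $\mathbb{C}$. $\mathrm{T}^\bullet(\mathfrak{g})$ is the tensor algebra and $\mathrm{S}^\bullet(\mathfrak{g})=\bigoplus_{n\ge0}\mathrm{S}^n(\mathfrak{g})$ the symmetric tensor algebra with its commutative product written without a sign; $\pi_n\colon \mathrm{S}^\bullet(\mathfrak{g})\to \mathrm{S}^n(\mathfrak{g})$ is the projection. $\{\cdot,\cdot\}$ is the unique Poisson bracket (antisymmetric biderivation) on $\mathrm{S}^\bullet(\mathfrak{g})$ with $\{\xi,\eta\}=[\xi,\eta]$ for $\xi,\eta\in\mathfrak{g}$. For $z\in\mathbb{K}$ let $\mathcal{U}(\mathfrak{g}_z)=\mathrm{T}^\bullet(\mathfrak{g})/\langle \xi\otimes\eta-\eta\otimes\xi-z[\xi,\eta]\rangle$,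 with product $\odot$, and let $\mathfrak{q}_z\colon \mathrm{S}^\bullet(\mathfrak{g})\to\mathcal{U}(\mathfrak{g}_z)$ be the linear isomorphism given by $\mathfrak{q}_z(\xi_1\cdots\xi_n)=\frac1{n!}\sum_{\sigma\in S_n}\xi_{\sigma(1)}\odot\cdots\odot\xi_{\sigma(n)}$. Write $\mathfrak{q}=\mathfrak{q}_1$ and $\mathcal{U}(\mathfrak{g})=\mathcal{U}(\mathfrak{g}_1)$. (1) $\star_z$ is the bilinear map with $f\star_z g=\sum_{n=0}^{k+\ell} z^n\,\pi_{k+\ell-n}\big(\mathfrak{q}^{-1}(\mathfrak{q}(f)\odot\mathfrak{q}(g))\big)$ for $f\in \mathrm{S}^k(\mathfrak{g})$, $g\in \mathrm{S}^\ell(\mathfrak{g})$. (2) $f\,\widehat{\star}_z\,g=\mathfrak{q}_z^{-1}(\mathfrak{q}_z(f)\odot\mathfrak{q}_z(g))$. (3) Write $\mathrm{BCH}(\xi,\eta)=\log(\exp\xi\exp\eta)=\sum_{a,b\ge 0}\mathrm{BCH}_{a,b}(\xi,\eta)$ for the Baker-Campbell-Hausdorff series, where $\mathrm{BCH}_{a,b}$ is the part of degree $a$ in $\xi$ and $b$ in $\eta$. Then $\ast_z$ is determined by $\exp(\xi)\ast_z\exp(\eta)=\exp\big(\frac1z\mathrm{BCH}(z\xi,z\eta)\big)$ for $\xi,\eta\in\mathfrak{g}$, where $\frac1z\mathrm{BCH}(z\xi,z\eta)=\sum_{a,b}z^{a+b-1}\mathrm{BCH}_{a,b}(\xi,\eta)$;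 i.e. it is the bilinear map with $\xi^k\ast_z\eta^\ell=\frac{\partial^k}{\partial t^k}\frac{\partial^\ell}{\partial s^\ell}\big|_{t=s=0}\exp\big(\frac1z\mathrm{BCH}(zt\xi,zs\eta)\big)$ for all $k,\ell\ge0$, $\xi,\eta\in\mathfrak{g}$, where the exponential is the formal power series in $t,s$ with coefficients in $\mathrm{S}^\bullet(\mathfrak{g})$. *)

theory Defs
  imports
    Complex_Main
    "HOL-Library.Poly_Mapping"
    "HOL-Combinatorics.Permutations"
    "HOL-Algebra.QuotRing"
    "HOL-Algebra.Module"
begin

section \<open>Scalars and Lie algebras\<close>

text \<open>The fields \<open>\<real>\<close> and \<open>\<complex>\<close>, up to isomorphism.\<close>

class real_or_complex = field_char_0 +
  assumes real_or_complex:
    "(\<exists>\<phi> :: 'a \<Rightarrow> real. bij \<phi> \<and> (\<forall>x y. \<phi> (x + y) = \<phi> x + \<phi> y \<and> \<phi> (x * y) = \<phi> x * \<phi> y)) \<or>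
     (\<exists>\<phi> :: 'a \<Rightarrow> complex. bij \<phi> \<and> (\<forall>x y. \<phi> (x + y) = \<phi> x + \<phi> y \<and> \<phi> (x * y) = \<phi> x * \<phi> y))"

instance real :: real_or_complex
  by standard (rule disjI1, rule exI[of _ id], simp)

instance complex :: real_or_complex
  by standard (rule disjI2, rule exI[of _ id], simp)

locale lie_algebra = vector_space scale
  for scale :: "'k::field \<Rightarrow> 'g::ab_group_add \<Rightarrow> 'g" +
  fixes bracket :: "'g \<Rightarrow> 'g \<Rightarrow> 'g"
  assumes bracket_add_left: "bracket (x + y) w = bracket x w + bracket y w"
    and bracket_add_right: "bracket w (x + y) = bracket w x + bracket w y"
    and bracket_scale_left: "bracket (scale c x) y = scale c (bracket x y)"
    and bracket_scale_right: "bracket x (scale c y) = scale c (bracket x y)"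
    and bracket_self: "bracket x x = 0"
    and jacobi: "bracket x (bracket y w) + bracket y (bracket w x) + bracket w (bracket x y) = 0"


section \<open>Associative algebras\<close>

text \<open>Algebras over \<open>'k\<close> (not necessarily commutative) are records of type \<open>('k, 'a) module\<close>,
  which carry a multiplication, a unit and the scalar multiplication \<open>\<odot>\<close>.\<close>

definition alg_linear :: "('k, 'a) module \<Rightarrow> ('k, 'b) module \<Rightarrow> ('a \<Rightarrow> 'b) \<Rightarrow> bool" where
  "alg_linear A B Q \<longleftrightarrow>
     Q \<in> carrier A \<rightarrow> carrier B \<and>
     (\<forall>f \<in> carrier A. \<forall>g \<in> carrier A. Q (f \<oplus>\<^bsub>A\<^esub> g) = Q f \<oplus>\<^bsub>B\<^esub> Q g) \<and>
     (\<forall>c. \<forall>f \<in> carrier A. Q (c \<odot>\<^bsub>A\<^esub> f) = c \<odot>\<^bsub>B\<^esub> Q f)"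

definition alg_bilinear :: "('k, 'a) module \<Rightarrow> ('a \<Rightarrow> 'a \<Rightarrow> 'a) \<Rightarrow> bool" where
  "alg_bilinear A B \<longleftrightarrow>
     (\<forall>f \<in> carrier A. alg_linear A A (B f)) \<and>
     (\<forall>g \<in> carrier A. alg_linear A A (\<lambda>f. B f g))"

inductive_set alg_span :: "('k, 'a) module \<Rightarrow> 'a set \<Rightarrow> 'a set"
  for A :: "('k, 'a) module" and X :: "'a set" where
  zero: "\<zero>\<^bsub>A\<^esub> \<in> alg_span A X"
| add_smult: "x \<in> X \<Longrightarrow> v \<in> alg_span A X \<Longrightarrow> (c \<odot>\<^bsub>A\<^esub> x) \<oplus>\<^bsub>A\<^esub> v \<in> alg_span A X"

definition alg_prod :: "('k, 'a) module \<Rightarrow> 'a list \<Rightarrow> 'a" where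
  "alg_prod A xs = foldr (\<otimes>\<^bsub>A\<^esub>) xs \<one>\<^bsub>A\<^esub>"

text \<open>The quotient ring together with the induced scalar multiplication on cosets.\<close>

definition quot_alg :: "('k, 'a) module \<Rightarrow> 'a set \<Rightarrow> ('k, 'a set) module" where
  "quot_alg A I =
     \<lparr>carrier = carrier (A Quot I), mult = mult (A Quot I), one = one (A Quot I),
      zero = zero (A Quot I), add = add (A Quot I),
      smult = (\<lambda>c F. \<Union>f\<in>F. I +>\<^bsub>A\<^esub> (c \<odot>\<^bsub>A\<^esub> f))\<rparr>"


section \<open>Free and tensor algebra\<close>

text \<open>With lists as the free monoid, \<^typ>\<open>'x list \<Rightarrow>\<^sub>0 'k\<close> is the free associative algebra
  on \<open>'x\<close> (non-commutative polynomials), with the convolution product.\<close>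

instantiation list :: (type) monoid_add
begin
definition zero_list_def: "0 = []"
definition plus_list_def: "xs + ys = xs @ ys"
instance by standard (simp_all add: zero_list_def plus_list_def)
end

definition free_alg :: "('k::comm_ring_1, 'x list \<Rightarrow>\<^sub>0 'k) module" where
  "free_alg = \<lparr>carrier = UNIV, mult = (*), one = 1, zero = 0, add = (+),
     smult = (\<lambda>c p. Poly_Mapping.single 0 c * p)\<rparr>"

definition free_gen :: "'x \<Rightarrow> 'x list \<Rightarrow>\<^sub>0 'k::comm_ring_1" where
  "free_gen x = Poly_Mapping.single [x] 1"

text \<open>The tensor algebra is the free algebra on the set \<open>\<gg>\<close> modulo linearity of \<open>\<gg> \<rightarrow> T(\<gg>)\<close>. In
  degree \<open>n\<close> this is the usual construction of the \<open>n\<close>-th tensor power: the vector space with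
  basis \<open>\<gg>\<^sup>n\<close> modulo multilinearity.\<close>

definition tensor_ideal :: "('k::comm_ring_1 \<Rightarrow> 'g::ab_group_add \<Rightarrow> 'g) \<Rightarrow> ('g list \<Rightarrow>\<^sub>0 'k) set" where
  "tensor_ideal scale = Idl\<^bsub>free_alg :: ('k, 'g list \<Rightarrow>\<^sub>0 'k) module\<^esub>
     ({free_gen (x + y) - free_gen x - free_gen y | x y. True} \<union>
      {free_gen (scale c x) - Poly_Mapping.single 0 c * free_gen x | c x. True})"

definition tensor_alg ::
    "('k::comm_ring_1 \<Rightarrow> 'g::ab_group_add \<Rightarrow> 'g) \<Rightarrow> ('k, ('g list \<Rightarrow>\<^sub>0 'k) set) module" where
  "tensor_alg scale = quot_alg free_alg (tensor_ideal scale)"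

definition tensor_gen ::
    "('k::comm_ring_1 \<Rightarrow> 'g::ab_group_add \<Rightarrow> 'g) \<Rightarrow> 'g \<Rightarrow> ('g list \<Rightarrow>\<^sub>0 'k) set" where
  "tensor_gen scale \<xi> = tensor_ideal scale +>\<^bsub>free_alg\<^esub> free_gen \<xi>"


section \<open>Symmetric algebra\<close>

type_synonym ('k, 'g) tquot = "('g list \<Rightarrow>\<^sub>0 'k) set set"

definition sym_ideal ::
    "('k::comm_ring_1 \<Rightarrow> 'g::ab_group_add \<Rightarrow> 'g) \<Rightarrow> ('k, 'g) tquot" where
  "sym_ideal scale = (let T = tensor_alg scale; \<iota> = tensor_gen scale in
     Idl\<^bsub>T\<^esub> {\<iota> \<xi> \<otimes>\<^bsub>T\<^esub> \<iota> \<eta> \<ominus>\<^bsub>T\<^esub> \<iota> \<eta> \<otimes>\<^bsub>T\<^esub> \<iota> \<xi> | \<xi> \<eta>. True})"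

definition sym_alg ::
    "('k::comm_ring_1 \<Rightarrow> 'g::ab_group_add \<Rightarrow> 'g) \<Rightarrow> ('k, ('k, 'g) tquot) module" where
  "sym_alg scale = quot_alg (tensor_alg scale) (sym_ideal scale)"

definition sym_gen ::
    "('k::comm_ring_1 \<Rightarrow> 'g::ab_group_add \<Rightarrow> 'g) \<Rightarrow> 'g \<Rightarrow> ('k, 'g) tquot" where
  "sym_gen scale \<xi> = sym_ideal scale +>\<^bsub>tensor_alg scale\<^esub> tensor_gen scale \<xi>"

definition sym_power ::
    "('k::comm_ring_1 \<Rightarrow> 'g::ab_group_add \<Rightarrow> 'g) \<Rightarrow> nat \<Rightarrow> ('k, 'g) tquot set" where
  "sym_power scale n = alg_span (sym_alg scale)
     {alg_prod (sym_alg scale) (map (sym_gen scale) \<xi>s) | \<xi>s. length \<xi>s = n}"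

text \<open>The projection \<open>\<pi>\<^sub>n\<close> along the decomposition of \<open>S(\<gg>)\<close> as direct sum of the \<open>S\<^sup>n(\<gg>)\<close>.\<close>

definition sym_proj ::
    "('k::comm_ring_1 \<Rightarrow> 'g::ab_group_add \<Rightarrow> 'g) \<Rightarrow> nat \<Rightarrow> ('k, 'g) tquot \<Rightarrow> ('k, 'g) tquot" where
  "sym_proj scale n f = (let S = sym_alg scale in
     THE h. \<exists>\<phi>. (\<forall>m. \<phi> m \<in> sym_power scale m) \<and> finite {m. \<phi> m \<noteq> \<zero>\<^bsub>S\<^esub>} \<and>
       f = (\<Oplus>\<^bsub>S\<^esub> m \<in> {m. \<phi> m \<noteq> \<zero>\<^bsub>S\<^esub>}. \<phi> m) \<and> h = \<phi> n)"

text \<open>Here and below, a map on \<open>S(\<gg>)\<close> that is specified by a property is only determined on the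
  carrier, so that it is selected by \<open>SOME\<close> rather than \<open>THE\<close>.\<close>

definition is_poisson_bracket ::
    "('k, 'a) module \<Rightarrow> ('a \<Rightarrow> 'a \<Rightarrow> 'a) \<Rightarrow> bool" where
  "is_poisson_bracket S P \<longleftrightarrow>
     alg_bilinear S P \<and>
     (\<forall>f \<in> carrier S. \<forall>g \<in> carrier S. P f g = \<ominus>\<^bsub>S\<^esub> P g f) \<and>
     (\<forall>f \<in> carrier S. \<forall>g \<in> carrier S. \<forall>h \<in> carrier S.
        P f (g \<otimes>\<^bsub>S\<^esub> h) = P f g \<otimes>\<^bsub>S\<^esub> h \<oplus>\<^bsub>S\<^esub> g \<otimes>\<^bsub>S\<^esub> P f h) \<and>
     (\<forall>f \<in> carrier S. \<forall>g \<in> carrier S. \<forall>h \<in> carrier S.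
        P f (P g h) \<oplus>\<^bsub>S\<^esub> P g (P h f) \<oplus>\<^bsub>S\<^esub> P h (P f g) = \<zero>\<^bsub>S\<^esub>)"

definition sym_poisson ::
    "('k::comm_ring_1 \<Rightarrow> 'g::ab_group_add \<Rightarrow> 'g) \<Rightarrow> ('g \<Rightarrow> 'g \<Rightarrow> 'g) \<Rightarrow>
     ('k, 'g) tquot \<Rightarrow> ('k, 'g) tquot \<Rightarrow> ('k, 'g) tquot" where
  "sym_poisson scale bracket = (SOME P. is_poisson_bracket (sym_alg scale) P \<and>
     (\<forall>\<xi> \<eta>. P (sym_gen scale \<xi>) (sym_gen scale \<eta>) = sym_gen scale (bracket \<xi> \<eta>)))"


section \<open>Universal enveloping algebra of the rescaled Lie algebra\<close>

definition univ_ideal ::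
    "('k::comm_ring_1 \<Rightarrow> 'g::ab_group_add \<Rightarrow> 'g) \<Rightarrow> ('g \<Rightarrow> 'g \<Rightarrow> 'g) \<Rightarrow> 'k \<Rightarrow> ('k, 'g) tquot" where
  "univ_ideal scale bracket z = (let T = tensor_alg scale; \<iota> = tensor_gen scale in
     Idl\<^bsub>T\<^esub> {\<iota> \<xi> \<otimes>\<^bsub>T\<^esub> \<iota> \<eta> \<ominus>\<^bsub>T\<^esub> \<iota> \<eta> \<otimes>\<^bsub>T\<^esub> \<iota> \<xi> \<ominus>\<^bsub>T\<^esub> z \<odot>\<^bsub>T\<^esub> \<iota> (bracket \<xi> \<eta>) | \<xi> \<eta>. True})"

definition univ_alg ::
    "('k::comm_ring_1 \<Rightarrow> 'g::ab_group_add \<Rightarrow> 'g) \<Rightarrow> ('g \<Rightarrow> 'g \<Rightarrow> 'g) \<Rightarrow> 'k \<Rightarrow>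
     ('k, ('k, 'g) tquot) module" where
  "univ_alg scale bracket z = quot_alg (tensor_alg scale) (univ_ideal scale bracket z)"

definition univ_gen ::
    "('k::comm_ring_1 \<Rightarrow> 'g::ab_group_add \<Rightarrow> 'g) \<Rightarrow> ('g \<Rightarrow> 'g \<Rightarrow> 'g) \<Rightarrow> 'k \<Rightarrow>
     'g \<Rightarrow> ('k, 'g) tquot" where
  "univ_gen scale bracket z \<xi> =
     univ_ideal scale bracket z +>\<^bsub>tensor_alg scale\<^esub> tensor_gen scale \<xi>"

text \<open>The symmetrisation map \<open>\<qq>\<^sub>z : S(\<gg>) \<rightarrow> U(\<gg>\<^sub>z)\<close>.\<close>

definition symmetrise ::
    "('k::field_char_0 \<Rightarrow> 'g::ab_group_add \<Rightarrow> 'g) \<Rightarrow> ('g \<Rightarrow> 'g \<Rightarrow> 'g) \<Rightarrow> 'k \<Rightarrow>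
     ('k, 'g) tquot \<Rightarrow> ('k, 'g) tquot" where
  "symmetrise scale bracket z = (let S = sym_alg scale; U = univ_alg scale bracket z in
     SOME Q. alg_linear S U Q \<and>
       (\<forall>\<xi>s. Q (alg_prod S (map (sym_gen scale) \<xi>s)) =
          inverse (fact (length \<xi>s)) \<odot>\<^bsub>U\<^esub>
            (\<Oplus>\<^bsub>U\<^esub> \<sigma> \<in> {\<sigma>. \<sigma> permutes {..<length \<xi>s}}.
               alg_prod U (map (univ_gen scale bracket z) (permute_list \<sigma> \<xi>s)))))"

definition symmetrise_inv ::
    "('k::field_char_0 \<Rightarrow> 'g::ab_group_add \<Rightarrow> 'g) \<Rightarrow> ('g \<Rightarrow> 'g \<Rightarrow> 'g) \<Rightarrow> 'k \<Rightarrow>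
     ('k, 'g) tquot \<Rightarrow> ('k, 'g) tquot" where
  "symmetrise_inv scale bracket z =
     inv_into (carrier (sym_alg scale)) (symmetrise scale bracket z)"


section \<open>Formal power series in two commuting variables\<close>

text \<open>\<open>F :: nat \<Rightarrow> nat \<Rightarrow> 'a\<close> stands for the series \<open>\<Sum>\<^sub>k\<^sub>,\<^sub>l F k l t\<^sup>k s\<^sup>l\<close> with coefficients in an algebra.
  For \<open>F\<close> without constant term the coefficients of order \<open>(k, l)\<close> of \<open>F\<^sup>m\<close> vanish when
  \<open>m > k + l\<close>; hence the finite sums in the exponential and the logarithm.\<close>

definition ser_one :: "('k, 'a) module \<Rightarrow> nat \<Rightarrow> nat \<Rightarrow> 'a" where
  "ser_one A = (\<lambda>k l. if k = 0 \<and> l = 0 then \<one>\<^bsub>A\<^esub> else \<zero>\<^bsub>A\<^esub>)"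

definition ser_mult ::
    "('k, 'a) module \<Rightarrow> (nat \<Rightarrow> nat \<Rightarrow> 'a) \<Rightarrow> (nat \<Rightarrow> nat \<Rightarrow> 'a) \<Rightarrow> nat \<Rightarrow> nat \<Rightarrow> 'a" where
  "ser_mult A F G = (\<lambda>k l. \<Oplus>\<^bsub>A\<^esub> i \<in> {..k}. \<Oplus>\<^bsub>A\<^esub> j \<in> {..l}. F i j \<otimes>\<^bsub>A\<^esub> G (k - i) (l - j))"

definition ser_power ::
    "('k, 'a) module \<Rightarrow> (nat \<Rightarrow> nat \<Rightarrow> 'a) \<Rightarrow> nat \<Rightarrow> nat \<Rightarrow> nat \<Rightarrow> 'a" where
  "ser_power A F m = (ser_mult A F ^^ m) (ser_one A)"

definition ser_exp ::
    "('k::field_char_0, 'a) module \<Rightarrow> (nat \<Rightarrow> nat \<Rightarrow> 'a) \<Rightarrow> nat \<Rightarrow> nat \<Rightarrow> 'a" where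
  "ser_exp A F = (\<lambda>k l. \<Oplus>\<^bsub>A\<^esub> m \<in> {..k + l}. inverse (fact m) \<odot>\<^bsub>A\<^esub> ser_power A F m k l)"

definition ser_log ::
    "('k::field_char_0, 'a) module \<Rightarrow> (nat \<Rightarrow> nat \<Rightarrow> 'a) \<Rightarrow> nat \<Rightarrow> nat \<Rightarrow> 'a" where
  "ser_log A F = (\<lambda>k l. \<Oplus>\<^bsub>A\<^esub> m \<in> {1..k + l}. ((- 1) ^ (m + 1) / of_nat m) \<odot>\<^bsub>A\<^esub>
     ser_power A (\<lambda>i j. F i j \<ominus>\<^bsub>A\<^esub> ser_one A i j) m k l)"

definition ser_deriv1 ::
    "('k::field_char_0, 'a) module \<Rightarrow> (nat \<Rightarrow> nat \<Rightarrow> 'a) \<Rightarrow> nat \<Rightarrow> nat \<Rightarrow> 'a" where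
  "ser_deriv1 A F = (\<lambda>k l. of_nat (Suc k) \<odot>\<^bsub>A\<^esub> F (Suc k) l)"

definition ser_deriv2 ::
    "('k::field_char_0, 'a) module \<Rightarrow> (nat \<Rightarrow> nat \<Rightarrow> 'a) \<Rightarrow> nat \<Rightarrow> nat \<Rightarrow> 'a" where
  "ser_deriv2 A F = (\<lambda>k l. of_nat (Suc l) \<odot>\<^bsub>A\<^esub> F k (Suc l))"


section \<open>The Baker-Campbell-Hausdorff series\<close>

datatype bch_var = Bch_x | Bch_y

text \<open>The coefficient of \<open>t\<^sup>a s\<^sup>b\<close> in \<open>log (exp (t x) exp (s y))\<close>, i.e. the part of degree \<open>a\<close> in \<open>x\<close> and
  \<open>b\<close> in \<open>y\<close> of \<open>log (exp x exp y)\<close>, as an element of the free associative algebra on \<open>x, y\<close>.\<close>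

definition bch_free :: "nat \<Rightarrow> nat \<Rightarrow> bch_var list \<Rightarrow>\<^sub>0 'k::field_char_0" where
  "bch_free = ser_log free_alg (ser_mult free_alg
     (ser_exp free_alg (\<lambda>k l. if k = 1 \<and> l = 0 then free_gen Bch_x else 0))
     (ser_exp free_alg (\<lambda>k l. if k = 0 \<and> l = 1 then free_gen Bch_y else 0)))"

text \<open>The graph of the Lie algebra homomorphism that maps \<open>x, y\<close> to \<open>\<xi>, \<eta>\<close>. Its domain is the free
  Lie algebra on \<open>x, y\<close>, realised as the Lie subalgebra generated by \<open>x, y\<close> in the free
  associative algebra.\<close>

inductive lie_eval ::
    "('k::comm_ring_1 \<Rightarrow> 'g::ab_group_add \<Rightarrow> 'g) \<Rightarrow> ('g \<Rightarrow> 'g \<Rightarrow> 'g) \<Rightarrow> 'g \<Rightarrow> 'g \<Rightarrow>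
     (bch_var list \<Rightarrow>\<^sub>0 'k) \<Rightarrow> 'g \<Rightarrow> bool"
  for scale :: "'k::comm_ring_1 \<Rightarrow> 'g::ab_group_add \<Rightarrow> 'g" and bracket and \<xi> \<eta> where
  var_x: "lie_eval scale bracket \<xi> \<eta> (free_gen Bch_x) \<xi>"
| var_y: "lie_eval scale bracket \<xi> \<eta> (free_gen Bch_y) \<eta>"
| zero: "lie_eval scale bracket \<xi> \<eta> 0 0"
| add: "lie_eval scale bracket \<xi> \<eta> u v \<Longrightarrow> lie_eval scale bracket \<xi> \<eta> u' v' \<Longrightarrow>
    lie_eval scale bracket \<xi> \<eta> (u + u') (v + v')"
| scale: "lie_eval scale bracket \<xi> \<eta> u v \<Longrightarrow>
    lie_eval scale bracket \<xi> \<eta> (Poly_Mapping.single 0 c * u) (scale c v)"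
| bracket: "lie_eval scale bracket \<xi> \<eta> u v \<Longrightarrow> lie_eval scale bracket \<xi> \<eta> u' v' \<Longrightarrow>
    lie_eval scale bracket \<xi> \<eta> (u * u' - u' * u) (bracket v v')"

definition bch ::
    "('k::field_char_0 \<Rightarrow> 'g::ab_group_add \<Rightarrow> 'g) \<Rightarrow> ('g \<Rightarrow> 'g \<Rightarrow> 'g) \<Rightarrow>
     nat \<Rightarrow> nat \<Rightarrow> 'g \<Rightarrow> 'g \<Rightarrow> 'g" where
  "bch scale bracket a b \<xi> \<eta> = (THE \<zeta>. lie_eval scale bracket \<xi> \<eta> (bch_free a b) \<zeta>)"


section \<open>The three products\<close>

definition gutt_star ::
    "('k::field_char_0 \<Rightarrow> 'g::ab_group_add \<Rightarrow> 'g) \<Rightarrow> ('g \<Rightarrow> 'g \<Rightarrow> 'g) \<Rightarrow> 'k \<Rightarrow>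
     ('k, 'g) tquot \<Rightarrow> ('k, 'g) tquot \<Rightarrow> ('k, 'g) tquot" where
  "gutt_star scale bracket z =
     (let S = sym_alg scale; U = univ_alg scale bracket 1; \<qq> = symmetrise scale bracket 1 in
      SOME B. alg_bilinear S B \<and>
        (\<forall>k l. \<forall>f \<in> sym_power scale k. \<forall>g \<in> sym_power scale l.
           B f g = (\<Oplus>\<^bsub>S\<^esub> n \<in> {..k + l}. (z ^ n) \<odot>\<^bsub>S\<^esub>
             sym_proj scale (k + l - n) (symmetrise_inv scale bracket 1 (\<qq> f \<otimes>\<^bsub>U\<^esub> \<qq> g)))))"

definition hat_star ::
    "('k::field_char_0 \<Rightarrow> 'g::ab_group_add \<Rightarrow> 'g) \<Rightarrow> ('g \<Rightarrow> 'g \<Rightarrow> 'g) \<Rightarrow> 'k \<Rightarrow>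
     ('k, 'g) tquot \<Rightarrow> ('k, 'g) tquot \<Rightarrow> ('k, 'g) tquot" where
  "hat_star scale bracket z f g =
     symmetrise_inv scale bracket z
       (symmetrise scale bracket z f \<otimes>\<^bsub>univ_alg scale bracket z\<^esub> symmetrise scale bracket z g)"

text \<open>The series \<open>(1/z) BCH(z t \<xi>, z s \<eta>)\<close> with coefficients in \<open>\<gg> \<subseteq> S(\<gg>)\<close>. The truncated exponent
  \<open>a + b - 1\<close> is harmless because the term with \<open>a = b = 0\<close> vanishes.\<close>

definition bch_series ::
    "('k::field_char_0 \<Rightarrow> 'g::ab_group_add \<Rightarrow> 'g) \<Rightarrow> ('g \<Rightarrow> 'g \<Rightarrow> 'g) \<Rightarrow> 'k \<Rightarrow>
     'g \<Rightarrow> 'g \<Rightarrow> nat \<Rightarrow> nat \<Rightarrow> ('k, 'g) tquot" where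
  "bch_series scale bracket z \<xi> \<eta> =
     (\<lambda>a b. (z ^ (a + b - 1)) \<odot>\<^bsub>sym_alg scale\<^esub> sym_gen scale (bch scale bracket a b \<xi> \<eta>))"

definition bch_star ::
    "('k::field_char_0 \<Rightarrow> 'g::ab_group_add \<Rightarrow> 'g) \<Rightarrow> ('g \<Rightarrow> 'g \<Rightarrow> 'g) \<Rightarrow> 'k \<Rightarrow>
     ('k, 'g) tquot \<Rightarrow> ('k, 'g) tquot \<Rightarrow> ('k, 'g) tquot" where
  "bch_star scale bracket z = (let S = sym_alg scale in
     SOME B. alg_bilinear S B \<and>
       (\<forall>k l \<xi> \<eta>. B (sym_gen scale \<xi> [^]\<^bsub>S\<^esub> k) (sym_gen scale \<eta> [^]\<^bsub>S\<^esub> l) =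
          (ser_deriv1 S ^^ k) ((ser_deriv2 S ^^ l)
            (ser_exp S (bch_series scale bracket z \<xi> \<eta>))) 0 0))"


section \<open>Star products\<close>

text \<open>A family of products, depending on the parameter \<open>z\<close>, that quantises the Poisson bracket \<open>P\<close>.\<close>

definition is_star_product ::
    "('k::field_char_0, 'a) module \<Rightarrow> ('a \<Rightarrow> 'a \<Rightarrow> 'a) \<Rightarrow> ('k \<Rightarrow> 'a \<Rightarrow> 'a \<Rightarrow> 'a) \<Rightarrow> bool" where
  "is_star_product S P star \<longleftrightarrow>
     (\<forall>z. alg_bilinear S (star z)) \<and>
     (\<forall>z. \<forall>f \<in> carrier S. \<forall>g \<in> carrier S. \<forall>h \<in> carrier S.
        star z (star z f g) h = star z f (star z g h)) \<and>
     (\<forall>z. \<forall>f \<in> carrier S. star z \<one>\<^bsub>S\<^esub> f = f \<and> star z f \<one>\<^bsub>S\<^esub> = f) \<and>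
     (\<exists>C :: nat \<Rightarrow> 'a \<Rightarrow> 'a \<Rightarrow> 'a.
        (\<forall>n. alg_bilinear S (C n)) \<and>
        (\<forall>f \<in> carrier S. \<forall>g \<in> carrier S. finite {n. C n f g \<noteq> \<zero>\<^bsub>S\<^esub>}) \<and>
        (\<forall>z. \<forall>f \<in> carrier S. \<forall>g \<in> carrier S.
           star z f g = (\<Oplus>\<^bsub>S\<^esub> n \<in> {n. C n f g \<noteq> \<zero>\<^bsub>S\<^esub>}. (z ^ n) \<odot>\<^bsub>S\<^esub> C n f g)) \<and>
        (\<forall>f \<in> carrier S. \<forall>g \<in> carrier S. C 0 f g = f \<otimes>\<^bsub>S\<^esub> g) \<and>
        (\<forall>f \<in> carrier S. \<forall>g \<in> carrier S. C 1 f g \<ominus>\<^bsub>S\<^esub> C 1 g f = P f g))"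

end

theory Submission
  imports Defs "HOL-Computational_Algebra.Formal_Power_Series"
begin

text \<open>
  Everything is computed on representatives in the free algebra on \<open>\<gg>\<close>. The symmetrisation of words
  induces all maps \<open>\<qq>\<^sub>z\<close> at once. It is surjective because a word differs from its symmetrisation,
  modulo the relations of \<open>U(\<gg>\<^sub>z)\<close>, by \<open>z\<close> times words of lower degree that do not depend on \<open>z\<close>;
  iterating this writes \<open>\<qq>\<^sub>z\<^sup>-\<^sup>1\<close> as a polynomial in \<open>z\<close> whose coefficients lower the degree, which
  identifies the first two products and gives the maps \<open>C\<^sub>n\<close>. It is injective because \<open>\<gg>\<^sub>z\<close> acts on
  \<open>S(\<gg>)\<close> by \<open>\<xi> \<cdot> exp \<eta> = (\<Sum>\<^sub>k b\<^sub>k (- z ad \<eta>)\<^sup>k \<xi>) exp \<eta>\<close> with \<open>\<Sum>\<^sub>k b\<^sub>k x\<^sup>k = x / (1 - e\<^sup>-\<^sup>x)\<close>, so that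
  \<open>\<eta> \<cdot> \<eta>\<^sup>n = \<eta>\<^sup>n\<^sup>+\<^sup>1\<close>; that this is an action is a functional equation for the generating series.
  For the third product, the logarithm \<open>Z\<close> of \<open>exp (t x) exp (s y)\<close> satisfies
  \<open>\<Sum>\<^sub>j (- ad Z)\<^sup>j (\<partial>Z/\<partial>s) / (j + 1)! = y\<close>, which exhibits its coefficients as Lie polynomials; evaluated
  in \<open>U(\<gg>\<^sub>z)\<close> they give the product of the exponentials, and powers span \<open>S(\<gg>)\<close>. Associativity of the
  products for all \<open>z\<close>, expanded in powers of \<open>z\<close>, yields the Poisson bracket.
\<close>

section \<open>Linear algebra in free algebras\<close>

text \<open>The algebras of the statement are cosets of cosets. Congruences \<open>cg br\<close> in
  one free algebra, with the bracket as a parameter, let S(g) and all U(g_z) be compared on the same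
  representatives. The obstacle is the injectivity half of Poincare-Birkhoff-Witt: the defining
  ideal must not be too large. An action on S(g) settles this without an ordered basis of g. It is
  used in transposed form, on functions of multisets, where nothing has to descend to a quotient.
  Its coefficients are forced: exp (t \<xi>) exp \<eta> = exp (\<eta> + t \<delta> + ...) with
  \<delta> = (ad \<eta> / (e^(ad \<eta>) - 1)) \<xi>. Injectivity serves twice more: it makes the
  chosen inverse of symmetrisation respect congruences, and it embeds g into U(g), so that
  evaluating a Lie polynomial has only one possible result. Remainders are chosen before z, so that
  an identity for all z is one between polynomials in z, whose coefficients can be compared order by
  order.\<close>

definition fsc :: "'k::field \<Rightarrow> ('x list \<Rightarrow>\<^sub>0 'k) \<Rightarrow> ('x list \<Rightarrow>\<^sub>0 'k)" where
  "fsc c f = Poly_Mapping.single 0 c * f"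

global_interpretation fs: vector_space fsc
proof unfold_locales
  fix a b :: "'k::field" and x y :: "'x list \<Rightarrow>\<^sub>0 'k"
  show "fsc a (x + y) = fsc a x + fsc a y" by (simp add: fsc_def distrib_left)
  show "fsc (a + b) x = fsc a x + fsc b x" by (simp add: fsc_def single_add distrib_right)
  show "fsc a (fsc b x) = fsc (a * b) x" by (simp add: fsc_def mult_single flip: mult.assoc)
  show "fsc 1 x = x" by (simp add: fsc_def)
qed

lemma lookup_fsc: "Poly_Mapping.lookup (fsc c f) w = c * Poly_Mapping.lookup f w"
  unfolding fsc_def by (simp flip: mult_map_scale_conv_mult add: Poly_Mapping.map.rep_eq when_def)

definition word :: "'x list \<Rightarrow> 'x list \<Rightarrow>\<^sub>0 'k::field" where
  "word w = Poly_Mapping.single w 1"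

lemma word_mult: "word u * word v = word (u @ v)"
  by (simp add: word_def mult_single plus_list_def)

lemma word_Nil [simp]: "word [] = 1"
  by (simp add: word_def flip: zero_list_def)

lemma free_gen_word: "free_gen x = word [x]"
  by (simp add: free_gen_def word_def)

lemma fsc_word: "fsc c (word w) = Poly_Mapping.single w c"
  by (simp add: fsc_def word_def mult_single)

lemma free_expand: "f = (\<Sum>w\<in>Poly_Mapping.keys f. fsc (Poly_Mapping.lookup f w) (word w))"
  by (rule poly_mapping_eqI)
     (simp add: lookup_sum fsc_word lookup_single when_def in_keys_iff)

lemma word_span: "fs.span (range word) = (UNIV :: ('x list \<Rightarrow>\<^sub>0 'k::field) set)"
proof -
  have "f \<in> fs.span (range word)" for f :: "'x list \<Rightarrow>\<^sub>0 'k"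
    by (subst free_expand) (intro fs.span_sum fs.span_scale fs.span_base rangeI)
  thus ?thesis by blast
qed

lemma free_induct [case_names zero step]:
  assumes "P 0" "\<And>c w f. P f \<Longrightarrow> P (fsc c (word w) + f)"
  shows "P f"
proof -
  have "f \<in> fs.span (range word)" by (simp add: word_span)
  thus ?thesis by (induction rule: fs.span_induct_alt) (auto intro: assms)
qed

lemma fsc_mult_left: "fsc c f * g = fsc c (f * g)"
  by (simp add: fsc_def mult.assoc)

lemma fsc_mult_right: "f * fsc c g = fsc c (f * g)"
proof -
  have "f * Poly_Mapping.single 0 c = Poly_Mapping.single 0 c * f"
    by (induction f rule: free_induct)
       (simp_all add: distrib_left distrib_right fsc_word mult_single mult.commute)
  thus ?thesis by (simp add: fsc_def flip: mult.assoc)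
qed

abbreviation flinear :: "(('x list \<Rightarrow>\<^sub>0 'k::field) \<Rightarrow> ('y list \<Rightarrow>\<^sub>0 'k)) \<Rightarrow> bool" where
  "flinear \<equiv> Vector_Spaces.linear fsc fsc"

lemma flinearI:
  assumes "\<And>f g. L (f + g) = L f + L g" "\<And>c f. L (fsc c f) = fsc c (L f)"
  shows "flinear L"
  by unfold_locales (use assms in auto)

definition lext :: "('k::field \<Rightarrow> 'v \<Rightarrow> 'v) \<Rightarrow> ('x list \<Rightarrow> 'v::ab_group_add) \<Rightarrow> ('x list \<Rightarrow>\<^sub>0 'k) \<Rightarrow> 'v" where
  "lext s h f = (\<Sum>w\<in>Poly_Mapping.keys f. s (Poly_Mapping.lookup f w) (h w))"

lemma
  fixes s :: "'k::field \<Rightarrow> 'v::ab_group_add \<Rightarrow> 'v" and h :: "'x list \<Rightarrow> 'v"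
  assumes "vector_space s"
  shows lext_linear: "Vector_Spaces.linear fsc s (lext s h)"
    and lext_word: "lext s h (word w) = h w"
proof -
  interpret s: vector_space s by fact
  \<comment> \<open>The sums for \<open>f\<close>, \<open>g\<close> and \<open>f + g\<close> have
    different supports; a common finite index set makes them comparable.\<close>
  have eq: "lext s h f = (\<Sum>w\<in>A. s (Poly_Mapping.lookup f w) (h w))"
    if "finite A" "Poly_Mapping.keys f \<subseteq> A" for f A
    unfolding lext_def using that by (intro sum.mono_neutral_left) (auto simp: in_keys_iff)
  show "Vector_Spaces.linear fsc s (lext s h)"
  proof unfold_locales
    fix f g :: "'x list \<Rightarrow>\<^sub>0 'k" and c
    let ?A = "Poly_Mapping.keys f \<union> Poly_Mapping.keys g"
    have "lext s h (f + g) = (\<Sum>w\<in>?A. s (Poly_Mapping.lookup (f + g) w) (h w))"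
      by (rule eq) (auto simp: keys_add)
    also have "\<dots> = lext s h f + lext s h g"
      by (subst (1 2) eq[of ?A]) (auto simp: lookup_add s.scale_left_distrib sum.distrib)
    finally show "lext s h (f + g) = lext s h f + lext s h g" .
    have "lext s h (fsc c f) = (\<Sum>w\<in>?A. s (Poly_Mapping.lookup (fsc c f) w) (h w))"
      by (rule eq) (auto simp: in_keys_iff lookup_fsc)
    also have "\<dots> = s c (lext s h f)"
      by (subst eq[of ?A]) (auto simp: lookup_fsc s.scale_sum_right)
    finally show "lext s h (fsc c f) = s c (lext s h f)" .
  qed
  show "lext s h (word w) = h w" by (simp add: lext_def word_def)
qed

lemma linear_eq_on_words:
  assumes "Vector_Spaces.linear fsc s L" "Vector_Spaces.linear fsc s L'"
    and "\<And>w. L (word w) = L' (word w)"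
  shows "L f = L' f"
proof -
  interpret L: Vector_Spaces.linear fsc s L by fact
  interpret L': Vector_Spaces.linear fsc s L' by fact
  show ?thesis
    by (induction f rule: free_induct) (simp_all add: L.add L'.add L.scale L'.scale assms(3) L.zero L'.zero)
qed

lemma linear_in_subspace_words:
  assumes "flinear L" "fs.subspace V" "\<And>w. L (word w) \<in> V"
  shows "L f \<in> V"
proof -
  interpret L: Vector_Spaces.linear fsc fsc L by fact
  show ?thesis
    by (induction f rule: free_induct)
       (simp_all add: L.add L.scale L.zero assms fs.subspace_add fs.subspace_scale fs.subspace_0)
qed

lemma linear_span_subset:
  assumes "flinear L" "fs.subspace V" "\<And>x. x \<in> B \<Longrightarrow> L x \<in> V" "f \<in> fs.span B"
  shows "L f \<in> V"
proof -
  interpret L: Vector_Spaces.linear fsc fsc L by fact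
  show ?thesis using assms(4)
    by (induction rule: fs.span_induct_alt)
       (simp_all add: L.add L.scale L.zero assms fs.subspace_add fs.subspace_scale fs.subspace_0)
qed

lemma flinear_mult_left: "flinear (\<lambda>f. a * f)"
  by (rule flinearI) (simp_all add: distrib_left fsc_mult_right)

lemma flinear_mult_right: "flinear (\<lambda>f. f * a)"
  by (rule flinearI) (simp_all add: distrib_right fsc_mult_left)

text \<open>Comparing the values at \<open>c\<close> and \<open>2 c\<close> eliminates the leading coefficient.\<close>

lemma (in vector_space) polynomial_coeffs_in_subspace:
  fixes v :: "nat \<Rightarrow> 'b"
  assumes char: "\<And>n. n > 0 \<Longrightarrow> (of_nat n :: 'a) \<noteq> 0"
    and V: "subspace V" and all: "\<And>c. (\<Sum>j\<le>n. c ^ j *s v j) \<in> V" and "j \<le> n"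
  shows "v j \<in> V"
  using all \<open>j \<le> n\<close>
proof (induction n arbitrary: v j)
  case 0
  thus ?case using "0.prems"(1)[of 1] by simp
next
  case (Suc n)
  \<comment> \<open>The pivots 2^i - 2^(n+1) must be invertible; up to sign they are 2^i times the
    positive integer 2^(n+1-i) - 1.\<close>
  have two: "(2 ^ i :: 'a) \<noteq> 2 ^ Suc n" if "i \<le> n" for i
  proof
    assume "(2 ^ i :: 'a) = 2 ^ Suc n"
    moreover have "(2::'a) ^ Suc n = 2 ^ i * 2 ^ (Suc n - i)"
      using that by (simp flip: power_add)
    ultimately have "(2::'a) ^ i * (2 ^ (Suc n - i) - 1) = 0" by (simp add: algebra_simps)
    moreover have "(2::'a) \<noteq> 0" using char[of 2] by simp
    ultimately have "(2::'a) ^ (Suc n - i) - 1 = 0" by simp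
    moreover have "(2::'a) ^ (Suc n - i) - 1 = of_nat (2 ^ (Suc n - i) - 1)"
      by (subst of_nat_diff) auto
    moreover have "(2::nat) ^ (Suc n - i) - 1 > 0" using that 
      by (metis Suc_diff_le one_less_numeral_iff power_gt1 semiring_norm(76) zero_less_diff)
    ultimately show False using char by metis
  qed
  have low: "v i \<in> V" if "i \<le> n" for i
  proof -
    have "(\<Sum>j\<le>n. c ^ j *s ((2 ^ j - 2 ^ Suc n) *s v j)) \<in> V" for c
    proof -
      have "(\<Sum>j\<le>Suc n. (2 * c) ^ j *s v j) - 2 ^ Suc n *s (\<Sum>j\<le>Suc n. c ^ j *s v j) \<in> V"
        by (intro subspace_diff subspace_scale V Suc.prems)
      also have "(\<Sum>j\<le>Suc n. (2 * c) ^ j *s v j) - 2 ^ Suc n *s (\<Sum>j\<le>Suc n. c ^ j *s v j)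
         = (\<Sum>j\<le>Suc n. c ^ j *s ((2 ^ j - 2 ^ Suc n) *s v j))"
        by (simp only: scale_sum_right flip: sum_subtractf)
           (intro sum.cong refl, simp add: power_mult_distrib scale_left_diff_distrib algebra_simps flip: scale_left_diff_distrib)
      finally show ?thesis by simp
    qed
    from Suc.IH[OF this that] have "inverse (2 ^ i - 2 ^ Suc n) *s ((2 ^ i - 2 ^ Suc n) *s v i) \<in> V"
      by (rule subspace_scale[OF V])
    thus ?thesis using two[OF that] by simp
  qed
  have "(\<Sum>j\<le>Suc n. 1 ^ j *s v j) - (\<Sum>j\<le>n. v j) \<in> V"
    by (intro subspace_diff V Suc.prems subspace_sum low) auto
  hence "v (Suc n) \<in> V" by simp
  with low Suc.prems(2) show ?case by (cases "j = Suc n") auto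
qed

section \<open>Symmetrisation and grading of the free algebra\<close>

definition homog :: "nat \<Rightarrow> ('x list \<Rightarrow>\<^sub>0 'k::field) set" where
  "homog n = fs.span {word w | w. length w = n}"

definition hcomp :: "nat \<Rightarrow> ('x list \<Rightarrow>\<^sub>0 'k::field) \<Rightarrow> 'x list \<Rightarrow>\<^sub>0 'k" where
  "hcomp n = lext fsc (\<lambda>w. if length w = n then word w else 0)"

lemma flinear_hcomp: "flinear (hcomp n)"
  unfolding hcomp_def by (rule lext_linear) (rule fs.vector_space_axioms)

interpretation hcomp: Vector_Spaces.linear fsc fsc "hcomp n"
  by (rule flinear_hcomp)

lemma hcomp_word: "hcomp n (word w) = (if length w = n then word w else 0)"
  unfolding hcomp_def by (rule lext_word) (rule fs.vector_space_axioms)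

lemma subspace_homog: "fs.subspace (homog n)"
  by (simp add: homog_def)

lemma word_in_homog: "length w = n \<Longrightarrow> word w \<in> homog n"
  unfolding homog_def by (rule fs.span_base) blast

lemma homog_induct [consumes 1, case_names zero step]:
  assumes "f \<in> homog n" "P 0"
    and "\<And>c w f. length w = n \<Longrightarrow> f \<in> homog n \<Longrightarrow> P f \<Longrightarrow> P (fsc c (word w) + f)"
  shows "P f"
proof -
  have "f \<in> homog n \<and> P f" using assms(1) unfolding homog_def
  proof (induction rule: fs.span_induct_alt)
    case base
    show ?case using assms(2) by (simp add: fs.span_zero)
  next
    case (step c x y)
    then obtain w where w: "x = word w" "length w = n" by blast
    have "x \<in> fs.span {word w | w. length w = n}" using step by (intro fs.span_base)
    thus ?case using assms(3) step w
      by (auto simp: homog_def intro!: fs.span_add fs.span_scale)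
  qed
  thus ?thesis ..
qed

lemma homog_0: "0 \<in> homog n"
  by (rule fs.subspace_0[OF subspace_homog])

lemma hcomp_in_homog: "hcomp n f \<in> homog n"
  by (rule linear_in_subspace_words[OF flinear_hcomp subspace_homog])
     (auto simp: hcomp_word word_in_homog homog_0)

lemma hcomp_homog: "f \<in> homog n \<Longrightarrow> hcomp m f = (if m = n then f else 0)"
  by (induction rule: homog_induct) (auto simp: hcomp.add hcomp.scale hcomp_word)

lemma homog_mult:
  assumes "f \<in> homog m" "g \<in> homog n"
  shows "f * g \<in> homog (m + n)"
  using assms(1)
proof (induction rule: homog_induct)
  case (step c w f)
  have "word w * g \<in> homog (m + n)" using assms(2)
    by (induction rule: homog_induct)
       (auto simp: homog_0 step(1) distrib_left fsc_mult_right word_mult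
             intro!: fs.subspace_add fs.subspace_scale subspace_homog word_in_homog)
  with step.IH show ?case
    by (auto simp: distrib_right fsc_mult_left intro!: fs.subspace_add fs.subspace_scale subspace_homog)
qed (simp add: homog_0)

lemma hcomp_sum: "\<exists>N. \<forall>n\<ge>N. f = (\<Sum>m\<le>n. hcomp m f)"
proof (induction f rule: free_induct)
  case (step c w f)
  then obtain N where N: "\<forall>n\<ge>N. f = (\<Sum>m\<le>n. hcomp m f)" by blast
  have "\<forall>n\<ge>max N (length w). fsc c (word w) + f = (\<Sum>m\<le>n. hcomp m (fsc c (word w) + f))"
    using N by (auto simp: hcomp.add hcomp.scale hcomp_word sum.distrib simp flip: fs.scale_sum_right)
  thus ?case by blast
qed simp

section \<open>The symmetrisation operator\<close>

definition sym_word :: "'x list \<Rightarrow> 'x list \<Rightarrow>\<^sub>0 'k::field_char_0" where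
  "sym_word w = fsc (inverse (fact (length w)))
     (\<Sum>\<sigma> | \<sigma> permutes {..<length w}. word (permute_list \<sigma> w))"

definition symm :: "('x list \<Rightarrow>\<^sub>0 'k::field_char_0) \<Rightarrow> 'x list \<Rightarrow>\<^sub>0 'k" where
  "symm = lext fsc sym_word"

lemma flinear_sym: "flinear symm"
  unfolding symm_def by (rule lext_linear) (rule fs.vector_space_axioms)

interpretation symm: Vector_Spaces.linear fsc fsc symm
  by (rule flinear_sym)

lemma symm_of_word: "symm (word w) = sym_word w"
  unfolding symm_def by (rule lext_word) (rule fs.vector_space_axioms)

lemma fsc_sum_const: "finite A \<Longrightarrow> (\<Sum>x\<in>A. f) = fsc (of_nat (card A)) f"
  by (induction A rule: finite_induct) (simp_all add: fs.scale_left_distrib add.commute del: sum_constant)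

lemma card_perms: "card {\<sigma>. \<sigma> permutes {..<n}} = fact n"
  by (rule card_permutations) auto

lemma finite_perms: "finite {\<sigma>. \<sigma> permutes {..<n::nat}}"
  by (rule finite_permutations) simp

lemma perm_average:
  assumes "\<And>\<sigma>. \<sigma> permutes {..<length w} \<Longrightarrow> h \<sigma> = f"
  shows "fsc (inverse (fact (length w) :: 'k::field_char_0)) (\<Sum>\<sigma> | \<sigma> permutes {..<length w}. h \<sigma>) = f"
proof -
  have "(\<Sum>\<sigma> | \<sigma> permutes {..<length w}. h \<sigma>) = (\<Sum>\<sigma> | \<sigma> permutes {..<length w}. f)"
    by (rule sum.cong) (auto simp: assms)
  also have "\<dots> = fsc (fact (length w)) f"
    by (subst fsc_sum_const[OF finite_perms]) (simp add: card_perms)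
  finally show ?thesis by simp
qed

text \<open>Rearranging the word by \<tau> composes every summation permutation with \<tau>, which
  only permutes the summands.\<close>

lemma sym_word_mset:
  assumes "mset w = mset w'"
  shows "sym_word w = sym_word w'"
proof -
  obtain \<tau> where \<tau>: "\<tau> permutes {..<length w'}" "permute_list \<tau> w' = w"
    using mset_eq_permutation[OF assms] by blast
  have len: "length w = length w'" using assms by (rule mset_eq_length)
  have "(\<Sum>\<sigma> | \<sigma> permutes {..<length w'}. word (permute_list \<sigma> w)) =
        (\<Sum>\<sigma> | \<sigma> permutes {..<length w'}. word (permute_list (\<tau> \<circ> \<sigma>) w'))"
    by (rule sum.cong) (auto simp: permute_list_compose \<tau>)
  also have "\<dots> = (\<Sum>\<sigma> | \<sigma> permutes {..<length w'}. word (permute_list \<sigma> w'))"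
    by (rule setum_permutations_compose_left[OF \<tau>(1), symmetric])
  finally show ?thesis by (simp add: sym_word_def len)
qed

lemma sym_word_replicate: "sym_word (replicate n x) = word (replicate n x)"
  unfolding sym_word_def
proof (rule perm_average)
  fix \<sigma> assume "\<sigma> permutes {..<length (replicate n x)}"
  hence "mset (permute_list \<sigma> (replicate n x)) = mset (replicate n x)"
    by (rule mset_permute_list)
  hence "permute_list \<sigma> (replicate n x) = replicate n x"
    by (metis in_multiset_in_set length_permute_list length_replicate mset_eq_setD 
        in_set_replicate replicate_eqI)
  thus "word (permute_list \<sigma> (replicate n x)) = word (replicate n x)" by simp
qed

text \<open>The letter in place \<open>length u\<close> is moved to the place that \<sigma> sends to
  \<open>length u\<close>, and its surroundings do not depend on it. Hence linearity in one letter
  passes to every permuted word.\<close>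

lemma permute_list_split:
  assumes "\<sigma> permutes {..<length (u @ x # v)}"
  obtains u' v' where "\<And>y. permute_list \<sigma> (u @ y # v) = u' @ y # v'"
proof -
  define n where "n = length (u @ x # v)"
  define j where "j = inv_into UNIV \<sigma> (length u)"
  have p: "\<sigma> permutes {..<n}" using assms by (simp add: n_def)
  have j: "j < n" unfolding j_def
    using permutes_in_image[OF permutes_inv[OF p], of "length u"] by (simp add: n_def)
  have sj: "\<sigma> j = length u" unfolding j_def using permutes_inverses(1)[OF p] by simp
  have ne: "\<sigma> i \<noteq> length u" if "i \<noteq> j" for i
    using that sj permutes_inj[OF p] by (metis injD)
  define U where "U = map (\<lambda>i. (u @ x # v) ! \<sigma> i) [0..<j]"
  define V where "V = map (\<lambda>i. (u @ x # v) ! \<sigma> i) [Suc j..<n]"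
  have "permute_list \<sigma> (u @ y # v) = U @ y # V" for y
  proof -
    have "permute_list \<sigma> (u @ y # v) = map (\<lambda>i. (u @ y # v) ! \<sigma> i) [0..<n]"
      by (simp add: permute_list_def n_def)
    also have "[0..<n] = [0..<j] @ j # [Suc j..<n]"
      using j by (metis le_add_same_cancel1 less_imp_le upt_add_eq_append upt_conv_Cons zero_le le_add_diff_inverse)
    also have "map (\<lambda>i. (u @ y # v) ! \<sigma> i) \<dots> = U @ y # V"
      unfolding U_def V_def using ne
      by (auto simp: sj nth_append nth_Cons' intro!: map_cong)
    finally show ?thesis .
  qed
  thus ?thesis by (rule that)
qed

lemma symm_homog: "f \<in> homog n \<Longrightarrow> symm f \<in> homog n"
proof (induction rule: homog_induct)
  case (step c w f)
  have "sym_word w \<in> homog n" unfolding sym_word_def using step(1)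
    by (auto intro!: fs.subspace_scale fs.subspace_sum subspace_homog word_in_homog)
  with step.IH show ?case
    by (auto simp: symm.add symm.scale symm_of_word intro!: fs.subspace_add fs.subspace_scale subspace_homog)
qed (simp add: homog_0)

section \<open>The defining ideals\<close>

locale char0_space = vector_space scale
  for scale :: "'k::field_char_0 \<Rightarrow> 'g::ab_group_add \<Rightarrow> 'g"
begin

text \<open>\<open>br\<close> is an arbitrary operation: 0 gives the symmetric algebra,
  \<open>scale z (br x y)\<close> the enveloping algebra for z. Linearity of the letters is among
  the relations, so one ideal of the free algebra covers both quotient steps.\<close>

definition rels :: "('g \<Rightarrow> 'g \<Rightarrow> 'g) \<Rightarrow> ('g list \<Rightarrow>\<^sub>0 'k) set" where
  "rels br = {word [x + y] - word [x] - word [y] | x y. True} \<union>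
     {word [scale c x] - fsc c (word [x]) | c x. True} \<union>
     {word [x] * word [y] - word [y] * word [x] - word [br x y] | x y. True}"

text \<open>A span instead of a generated ideal, so that linear maps can be tested on explicit
  spanning elements.\<close>

definition idl :: "('g \<Rightarrow> 'g \<Rightarrow> 'g) \<Rightarrow> ('g list \<Rightarrow>\<^sub>0 'k) set" where
  "idl br = fs.span {word u * r * word v | u r v. r \<in> rels br}"

definition cg :: "('g \<Rightarrow> 'g \<Rightarrow> 'g) \<Rightarrow> ('g list \<Rightarrow>\<^sub>0 'k) \<Rightarrow> ('g list \<Rightarrow>\<^sub>0 'k) \<Rightarrow> bool" where
  "cg br f g \<longleftrightarrow> f - g \<in> idl br"

lemma subspace_idl: "fs.subspace (idl br)"
  by (simp add: idl_def)

lemma idl_mult_left: "f \<in> idl br \<Longrightarrow> a * f \<in> idl br"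
proof (induction a rule: free_induct)
  case zero
  show ?case by (simp add: fs.subspace_0[OF subspace_idl])
next
  case (step c w a)
  have "word w * f \<in> idl br"
  proof (rule linear_span_subset[OF flinear_mult_left subspace_idl _ step.prems[unfolded idl_def]])
    fix x assume "x \<in> {word u * r * word v | u r v. r \<in> rels br}"
    then obtain u r v where x: "x = word u * r * word v" "r \<in> rels br" by blast
    have "word w * x = word (w @ u) * r * word v" by (simp add: x mult.assoc flip: word_mult)
    with x(2) show "word w * x \<in> idl br" unfolding idl_def by (intro fs.span_base) blast
  qed
  with step show ?case
    by (auto simp: distrib_right fsc_mult_left intro!: fs.subspace_add fs.subspace_scale subspace_idl)
qed

lemma idl_mult_right: "f \<in> idl br \<Longrightarrow> f * a \<in> idl br"
proof (induction a rule: free_induct)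
  case zero
  show ?case by (simp add: fs.subspace_0[OF subspace_idl])
next
  case (step c w a)
  have "f * word w \<in> idl br"
  proof (rule linear_span_subset[OF flinear_mult_right subspace_idl _ step.prems[unfolded idl_def]])
    fix x assume "x \<in> {word u * r * word v | u r v. r \<in> rels br}"
    then obtain u r v where x: "x = word u * r * word v" "r \<in> rels br" by blast
    have "x * word w = word u * r * word (v @ w)" by (simp add: x mult.assoc word_mult)
    with x(2) show "x * word w \<in> idl br" unfolding idl_def by (intro fs.span_base) blast
  qed
  with step show ?case
    by (auto simp: distrib_left fsc_mult_right intro!: fs.subspace_add fs.subspace_scale subspace_idl)
qed

lemma rels_in_idl: "r \<in> rels br \<Longrightarrow> r \<in> idl br"
  unfolding idl_def by (rule fs.span_base) (auto intro!: exI[of _ "[]"] exI[of _ r])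

lemma cg_refl [simp, intro]: "cg br f f"
  by (simp add: cg_def fs.subspace_0[OF subspace_idl])

lemma cg_sym: "cg br f g \<Longrightarrow> cg br g f"
  using fs.subspace_neg[OF subspace_idl, of "f - g"] by (simp add: cg_def)

lemma cg_trans [trans]: "cg br f g \<Longrightarrow> cg br g h \<Longrightarrow> cg br f h"
  using fs.subspace_add[OF subspace_idl, of "f - g" br "g - h"] by (simp add: cg_def)

lemma cg_add: "cg br f g \<Longrightarrow> cg br f' g' \<Longrightarrow> cg br (f + f') (g + g')"
  using fs.subspace_add[OF subspace_idl, of "f - g" br "f' - g'"] by (simp add: cg_def algebra_simps)

lemma cg_diff: "cg br f g \<Longrightarrow> cg br f' g' \<Longrightarrow> cg br (f - f') (g - g')"
  using fs.subspace_diff[OF subspace_idl, of "f - g" br "f' - g'"] by (simp add: cg_def algebra_simps)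

lemma cg_fsc: "cg br f g \<Longrightarrow> cg br (fsc c f) (fsc c g)"
  using fs.subspace_scale[OF subspace_idl, of "f - g" br c] by (simp add: cg_def fs.scale_right_diff_distrib)

lemma cg_mult: "cg br f g \<Longrightarrow> cg br f' g' \<Longrightarrow> cg br (f * f') (g * g')"
proof -
  assume *: "cg br f g" "cg br f' g'"
  have "f * f' - g * g' = (f - g) * f' + g * (f' - g')" by (simp add: algebra_simps)
  with * show ?thesis
    by (simp add: cg_def fs.subspace_add[OF subspace_idl] idl_mult_left idl_mult_right)
qed

lemma cg_sum: "(\<And>x. x \<in> A \<Longrightarrow> cg br (f x) (g x)) \<Longrightarrow> cg br (sum f A) (sum g A)"
  unfolding cg_def sum_subtractf[symmetric] by (rule fs.subspace_sum[OF subspace_idl])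

lemma cg_0: "cg br f 0 \<longleftrightarrow> f \<in> idl br"
  by (simp add: cg_def)

lemma cg_in: "cg br f g \<Longrightarrow> f \<in> idl br \<longleftrightarrow> g \<in> idl br"
  by (meson cg_0 cg_sym cg_trans)

lemma gen_add: "cg br (word [x + y]) (word [x] + word [y])"
  unfolding cg_def diff_diff_eq[symmetric] by (rule rels_in_idl) (auto simp: rels_def)

lemma gen_scale: "cg br (word [scale c x]) (fsc c (word [x]))"
  unfolding cg_def by (rule rels_in_idl) (auto simp: rels_def)

lemma gen_swap: "cg br (word [x] * word [y]) (word [y] * word [x] + word [br x y])"
  unfolding cg_def diff_diff_eq[symmetric] by (rule rels_in_idl) (auto simp: rels_def)

lemma word_split: "word (u @ x # v) = word u * word [x] * word v"
  "word (u @ x # y # v) = word u * (word [x] * word [y]) * word v"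
  by (simp_all add: word_mult)

lemma cg_word_add: "cg br (word (u @ (x + y) # v)) (word (u @ x # v) + word (u @ y # v))"
  using cg_mult[OF cg_mult[OF cg_refl gen_add] cg_refl, of br "word u" x y "word v"]
  by (simp add: word_mult distrib_left distrib_right)

lemma cg_word_scale: "cg br (word (u @ scale c x # v)) (fsc c (word (u @ x # v)))"
  using cg_mult[OF cg_mult[OF cg_refl gen_scale] cg_refl, of br "word u" c x "word v"]
  by (simp add: word_split fsc_mult_left fsc_mult_right)

lemma cg_word_swap: "cg br (word (u @ x # y # v)) (word (u @ y # x # v) + word (u @ br x y # v))"
  using cg_mult[OF cg_mult[OF cg_refl gen_swap] cg_refl, of br "word u" x y "word v"]
  by (simp add: word_mult distrib_left distrib_right)

lemma cg_word_zero: "cg br (word (u @ 0 # v)) 0"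
  using cg_word_scale[of br u 0 0 v] by simp

text \<open>A linear map only has to be tested on relations placed between two words. Descents to
  quotients use this with \<open>V\<close> an ideal for operators and \<open>V\<close> = {0} for
  functionals.\<close>

lemma idl_linear_induct:
  assumes L: "Vector_Spaces.linear fsc s L" and V: "module.subspace s V"
    and add: "\<And>u x y v. L (word (u @ (x + y) # v)) - (L (word (u @ x # v)) + L (word (u @ y # v))) \<in> V"
    and sc: "\<And>u c x v. L (word (u @ scale c x # v)) - s c (L (word (u @ x # v))) \<in> V"
    and sw: "\<And>u x y v. L (word (u @ x # y # v)) - (L (word (u @ y # x # v)) + L (word (u @ br x y # v))) \<in> V"
    and "f \<in> idl br"
  shows "L f \<in> V"
proof -
  interpret L: Vector_Spaces.linear fsc s L by fact
  show ?thesis using assms(6) unfolding idl_def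
  proof (induction rule: fs.span_induct_alt)
    case base
    show ?case using L.vs2.subspace_0[OF V] by (simp add: L.zero)
  next
    case (step c x y)
    then obtain u r v where r: "r \<in> rels br" and x: "x = word u * r * word v" by blast
    have "L x \<in> V" using r unfolding rels_def x
      using add[of u _ _ v] sc[of u _ _ v] sw[of u _ _ v]
      by (auto simp: left_diff_distrib right_diff_distrib distrib_left distrib_right fsc_mult_left
            fsc_mult_right L.add L.diff L.scale word_mult diff_diff_eq)
    with step show ?case by (simp add: L.add L.scale L.vs2.subspace_add[OF V] L.vs2.subspace_scale[OF V])
  qed
qed

subsection \<open>The commutative case\<close>

abbreviation idl0 :: "('g list \<Rightarrow>\<^sub>0 'k) set" where
  "idl0 \<equiv> idl (\<lambda>_ _. 0)"

abbreviation cg0 :: "('g list \<Rightarrow>\<^sub>0 'k) \<Rightarrow> ('g list \<Rightarrow>\<^sub>0 'k) \<Rightarrow> bool" where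
  "cg0 \<equiv> cg (\<lambda>_ _. 0)"

lemma idl0_linear_induct:
  assumes L: "Vector_Spaces.linear fsc s L" and V: "module.subspace s V"
    and add: "\<And>u x y v. L (word (u @ (x + y) # v)) - (L (word (u @ x # v)) + L (word (u @ y # v))) \<in> V"
    and sc: "\<And>u c x v. L (word (u @ scale c x # v)) - s c (L (word (u @ x # v))) \<in> V"
    and sw: "\<And>u x y v. L (word (u @ x # y # v)) - L (word (u @ y # x # v)) \<in> V"
    and "f \<in> idl0"
  shows "L f \<in> V"
proof -
  interpret L: Vector_Spaces.linear fsc s L by fact
  \<comment> \<open>The bracket term of the swap relation is a word containing the letter 0; scaling
    that letter by 0 puts its image into \<open>V\<close>.\<close>
  have z: "L (word (u @ 0 # v)) \<in> V" for u v
    using sc[of u 0 0 v] by simp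
  show ?thesis
    by (rule idl_linear_induct[OF L V add sc _ assms(6)])
       (use L.vs2.subspace_diff[OF V sw z] in \<open>simp add: algebra_simps\<close>)
qed

lemma cg0_word_swap: "cg0 (word (u @ x # y # v)) (word (u @ y # x # v))"
  using cg_trans[OF cg_word_swap[of "\<lambda>_ _. 0" u x y v] cg_add[OF cg_refl cg_word_zero]] by simp

text \<open>The first letter is carried to its place in \<open>w'\<close>; each transposition costs
  z times a word one letter shorter, where a bracket replaces two letters. The remainder is chosen
  before z, the source of all z-independent coefficients. For the empty word the truncated degree
  \<open>length w - 1\<close> would admit constants, hence the extra clause.\<close>

lemma cg_reorder:
  assumes "mset w = mset w'"
  shows "\<exists>r. (length w = 0 \<longrightarrow> r = 0) \<and> r \<in> homog (length w - 1) \<and>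
    (\<forall>z. cg (\<lambda>x y. scale z (br x y)) (word w) (word w' + fsc z r))"
  using assms
proof (induction w arbitrary: w')
  case Nil
  thus ?case by (auto simp: homog_0)
next
  case (Cons x w)
  have move: "\<exists>r. r \<in> homog (length u + length v) \<and>
    (\<forall>z. cg (\<lambda>x y. scale z (br x y)) (word (x # u @ v)) (word (u @ x # v) + fsc z r))" for u v
  proof (induction u)
    case Nil
    thus ?case by (auto intro!: exI[of _ 0] simp: homog_0)
  next
    case (Cons y u)
    then obtain r where r: "r \<in> homog (length u + length v)"
      "\<And>z. cg (\<lambda>x y. scale z (br x y)) (word (x # u @ v)) (word (u @ x # v) + fsc z r)" by blast
    define r' where "r' = word [y] * r + word (br x y # u @ v)"
    have "cg (\<lambda>x y. scale z (br x y)) (word (x # (y # u) @ v)) (word ((y # u) @ x # v) + fsc z r')" for z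
    proof -
      let ?B = "\<lambda>x y. scale z (br x y)"
      have "cg ?B (word (x # y # u @ v)) (word (y # x # u @ v) + word (?B x y # u @ v))"
        using cg_word_swap[of ?B "[]" x y "u @ v"] by simp
      also have "cg ?B \<dots> (word (y # x # u @ v) + fsc z (word (br x y # u @ v)))"
        using cg_add[OF cg_refl cg_word_scale[of ?B "[]" z "br x y" "u @ v"]] by simp
      also have "word (y # x # u @ v) = word [y] * word (x # u @ v)"
        by (simp add: word_mult)
      also have "cg ?B (word [y] * word (x # u @ v) + fsc z (word (br x y # u @ v)))
          (word [y] * (word (u @ x # v) + fsc z r) + fsc z (word (br x y # u @ v)))"
        by (intro cg_add cg_mult cg_refl r)
      also have "word [y] * (word (u @ x # v) + fsc z r) + fsc z (word (br x y # u @ v))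
         = word ((y # u) @ x # v) + fsc z r'"
        by (simp add: r'_def word_mult distrib_left fsc_mult_right fs.scale_right_distrib)
      finally show ?thesis by simp
    qed
    moreover have "r' \<in> homog (length (y # u) + length v)"
      unfolding r'_def using homog_mult[OF word_in_homog[of "[y]" 1] r(1)]
      by (auto intro!: fs.subspace_add subspace_homog word_in_homog)
    ultimately show ?case by blast
  qed
  from Cons.prems have "x \<in> set w'" by (metis list.set_intros(1) mset_eq_setD)
  then obtain u v where w': "w' = u @ x # v" by (meson split_list)
  with Cons.prems have ms: "mset w = mset (u @ v)" by simp
  from Cons.IH[OF this] obtain r where r: "length w = 0 \<longrightarrow> r = 0" "r \<in> homog (length w - 1)"
    "\<And>z. cg (\<lambda>x y. scale z (br x y)) (word w) (word (u @ v) + fsc z r)" by blast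
  from move[of u v] obtain r' where r': "r' \<in> homog (length u + length v)"
    "\<And>z. cg (\<lambda>x y. scale z (br x y)) (word (x # u @ v)) (word (u @ x # v) + fsc z r')" by blast
  have len: "length w = length u + length v" using mset_eq_length[OF ms] by simp
  have "cg (\<lambda>x y. scale z (br x y)) (word (x # w)) (word w' + fsc z (r' + word [x] * r))" for z
  proof -
    let ?B = "\<lambda>x y. scale z (br x y)"
    have "word (x # w) = word [x] * word w" by (simp add: word_mult)
    also have "cg ?B \<dots> (word [x] * (word (u @ v) + fsc z r))"
      by (intro cg_mult cg_refl r)
    also have "\<dots> = word (x # u @ v) + fsc z (word [x] * r)"
      by (simp add: distrib_left fsc_mult_right word_mult)
    also have "cg ?B \<dots> ((word (u @ x # v) + fsc z r') + fsc z (word [x] * r))"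
      by (intro cg_add cg_refl r')
    finally show ?thesis by (simp add: w' fs.scale_right_distrib add.assoc)
  qed
  moreover have "r' + word [x] * r \<in> homog (length (x # w) - 1)"
  proof (cases "length w = 0")
    case True
    thus ?thesis using r(1) r'(1) len by simp
  next
    case False
    thus ?thesis using homog_mult[OF word_in_homog[of "[x]" 1] r(2)] r'(1) len
      by (auto intro!: fs.subspace_add subspace_homog)
  qed
  ultimately show ?case by (auto intro!: exI[of _ "r' + word [x] * r"])
qed

lemma cg0_mset: "mset w = mset w' \<Longrightarrow> cg0 (word w) (word w')"
  using cg_reorder[of w w' "\<lambda>_ _. 0"] by (metis add.right_neutral fs.scale_zero_left scale_zero_right)

lemma cg0_mult_commute: "cg0 (f * g) (g * f)"
proof (induction f rule: free_induct)
  case (step c w f)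
  have "cg0 (word w * g) (g * word w)"
  proof (induction g rule: free_induct)
    case (step c' w' g)
    thus ?case
      by (auto simp: distrib_left distrib_right fsc_mult_left fsc_mult_right word_mult intro!: cg_add cg_fsc cg0_mset)
  qed simp
  with step show ?case
    by (auto simp: distrib_left distrib_right fsc_mult_left fsc_mult_right intro!: cg_add cg_fsc)
qed simp

text \<open>For the zero bracket all relations are homogeneous in word length, so the projections
  descend to the symmetric algebra.\<close>

lemma hcomp_idl0: "f \<in> idl0 \<Longrightarrow> hcomp n f \<in> idl0"
  by (rule idl0_linear_induct[OF flinear_hcomp subspace_idl, rotated -1])
     (use cg_word_add[of "\<lambda>_ _. 0"] cg_word_scale[of "\<lambda>_ _. 0"] cg0_word_swap in
      \<open>auto simp: hcomp_word cg_def fs.subspace_0[OF subspace_idl]\<close>)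

text \<open>\<open>cg_reorder\<close> is averaged over all permutations of the word.\<close>

lemma cg_symm_word:
  "\<exists>r. (length w = 0 \<longrightarrow> r = 0) \<and> r \<in> homog (length w - 1) \<and>
    (\<forall>z. cg (\<lambda>x y. scale z (br x y)) (word w) (symm (word w) + fsc z r))"
proof -
  let ?P = "{\<sigma>. \<sigma> permutes {..<length w}}"
  have "\<exists>r. (length w = 0 \<longrightarrow> r = 0) \<and> r \<in> homog (length w - 1) \<and>
    (\<forall>z. cg (\<lambda>x y. scale z (br x y)) (word w) (word (permute_list \<sigma> w) + fsc z r))" if "\<sigma> \<in> ?P" for \<sigma>
    by (rule cg_reorder) (use that in simp)
  then obtain r where r: "\<And>\<sigma>. \<sigma> \<in> ?P \<Longrightarrow> length w = 0 \<Longrightarrow> r \<sigma> = 0"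
    "\<And>\<sigma>. \<sigma> \<in> ?P \<Longrightarrow> r \<sigma> \<in> homog (length w - 1)"
    "\<And>\<sigma> z. \<sigma> \<in> ?P \<Longrightarrow> cg (\<lambda>x y. scale z (br x y)) (word w) (word (permute_list \<sigma> w) + fsc z (r \<sigma>))"
    by metis
  define R where "R = fsc (inverse (fact (length w))) (\<Sum>\<sigma>\<in>?P. r \<sigma>)"
  have "cg (\<lambda>x y. scale z (br x y)) (word w) (symm (word w) + fsc z R)" for z
  proof -
    have "fsc (inverse (fact (length w))) (\<Sum>\<sigma>\<in>?P. word w) = (word w :: 'g list \<Rightarrow>\<^sub>0 'k)"
      by (rule perm_average) simp
    moreover have "cg (\<lambda>x y. scale z (br x y))
        (fsc (inverse (fact (length w))) (\<Sum>\<sigma>\<in>?P. word w))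
        (fsc (inverse (fact (length w))) (\<Sum>\<sigma>\<in>?P. word (permute_list \<sigma> w) + fsc z (r \<sigma>)))"
      by (intro cg_fsc cg_sum r)
    ultimately show ?thesis
      by (simp add: R_def symm_of_word sym_word_def sum.distrib fs.scale_right_distrib mult.commute
            flip: fs.scale_sum_right)
  qed
  moreover have "R \<in> homog (length w - 1)" unfolding R_def
    by (intro fs.subspace_scale fs.subspace_sum subspace_homog r) auto
  moreover have "length w = 0 \<longrightarrow> R = 0" using r(1) by (simp add: R_def)
  ultimately show ?thesis by blast
qed

text \<open>The remainder of \<open>cg_symm_word\<close> carries the factor z, and z = 0 removes
  it.\<close>

lemma cg0_symm: "cg0 (symm f) f"
proof (induction f rule: free_induct)
  case (step c w f)
  have "cg0 (symm (word w)) (word w)"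
    using cg_symm_word[of w "\<lambda>_ _. 0"] cg_sym by (metis add.right_neutral fs.scale_zero_left scale_zero_right)
  with step show ?case by (auto simp: symm.add symm.scale intro!: cg_add cg_fsc)
qed (simp add: symm.zero)

text \<open>Commutativity is absorbed exactly, since \<open>sym_word\<close> sees only the multiset
  of letters; linearity in a letter survives in every permuted word. Thus one operator induces the
  symmetrisation into every quotient.\<close>

lemma symm_idl0: 
  assumes "f \<in> idl0"
  shows "symm f \<in> idl br"
proof (rule idl0_linear_induct[OF flinear_sym subspace_idl _ _ _ assms])
  fix u v :: "'g list" and x y c
  let ?n = "length (u @ x # v)"
  have "\<exists>u' v'. \<forall>y. permute_list \<sigma> (u @ y # v) = u' @ y # v'" if "\<sigma> permutes {..<?n}" for \<sigma>
    using permute_list_split[OF that] by metis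
  then obtain U V where UV: "\<And>\<sigma> y. \<sigma> permutes {..<?n} \<Longrightarrow> permute_list \<sigma> (u @ y # v) = U \<sigma> @ y # V \<sigma>"
    by metis
  have sym: "symm (word (u @ y # v)) = fsc (inverse (fact ?n)) (\<Sum>\<sigma> | \<sigma> permutes {..<?n}. word (U \<sigma> @ y # V \<sigma>))" for y
    unfolding symm_of_word sym_word_def
    by (intro arg_cong2[of _ _ _ _ fsc] sum.cong) (simp_all add: UV[symmetric])
  show "symm (word (u @ (x + y) # v)) - (symm (word (u @ x # v)) + symm (word (u @ y # v))) \<in> idl br"
    unfolding sym fs.scale_right_distrib[symmetric] sum.distrib[symmetric] cg_def[symmetric]
    by (intro cg_fsc cg_sum cg_word_add)
  have e: "fsc c (fsc (inverse (fact ?n)) S) = fsc (inverse (fact ?n)) (fsc c S)" for S :: "'g list \<Rightarrow>\<^sub>0 'k"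
    by (simp add: mult.commute)
  show "symm (word (u @ scale c x # v)) - fsc c (symm (word (u @ x # v))) \<in> idl br"
    unfolding sym e fs.scale_sum_right[of c] cg_def[symmetric]
    by (intro cg_fsc cg_sum cg_word_scale)
  show "symm (word (u @ x # y # v)) - symm (word (u @ y # x # v)) \<in> idl br"
  proof -
    have "symm (word (u @ x # y # v)) = (symm (word (u @ y # x # v)) :: 'g list \<Rightarrow>\<^sub>0 'k)"
      unfolding symm_of_word by (rule sym_word_mset) simp
    thus ?thesis by (simp add: fs.subspace_0[OF subspace_idl])
  qed
qed

lemma symm_cg: "cg0 f g \<Longrightarrow> cg br (symm f) (symm g)"
  using symm_idl0[of "f - g" br] by (simp add: cg_def symm.diff)

text \<open>\<open>binom_word x y m j\<close> is the coefficient of \<open>c\<^sup>j\<close> in the noncommutative power \<open>(c x + y)\<^sup>m\<close>.\<close>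

fun binom_word :: "'g \<Rightarrow> 'g \<Rightarrow> nat \<Rightarrow> nat \<Rightarrow> 'g list \<Rightarrow>\<^sub>0 'k" where
  "binom_word x y 0 j = (if j = 0 then 1 else 0)"
| "binom_word x y (Suc m) j =
     (if j = 0 then 0 else word [x] * binom_word x y m (j - 1)) + word [y] * binom_word x y m j"

lemma binom_word_eq_0: "m < j \<Longrightarrow> binom_word x y m j = 0"
  by (induction m arbitrary: j) auto

lemma binom_word_expand:
  "cg br (word (replicate m (scale c x + y))) (\<Sum>j\<le>m. fsc (c ^ j) (binom_word x y m j))"
proof (induction m)
  case (Suc m)
  let ?S = "\<Sum>j\<le>m. fsc (c ^ j) (binom_word x y m j)"
  have "word (replicate (Suc m) (scale c x + y)) = word [scale c x + y] * word (replicate m (scale c x + y))"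
    by (simp add: word_mult)
  also have "cg br \<dots> ((fsc c (word [x]) + word [y]) * ?S)"
    by (intro cg_mult Suc.IH cg_trans[OF gen_add] cg_add gen_scale cg_refl)
  also have "(fsc c (word [x]) + word [y]) * ?S =
      (\<Sum>j\<le>m. fsc (c ^ Suc j) (word [x] * binom_word x y m j)) + (\<Sum>j\<le>m. fsc (c ^ j) (word [y] * binom_word x y m j))"
    by (simp add: distrib_right sum_distrib_left fsc_mult_left fsc_mult_right fs.scale_right_distrib
          sum.distrib mult.commute)
  also have "(\<Sum>j\<le>m. fsc (c ^ j) (word [y] * binom_word x y m j)) =
      (\<Sum>j\<le>Suc m. fsc (c ^ j) (word [y] * binom_word x y m j))"
    by (simp add: binom_word_eq_0)
  also have "(\<Sum>j\<le>m. fsc (c ^ Suc j) (word [x] * binom_word x y m j)) =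
      (\<Sum>j\<le>Suc m. fsc (c ^ j) (if j = 0 then 0 else word [x] * binom_word x y m (j - 1)))"
    by (subst sum.atMost_Suc_shift) simp
  finally show ?case by (simp add: sum.distrib[symmetric] fs.scale_right_distrib del: sum.atMost_Suc)
qed simp

lemma binom_word_0: "binom_word x y m 0 = word (replicate m y)"
  by (induction m) (simp_all add: word_mult)

text \<open>One of the m + 1 factors contributes \<open>x\<close>, and modulo commutativity all its
  places are equivalent.\<close>

lemma binom_word_1: "cg0 (binom_word x y (Suc m) 1) (fsc (of_nat (Suc m)) (word (x # replicate m y)))"
proof (induction m)
  case (Suc m)
  have "binom_word x y (Suc (Suc m)) 1 = word (x # replicate (Suc m) y) + word [y] * binom_word x y (Suc m) 1"
    by (simp add: binom_word_0[of x y "Suc m", simplified] word_mult)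
  also have "cg0 \<dots> (word (x # replicate (Suc m) y) + word [y] * fsc (of_nat (Suc m)) (word (x # replicate m y)))"
    by (intro cg_add cg_mult cg_refl Suc.IH)
  also have "word [y] * fsc (of_nat (Suc m)) (word (x # replicate m y)) =
      fsc (of_nat (Suc m)) (word (y # x # replicate m y))"
    by (simp add: fsc_mult_right word_mult)
  also have "cg0 (word (x # replicate (Suc m) y) + \<dots>)
      (word (x # replicate (Suc m) y) + fsc (of_nat (Suc m)) (word (x # replicate (Suc m) y)))"
    by (intro cg_add cg_fsc cg_refl cg0_mset) simp
  also have "\<dots> = fsc (of_nat (Suc (Suc m))) (word (x # replicate (Suc m) y))"
    by (subst of_nat_Suc[of "Suc m"], subst fs.scale_left_distrib) simp
  finally show ?case .
qed simp

text \<open>Polarisation: the powers of \<open>scale c x + y\<close> lie in the span for all c,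
  hence so does their coefficient of c, a nonzero multiple of x y^m. The span is therefore closed
  under left multiplication by letters, and it contains 1.\<close>

lemma powers_span:
  assumes V: "fs.subspace V" and V0: "idl0 \<subseteq> V" and powers: "\<And>n x. word (replicate n x) \<in> V"
  shows "f \<in> V"
proof -
  define P where "P = fs.span (idl0 \<union> {word (replicate n x) | n x. True})"
  have P: "fs.subspace P" "idl0 \<subseteq> P" "\<And>n x. word (replicate n x) \<in> P"
    unfolding P_def by (auto intro: fs.span_base)
  have cg: "f \<in> P \<longleftrightarrow> g \<in> P" if "cg0 f g" for f g
  proof -
    have "f - g \<in> P" using that P(2) by (auto simp: cg_def)
    thus ?thesis using fs.subspace_add[OF P(1), of "f - g" g] fs.subspace_diff[OF P(1), of f "f - g"] by auto
  qed
  have step: "word (x # replicate m y) \<in> P" for x y m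
  proof -
    have "(\<Sum>j\<le>Suc m. fsc (c ^ j) (binom_word x y (Suc m) j)) \<in> P" for c
      using cg[OF binom_word_expand[of _ "Suc m" c x y]] P(3) by blast
    hence "binom_word x y (Suc m) 1 \<in> P"
      by (intro fs.polynomial_coeffs_in_subspace[OF _ P(1), where n = "Suc m" and v = "binom_word x y (Suc m)"]) simp_all
    hence "fsc (of_nat (Suc m)) (word (x # replicate m y)) \<in> P"
      using cg[OF binom_word_1[of x y m]] by simp
    hence "fsc (inverse (of_nat (Suc m))) (fsc (of_nat (Suc m)) (word (x # replicate m y))) \<in> P"
      by (rule fs.subspace_scale[OF P(1)])
    thus ?thesis by (simp del: of_nat_Suc)
  qed
  have mult: "word [x] * f \<in> P" if "f \<in> P" for x f
    by (rule linear_span_subset[OF flinear_mult_left P(1) _ that[unfolded P_def]])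
       (use step idl_mult_left P(2) in \<open>auto simp: word_mult\<close>)
  have "word w \<in> P" for w
  proof (induction w)
    case Nil
    show ?case using P(3)[of 0] by simp
  next
    case (Cons x w)
    thus ?case using mult[of "word w" x] by (simp add: word_mult)
  qed
  hence "f \<in> P" using linear_in_subspace_words[OF fs.linear_id P(1), of f] by (simp add: id_def)
  moreover have "P \<subseteq> V" unfolding P_def using V0 powers by (intro fs.span_minimal V) auto
  ultimately show ?thesis by blast
qed

lemma linear_eq_on_powers:
  assumes L: "Vector_Spaces.linear fsc s L" and L': "Vector_Spaces.linear fsc s L'"
    and "\<And>f. f \<in> idl0 \<Longrightarrow> L f = L' f" "\<And>n x. L (word (replicate n x)) = L' (word (replicate n x))"
  shows "L f = L' f"
proof -
  interpret L: Vector_Spaces.linear fsc s L by fact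
  interpret L': Vector_Spaces.linear fsc s L' by fact
  have "f \<in> {f. L f = L' f}"
    by (rule powers_span)
       (auto simp: assms(3,4) fs.subspace_def L.add L'.add L.scale L'.scale L.zero L'.zero)
  thus ?thesis by simp
qed

end

section \<open>A functional equation for the Todd series\<close>

text \<open>The series \<open>x / (1 - e\<^sup>-\<^sup>x)\<close>.\<close>

definition todd :: "'k::field_char_0 fps" where
  "todd = inverse (Abs_fps (\<lambda>n. (- 1) ^ n / fact (Suc n)))"

lemma todd_exp: "todd * (1 - fps_exp (- 1)) = (fps_X :: 'k::field_char_0 fps)"
proof -
  let ?A = "Abs_fps (\<lambda>n. (- 1) ^ n / fact (Suc n)) :: 'k fps"
  have "(1 - fps_exp (- 1) :: 'k fps) = fps_X * ?A"
  proof (rule fps_ext)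
    fix n show "fps_nth (1 - fps_exp (- 1) :: 'k fps) n = fps_nth (fps_X * ?A) n"
      by (cases n) (simp_all del: fact_Suc)
  qed
  hence "todd * (1 - fps_exp (- 1)) = todd * (fps_X * ?A)" by (rule arg_cong)
  also have "\<dots> = fps_X * (todd * ?A)" by (rule mult.left_commute)
  also have "todd * ?A = 1" unfolding todd_def by (rule inverse_mult_eq_1) simp
  finally show ?thesis by (simp only: mult_1_right)
qed

lemma todd_0 [simp]: "fps_nth todd 0 = 1"
  by (simp add: todd_def)

text \<open>A series in \<open>x\<close> and \<open>y\<close> is a series in \<open>y\<close> whose coefficients are series in \<open>x\<close>; the series
  \<open>f(x)\<close>, \<open>f(y)\<close> and \<open>f(x + y)\<close> are \<^term>\<open>fps_const f\<close>, \<open>fps_y f\<close> and \<open>fps_plus f\<close>.\<close>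

definition fps_y :: "'k::comm_ring_1 fps \<Rightarrow> 'k fps fps" where
  "fps_y f = Abs_fps (\<lambda>q. fps_const (fps_nth f q))"

definition fps_plus :: "'k::comm_ring_1 fps \<Rightarrow> 'k fps fps" where
  "fps_plus f = Abs_fps (\<lambda>q. Abs_fps (\<lambda>p. of_nat ((p + q) choose p) * fps_nth f (p + q)))"

lemma fps_y_mult: "fps_y (f * g) = fps_y f * fps_y g"
proof (rule fps_ext)
  fix n
  have sum: "fps_const (sum h A) = (\<Sum>k\<in>A. fps_const (h k))" for h and A :: "nat set"
    by (rule fps_ext) (simp add: fps_sum_nth)
  show "fps_nth (fps_y (f * g)) n = fps_nth (fps_y f * fps_y g) n"
    by (simp add: fps_y_def fps_mult_nth sum)
qed

lemma vandermonde_box: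
  "(\<Sum>i\<le>p. (n choose i) * ((N - n) choose (p - i))) = N choose p" if "n \<le> N"
  using vandermonde[of n "N - n" p] that by (simp add: atLeast0AtMost)

text \<open>On coefficients, multiplicativity of f(x) -> f(x + y) is Vandermonde's identity.\<close>

lemma fps_plus_mult: "fps_plus (f * g) = fps_plus f * fps_plus (g :: 'k::comm_ring_1 fps)"
proof (rule fps_ext, rule fps_ext)
  fix q p :: nat
  let ?N = "p + q"
  let ?t = "\<lambda>i n. of_nat (n choose i) * of_nat ((?N - n) choose (p - i)) * (fps_nth f n * fps_nth g (?N - n)) :: 'k"
  \<comment> \<open>Outside i \<le> n \<le> i + q one of the two binomials vanishes.\<close>
  have inner: "(\<Sum>n\<le>?N. ?t i n) = (\<Sum>j\<le>q. ?t i (i + j))" if "i \<le> p" for i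
  proof -
    have "(\<Sum>n\<le>?N. ?t i n) = (\<Sum>n\<in>{i..i+q}. ?t i n)"
      using that by (intro sum.mono_neutral_right) (auto simp: binomial_eq_0)
    also have "\<dots> = (\<Sum>j\<le>q. ?t i (i + j))"
      by (rule sum.reindex_bij_witness[of _ "\<lambda>j. i + j" "\<lambda>n. n - i"]) auto
    finally show ?thesis .
  qed
  have "fps_nth (fps_nth (fps_plus (f * g)) q) p =
      (\<Sum>n\<le>?N. of_nat (?N choose p) * (fps_nth f n * fps_nth g (?N - n)))"
    by (simp add: fps_plus_def fps_mult_nth sum_distrib_left atLeast0AtMost)
  also have "\<dots> = (\<Sum>n\<le>?N. \<Sum>i\<le>p. ?t i n)"
  proof (intro sum.cong refl)
    fix n assume "n \<in> {..?N}"
    hence "(of_nat (?N choose p) :: 'k) = of_nat (\<Sum>i\<le>p. (n choose i) * ((?N - n) choose (p - i)))"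
      by (subst vandermonde_box) auto
    thus "of_nat (?N choose p) * (fps_nth f n * fps_nth g (?N - n)) = (\<Sum>i\<le>p. ?t i n)"
      by (simp add: sum_distrib_right)
  qed
  also have "\<dots> = (\<Sum>i\<le>p. \<Sum>n\<le>?N. ?t i n)" by (rule sum.swap)
  also have "\<dots> = (\<Sum>i\<le>p. \<Sum>j\<le>q. ?t i (i + j))"
    by (rule sum.cong) (auto simp: inner)
  also have "\<dots> = (\<Sum>j\<le>q. \<Sum>i\<le>p. ?t i (i + j))" by (rule sum.swap)
  also have "\<dots> = fps_nth (fps_nth (fps_plus f * fps_plus g) q) p"
  proof -
    have "?t i (i + j) = of_nat ((i + j) choose i) * fps_nth f (i + j) *
        (of_nat ((p - i + (q - j)) choose (p - i)) * fps_nth g (p - i + (q - j)))" if "i \<le> p" "j \<le> q" for i j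
    proof -
      have eq: "p + q - (i + j) = p - i + (q - j)" using that by simp
      show ?thesis unfolding eq by (simp only: mult_ac)
    qed
    thus ?thesis
      unfolding fps_plus_def fps_mult_nth fps_sum_nth atLeast0AtMost fps_nth_Abs_fps
      by (intro sum.cong refl) auto
  qed
  finally show "fps_nth (fps_nth (fps_plus (f * g)) q) p = fps_nth (fps_nth (fps_plus f * fps_plus g) q) p" .
qed

lemma fps_plus_exp:
  "fps_plus (fps_exp c) = fps_const (fps_exp c) * fps_y (fps_exp (c :: 'k::field_char_0))"
proof (rule fps_ext, rule fps_ext)
  fix q p :: nat
  have "of_nat ((p + q) choose p) / fact (p + q) = (1 / (fact p * fact q) :: 'k)"
    by (subst binomial_fact) (auto simp: field_simps)
  thus "fps_nth (fps_nth (fps_plus (fps_exp c)) q) p =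
      fps_nth (fps_nth (fps_const (fps_exp c) * fps_y (fps_exp c)) q) p"
    by (simp add: fps_plus_def fps_y_def fps_mult_right_const_nth power_add field_simps)
qed

text \<open>With E = e^(-x), F = e^(-y) and T the Todd series this reads T(y) (T(x+y) - T(x))/y +
  T(x) (T(x+y) - T(y))/x = T(x+y). The quotients are given by the equations for \<open>D\<close> and
  \<open>D'\<close>, as the ring need not be a field. Clearing denominators reduces everything to
  (1-E) + (1-F) - (1-EF) = (1-E)(1-F).\<close>

lemma todd_identity:
  fixes E F u v w x y :: "'a::idom"
  assumes u: "u * (1 - E) = x" and v: "v * (1 - F) = y" and w: "w * (1 - E * F) = x + y"
    and D: "y * D = w - u" "x * D' = w - v"
    and nz: "1 - E \<noteq> 0" "1 - F \<noteq> 0" "1 - E * F \<noteq> 0" "x * y \<noteq> 0"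
  shows "v * D + u * D' = w"
proof -
  define a b c where abc: "a = 1 - E" "b = 1 - F" "c = 1 - E * F"
  have c: "a + b - c = a * b" by (simp add: abc algebra_simps)
  have "(a * b * c) * (v * x * (w - u) + u * y * (w - v)) =
     (v * b) * x * ((w * c) * a - (u * a) * c) + (u * a) * y * ((w * c) * b - (v * b) * c)"
    by (simp add: algebra_simps)
  also have "\<dots> = (x * y) * (x + y) * (a + b - c)"
    unfolding u[folded abc] v[folded abc] w[folded abc] by (simp add: algebra_simps)
  also have "\<dots> = (a * b * c) * (x * y * w)"
    unfolding c w[folded abc, symmetric] by (simp only: mult_ac)
  finally have "v * x * (w - u) + u * y * (w - v) = x * y * w" using nz(1-3) by (simp add: abc)
  hence "(x * y) * (v * D + u * D') = (x * y) * w"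
    unfolding D[symmetric] by (simp add: algebra_simps)
  thus ?thesis using nz(4) by (simp only: mult_cancel_left simp_thms)
qed

text \<open>The coefficient of x^p y^q in the identity: \<open>G p q\<close> comes from T(y) (T(x+y)
  - T(x))/y, \<open>G q p\<close> from the same term with x and y exchanged. They will belong to the
  two orders of composition in a commutator.\<close>

lemma todd_coeffs:
  fixes p q :: nat
  defines "b \<equiv> fps_nth (todd :: 'k::field_char_0 fps)"
  defines "G \<equiv> \<lambda>p q. \<Sum>j\<le>q. b j * b (p + q + 1 - j) * of_nat ((p + q + 1 - j) choose p)"
  shows "G p q + G q p = of_nat ((p + q) choose p) * b (p + q)"
proof -
  let ?T = "todd :: 'k fps"
  define E F u v w x y where "E = fps_const (fps_exp (-1) :: 'k fps)" and "F = fps_y (fps_exp (-1) :: 'k fps)"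
    and "u = fps_const ?T" and "v = fps_y ?T" and "w = fps_plus ?T"
    and "x = fps_const (fps_X :: 'k fps)" and "y = (fps_X :: 'k fps fps)"
  define D D' where "D = Abs_fps (\<lambda>r. Abs_fps (\<lambda>p. of_nat ((p + r + 1) choose p) * b (p + r + 1)))"
    and "D' = Abs_fps (\<lambda>q. Abs_fps (\<lambda>r. of_nat ((q + r + 1) choose q) * b (q + r + 1)))"
  have sub: "fps_y (f - g) = fps_y f - fps_y g" "fps_plus (f - g) = fps_plus f - fps_plus g" for f g :: "'k fps"
    by (auto simp: fps_y_def fps_plus_def fps_eq_iff algebra_simps)
  have one: "fps_y 1 = (1 :: 'k fps fps)" "fps_plus 1 = (1 :: 'k fps fps)"
    by (auto simp: fps_y_def fps_plus_def fps_eq_iff fps_one_nth)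
  have X: "fps_y fps_X = y" "fps_plus fps_X = x + y"
    by (auto simp: fps_y_def fps_plus_def fps_eq_iff fps_X_nth x_def y_def)
  have u: "u * (1 - E) = x"
    using arg_cong[OF todd_exp, of "fps_const :: 'k fps \<Rightarrow> _"]
    by (simp add: u_def E_def x_def right_diff_distrib fps_const_sub [symmetric] fps_const_mult [symmetric] del: fps_const_sub fps_const_mult)
  have v: "v * (1 - F) = y"
    using arg_cong[OF todd_exp, of "fps_y :: 'k fps \<Rightarrow> _"]
    by (simp add: v_def F_def fps_y_mult sub one X)
  have w: "w * (1 - E * F) = x + y"
    using arg_cong[OF todd_exp, of "fps_plus :: 'k fps \<Rightarrow> _"]
    by (simp add: w_def E_def F_def fps_plus_mult sub one X fps_plus_exp)
  have D: "y * D = w - u"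
  proof (rule fps_ext, rule fps_ext)
    fix n m show "fps_nth (fps_nth (y * D) n) m = fps_nth (fps_nth (w - u) n) m"
      by (cases n) (simp_all add: y_def D_def w_def u_def fps_plus_def b_def)
  qed
  have D': "x * D' = w - v"
  proof (rule fps_ext, rule fps_ext)
    fix n m show "fps_nth (fps_nth (x * D') n) m = fps_nth (fps_nth (w - v) n) m"
    proof (cases m)
      case 0
      thus ?thesis by (simp add: x_def w_def v_def fps_plus_def fps_y_def)
    next
      case (Suc k)
      have "(Suc k + n) choose Suc k = (Suc k + n) choose n"
        by (subst binomial_symmetric) auto
      thus ?thesis by (simp add: Suc x_def D'_def w_def v_def fps_plus_def fps_y_def b_def add_ac del: binomial_Suc_Suc)
    qed
  qed
  have nz: "1 - E \<noteq> 0" "1 - F \<noteq> 0" "1 - E * F \<noteq> 0" "x * y \<noteq> 0"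
  proof -
    have "x \<noteq> 0" "y \<noteq> 0" by (simp_all add: x_def y_def)
    thus "x * y \<noteq> 0" by simp
    show "1 - E \<noteq> 0" "1 - F \<noteq> 0" using u v \<open>x \<noteq> 0\<close> \<open>y \<noteq> 0\<close> by auto
    have "fps_nth (fps_nth (x + y) 0) 1 = 1" by (simp add: x_def y_def)
    hence "x + y \<noteq> 0" by (metis fps_zero_nth zero_neq_one)
    thus "1 - E * F \<noteq> 0" using w by auto
  qed
  have "v * D + u * D' = w"
    by (rule todd_identity[OF u v w D D' nz])
  hence "fps_nth (fps_nth (v * D + u * D') q) p = fps_nth (fps_nth w q) p" by (rule arg_cong)
  moreover have "fps_nth (fps_nth (v * D) q) p = G p q"
  proof -
    have "fps_nth (fps_nth (v * D) q) p = (\<Sum>j\<le>q. b j * (of_nat ((p + (q - j) + 1) choose p) * b (p + (q - j) + 1)))"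
      by (simp add: v_def D_def fps_y_def fps_mult_nth[where 'a = "'k fps"] fps_sum_nth b_def atLeast0AtMost del: binomial_Suc_Suc)
    also have "\<dots> = G p q" unfolding G_def
    proof (intro sum.cong refl)
      fix j assume "j \<in> {..q}"
      hence e: "p + (q - j) + 1 = p + q + 1 - j" by simp
      show "b j * (of_nat ((p + (q - j) + 1) choose p) * b (p + (q - j) + 1)) =
          b j * b (p + q + 1 - j) * of_nat ((p + q + 1 - j) choose p)"
        unfolding e by (simp only: mult_ac)
    qed
    finally show ?thesis .
  qed
  moreover have "fps_nth (fps_nth (u * D') q) p = G q p"
  proof -
    have "fps_nth (fps_nth (u * D') q) p = (\<Sum>j\<le>p. b j * (of_nat ((q + (p - j) + 1) choose q) * b (q + (p - j) + 1)))"
      by (simp add: u_def D'_def fps_mult_nth[of todd] b_def atLeast0AtMost del: binomial_Suc_Suc)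
    also have "\<dots> = G q p" unfolding G_def
    proof (intro sum.cong refl)
      fix j assume "j \<in> {..p}"
      hence e: "q + (p - j) + 1 = q + p + 1 - j" by simp
      show "b j * (of_nat ((q + (p - j) + 1) choose q) * b (q + (p - j) + 1)) =
          b j * b (q + p + 1 - j) * of_nat ((q + p + 1 - j) choose q)"
        unfolding e by (simp only: mult_ac)
    qed
    finally show ?thesis .
  qed
  ultimately have "G p q + G q p = fps_nth (fps_nth w q) p" by (simp only: fps_add_nth)
  thus ?thesis by (simp only: w_def fps_plus_def b_def fps_nth_Abs_fps)
qed

section \<open>The representation dual to left multiplication\<close>

text \<open>The transpose of modifying one factor of a monomial; \<open>sum_mset\<close> counts an
  element with its multiplicity, as the Leibniz rule does.\<close>

definition contract :: "('g \<Rightarrow> 'g multiset \<Rightarrow> 'k) \<Rightarrow> 'g multiset \<Rightarrow> 'k::comm_ring_1" where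
  "contract H M = (\<Sum>x\<in>#M. H x (M - {#x#}))"

lemma contract_empty [simp]: "contract H {#} = 0"
  by (simp add: contract_def)

lemma contract_add_mset:
  "contract H (add_mset a M) = H a M + contract (\<lambda>x N. H x (add_mset a N)) M"
proof -
  have "(\<Sum>x\<in>#M. H x (add_mset a M - {#x#})) = (\<Sum>x\<in>#M. H x (add_mset a (M - {#x#})))"
    by (rule arg_cong[of _ _ sum_mset], rule image_mset_cong) simp
  thus ?thesis by (simp add: contract_def)
qed

lemma contract_cong:
  "(\<And>x N. size M = Suc (size N) \<Longrightarrow> H x N = H' x N) \<Longrightarrow> contract H M = contract H' M"
  unfolding contract_def
  by (rule arg_cong[of _ _ sum_mset], rule image_mset_cong)
     (metis insert_DiffM size_add_mset)

lemma contract_add: "contract (\<lambda>x N. H x N + H' x N) M = contract H M + contract H' M"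
  by (simp add: contract_def sum_mset.distrib)

lemma contract_mult: "contract (\<lambda>x N. c * H x N) M = c * contract H M"
  by (simp add: contract_def sum_mset_distrib_left)

lemma contract_zero [simp]: "contract (\<lambda>x N. 0) M = 0"
  by (simp add: contract_def)

lemma contract_swap:
  "contract (\<lambda>x. contract (\<lambda>y. G x y)) M = contract (\<lambda>y. contract (\<lambda>x. G x y)) M"
proof (induction M arbitrary: G)
  case (add a M)
  \<comment> \<open>The element \<open>a\<close> is removed by the outer contraction, by the inner
    one, or by neither.\<close>
  have split: "contract (\<lambda>x. contract (\<lambda>y. H x y)) (add_mset a M) = contract (H a) M + contract (\<lambda>x. H x a) M +
      contract (\<lambda>x. contract (\<lambda>y N. H x y (add_mset a N))) M" for H
    by (simp add: contract_add_mset contract_add)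
  show ?case
    unfolding split by (subst add.IH) (simp add: split[of "\<lambda>y x. G x y"])
qed simp

locale char0_lie = lie_algebra scale br
  for scale :: "'k::field_char_0 \<Rightarrow> 'g::ab_group_add \<Rightarrow> 'g" and br
begin

sublocale char0_space scale ..

lemma br_antisym: "br x y = - br y x"
proof -
  have "br x y + br y x = 0"
    using bracket_self[of "x + y"] unfolding bracket_add_left bracket_add_right by (simp add: bracket_self add.commute)
  thus ?thesis by (simp add: eq_neg_iff_add_eq_0)
qed

lemma br_minus_left: "br (- x) y = - br x y"
  using bracket_scale_left[of "-1" x y] by simp

text \<open>The Leibniz rule for bracketing with \<open>x\<close> from the right, the form in which
  contractions meet the Jacobi identity.\<close>

lemma br_jacobi: "br (br a b) x = br (br a x) b + br a (br b x)"
proof -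
  have "br a (br b x) + br b (br x a) + br x (br a b) = 0" by (rule jacobi)
  moreover have "br b (br x a) = br (br a x) b"
    using br_antisym[of b "br x a"] br_antisym[of x a] by (simp add: br_minus_left)
  moreover have "br x (br a b) = - br (br a b) x" by (rule br_antisym)
  ultimately show ?thesis by (simp add: algebra_simps)
qed

definition slot_linear :: "('g \<Rightarrow> 'a \<Rightarrow> 'k) \<Rightarrow> bool" where
  "slot_linear \<phi> \<longleftrightarrow> (\<forall>x y M. \<phi> (x + y) M = \<phi> x M + \<phi> y M) \<and> (\<forall>c x M. \<phi> (scale c x) M = c * \<phi> x M)"

text \<open>Such a \<mu> is a linear functional on the symmetric algebra, given on monomials.
  Multisets have the symmetry built in, so linearity in one slot is linearity in all.\<close>

definition multilin :: "('g multiset \<Rightarrow> 'k) \<Rightarrow> bool" where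
  "multilin \<mu> \<longleftrightarrow> slot_linear (\<lambda>x M. \<mu> (add_mset x M))"

definition multilin2 :: "('g \<Rightarrow> 'g multiset \<Rightarrow> 'k) \<Rightarrow> bool" where
  "multilin2 \<phi> \<longleftrightarrow> slot_linear \<phi> \<and> (\<forall>\<xi>. multilin (\<phi> \<xi>))"

lemma slot_linearD:
  assumes "slot_linear \<phi>"
  shows "\<phi> (x + y) M = \<phi> x M + \<phi> y M" "\<phi> (scale c x) M = c * \<phi> x M" "\<phi> 0 M = 0" "\<phi> (- x) M = - \<phi> x M"
proof -
  show *: "\<phi> (x + y) M = \<phi> x M + \<phi> y M" "\<phi> (scale c x) M = c * \<phi> x M" for x y c
    using assms by (auto simp: slot_linear_def)
  show "\<phi> 0 M = 0" using *(2)[of 0 0] by simp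
  show "\<phi> (- x) M = - \<phi> x M" using *(2)[of "-1" x] by simp
qed

lemma slot_linear_fun:
  assumes "slot_linear \<phi>"
  shows "\<phi> (x + y) = (\<lambda>M. \<phi> x M + \<phi> y M)" "\<phi> (scale c x) = (\<lambda>M. c * \<phi> x M)"
  by (auto simp: slot_linearD[OF assms])

text \<open>For \<open>M\<close> consisting of n copies of \<eta> the value is n times \<phi> at
  [\<xi>, \<eta>] and n - 1 copies. On the generating function exp \<eta> this replaces \<xi> by (-
  ad \<eta>) \<xi>.\<close>

definition ad_contract :: "('g \<Rightarrow> 'g multiset \<Rightarrow> 'k) \<Rightarrow> 'g \<Rightarrow> 'g multiset \<Rightarrow> 'k" where
  "ad_contract \<phi> \<xi> M = contract (\<lambda>x. \<phi> (br \<xi> x)) M"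

lemma multilin2_ad_contract:
  assumes "multilin2 \<phi>"
  shows "multilin2 (ad_contract \<phi>)"
proof -
  have sl: "slot_linear \<phi>" and ml: "\<And>\<xi>. slot_linear (\<lambda>x M. \<phi> \<xi> (add_mset x M))"
    using assms by (auto simp: multilin2_def multilin_def)
  have "slot_linear (ad_contract \<phi>)"
    by (simp add: slot_linear_def ad_contract_def bracket_add_left bracket_scale_left slot_linear_fun[OF sl]
        contract_add contract_mult)
  moreover have "slot_linear (\<lambda>x M. ad_contract \<phi> \<xi> (add_mset x M))" for \<xi>
    by (simp add: slot_linear_def ad_contract_def contract_add_mset bracket_add_right bracket_scale_right
        slot_linear_fun[OF sl] slot_linearD(1,2)[OF ml] contract_add contract_mult algebra_simps)
  ultimately show ?thesis by (simp add: multilin2_def multilin_def)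
qed

lemma multilin2_ad_contract_pow: "multilin2 \<phi> \<Longrightarrow> multilin2 ((ad_contract ^^ k) \<phi>)"
  by (induction k) (simp_all add: multilin2_ad_contract)

text \<open>Each contraction uses up one element of the multiset; this makes the Todd sums
  finite.\<close>

lemma ad_contract_pow_eq_0: "size M < k \<Longrightarrow> (ad_contract ^^ k) \<phi> \<xi> M = 0"
proof (induction k arbitrary: \<xi> M)
  case (Suc k)
  have "contract (\<lambda>x. (ad_contract ^^ k) \<phi> (br \<xi> x)) M = contract (\<lambda>x N. 0) M"
    by (rule contract_cong) (use Suc in simp)
  thus ?case by (simp add: ad_contract_def[of "(ad_contract ^^ k) \<phi>"])
qed simp

text \<open>Contractions never enlarge the multiset. This permits truncating the inner Todd sum of a
  double action.\<close>

lemma ad_contract_pow_local: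
  assumes "\<And>\<xi> N. size N \<le> s \<Longrightarrow> \<phi> \<xi> N = \<psi> \<xi> N" "size M \<le> s"
  shows "(ad_contract ^^ k) \<phi> \<xi> M = (ad_contract ^^ k) \<psi> \<xi> M"
  using assms(2)
proof (induction k arbitrary: \<xi> M)
  case (Suc k)
  have "contract (\<lambda>x. (ad_contract ^^ k) \<phi> (br \<xi> x)) M = contract (\<lambda>x. (ad_contract ^^ k) \<psi> (br \<xi> x)) M"
    by (rule contract_cong) (use Suc in simp)
  thus ?case by (simp add: ad_contract_def[of "(ad_contract ^^ k) _"])
qed (simp add: assms(1))

definition insert_arg :: "('g multiset \<Rightarrow> 'k) \<Rightarrow> 'g \<Rightarrow> 'g multiset \<Rightarrow> 'k" where
  "insert_arg \<mu> \<xi> M = \<mu> (add_mset \<xi> M)"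

lemma multilin2_insert_arg: "multilin \<mu> \<Longrightarrow> multilin2 (insert_arg \<mu>)"
proof -
  assume "multilin \<mu>"
  hence "slot_linear (\<lambda>x M. \<mu> (add_mset x M))" by (simp add: multilin_def)
  hence sl: "\<mu> (add_mset (x + y) M) = \<mu> (add_mset x M) + \<mu> (add_mset y M)"
    "\<mu> (add_mset (scale c x) M) = c * \<mu> (add_mset x M)" for x y c M
    by (rule slot_linearD)+
  have "slot_linear (insert_arg \<mu>)"
    unfolding slot_linear_def insert_arg_def by (intro conjI allI sl)
  moreover have "slot_linear (\<lambda>x M. insert_arg \<mu> \<xi> (add_mset x M))" for \<xi>
    unfolding slot_linear_def insert_arg_def add_mset_commute[of \<xi>] by (intro conjI allI sl)
  ultimately show ?thesis unfolding multilin2_def multilin_def by blast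
qed

text \<open>\<open>act \<mu> \<xi>\<close> is \<open>\<mu>\<close> composed with the operator on the symmetric algebra that becomes left
  multiplication by \<open>\<xi>\<close> under symmetrisation. On \<open>exp \<eta>\<close> that operator is multiplication by
  \<open>\<Sum>\<^sub>k b\<^sub>k (- ad \<eta>)\<^sup>k \<xi>\<close>, with the coefficients \<open>b\<^sub>k\<close> of the Todd series.\<close>

definition act :: "('g multiset \<Rightarrow> 'k) \<Rightarrow> 'g \<Rightarrow> 'g multiset \<Rightarrow> 'k" where
  "act \<mu> \<xi> M = (\<Sum>k\<le>size M. fps_nth todd k * (ad_contract ^^ k) (insert_arg \<mu>) \<xi> M)"

lemma act_eq:
  assumes "size M \<le> n"
  shows "act \<mu> \<xi> M = (\<Sum>k\<le>n. fps_nth todd k * (ad_contract ^^ k) (insert_arg \<mu>) \<xi> M)"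
  unfolding act_def
  by (rule sum.mono_neutral_left) (use assms ad_contract_pow_eq_0 in auto)

lemma multilin2_act:
  assumes "multilin \<mu>"
  shows "multilin2 (act \<mu>)"
proof -
  have ml2: "multilin2 ((ad_contract ^^ k) (insert_arg \<mu>))" for k
    by (intro multilin2_ad_contract_pow multilin2_insert_arg assms)
  hence sl: "slot_linear ((ad_contract ^^ k) (insert_arg \<mu>))"
    and ml: "slot_linear (\<lambda>x M. (ad_contract ^^ k) (insert_arg \<mu>) \<xi> (add_mset x M))" for k \<xi>
    by (simp_all add: multilin2_def multilin_def)
  have "slot_linear (act \<mu>)"
    by (simp add: slot_linear_def act_def slot_linearD[OF sl] distrib_left sum.distrib sum_distrib_left mult_ac)
  moreover have "slot_linear (\<lambda>x M. act \<mu> \<xi> (add_mset x M))" for \<xi>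
    by (simp add: slot_linear_def act_def slot_linearD(1,2)[OF ml] distrib_left sum.distrib sum_distrib_left mult_ac
        del: sum.atMost_Suc)
  ultimately show ?thesis by (simp add: multilin2_def multilin_def)
qed

lemma multilin_act: "multilin \<mu> \<Longrightarrow> multilin (act \<mu> \<xi>)"
  using multilin2_act by (simp add: multilin2_def)

text \<open>All terms with k > 0 contain the bracket of \<eta> with itself.\<close>

lemma act_power:
  assumes "multilin \<mu>"
  shows "act \<mu> \<eta> (replicate_mset n \<eta>) = \<mu> (replicate_mset (Suc n) \<eta>)"
proof -
  have "(ad_contract ^^ Suc k) (insert_arg \<mu>) \<eta> (replicate_mset n \<eta>) = 0" for k
  proof -
    have "slot_linear ((ad_contract ^^ k) (insert_arg \<mu>))"
      using multilin2_ad_contract_pow[OF multilin2_insert_arg[OF assms]] by (simp add: multilin2_def)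
    thus ?thesis by (simp add: ad_contract_def contract_def bracket_self slot_linearD(3))
  qed
  hence "(\<Sum>k\<in>{..n} - {0}. fps_nth todd k * (ad_contract ^^ k) (insert_arg \<mu>) \<eta> (replicate_mset n \<eta>)) = 0"
    by (intro sum.neutral) (auto simp: gr0_conv_Suc simp del: funpow.simps)
  thus ?thesis unfolding act_def
    by (subst sum.remove[of _ 0]) (auto simp: insert_arg_def)
qed

subsection \<open>Commutators\<close>

definition con1 :: "('g \<Rightarrow> 'g \<Rightarrow> 'g multiset \<Rightarrow> 'k) \<Rightarrow> 'g \<Rightarrow> 'g \<Rightarrow> 'g multiset \<Rightarrow> 'k" where
  "con1 \<Phi> \<xi> \<eta> M = contract (\<lambda>x. \<Phi> (br \<xi> x) \<eta>) M"

definition con2 :: "('g \<Rightarrow> 'g \<Rightarrow> 'g multiset \<Rightarrow> 'k) \<Rightarrow> 'g \<Rightarrow> 'g \<Rightarrow> 'g multiset \<Rightarrow> 'k" where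
  "con2 \<Phi> \<xi> \<eta> M = contract (\<lambda>x. \<Phi> \<xi> (br \<eta> x)) M"

text \<open>Bookkeeping in two commuting variables: \<open>con p q\<close> is the operator of the
  monomial x^p y^q, where x contracts into the first argument and y into the second. Operator
  identities thus become identities of power series.\<close>

definition con :: "nat \<Rightarrow> nat \<Rightarrow> ('g \<Rightarrow> 'g \<Rightarrow> 'g multiset \<Rightarrow> 'k) \<Rightarrow> 'g \<Rightarrow> 'g \<Rightarrow> 'g multiset \<Rightarrow> 'k" where
  "con p q \<Phi> = (con1 ^^ p) ((con2 ^^ q) \<Phi>)"

lemma con1_con2: "con1 (con2 \<Phi>) = con2 (con1 \<Phi>)"
  by (intro ext) (simp add: con1_def con2_def [abs_def] con2_def contract_swap[of "\<lambda>x y. \<Phi> (br _ x) (br _ y)"] con1_def[abs_def])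

lemma con1_pow_con2: "(con1 ^^ p) (con2 \<Phi>) = con2 ((con1 ^^ p) \<Phi>)"
  by (induction p) (simp_all add: con1_con2)

lemma con_con1: "con p q (con1 \<Phi>) = con (Suc p) q \<Phi>"
proof -
  have "(con2 ^^ q) (con1 \<Phi>) = con1 ((con2 ^^ q) \<Phi>)"
    by (induction q) (simp_all add: con1_con2)
  thus ?thesis by (simp add: con_def funpow_swap1)
qed

lemma con_con2: "con p q (con2 \<Phi>) = con p (Suc q) \<Phi>"
  by (simp add: con_def funpow_swap1)

lemma con2_pow_con: "(con2 ^^ j) (con p q \<Phi>) = con p (j + q) \<Phi>"
proof (induction j)
  case (Suc j)
  thus ?case by (simp add: con_def con1_pow_con2)
qed simp

lemma con_lincomb:
  "con p q (\<lambda>\<xi> \<eta> M. \<Sum>i\<in>I. c i * \<Phi> i \<xi> \<eta> M) = (\<lambda>\<xi> \<eta> M. \<Sum>i\<in>I. c i * con p q (\<Phi> i) \<xi> \<eta> M)"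
proof -
  have c: "contract (\<lambda>x N. \<Sum>i\<in>I. c i * H i x N) M = (\<Sum>i\<in>I. c i * contract (H i) M)"
    for H :: "_ \<Rightarrow> 'g \<Rightarrow> _ \<Rightarrow> 'k" and M
    by (induction I rule: infinite_finite_induct) (simp_all add: contract_add contract_mult)
  have 2: "(con2 ^^ q) (\<lambda>\<xi> \<eta> M. \<Sum>i\<in>I. c i * \<Phi> i \<xi> \<eta> M) = (\<lambda>\<xi> \<eta> M. \<Sum>i\<in>I. c i * (con2 ^^ q) (\<Phi> i) \<xi> \<eta> M)"
    for \<Phi> by (induction q) (simp_all add: con2_def[abs_def] c)
  have 1: "(con1 ^^ p) (\<lambda>\<xi> \<eta> M. \<Sum>i\<in>I. c i * \<Phi> i \<xi> \<eta> M) = (\<lambda>\<xi> \<eta> M. \<Sum>i\<in>I. c i * (con1 ^^ p) (\<Phi> i) \<xi> \<eta> M)"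
    for \<Phi> by (induction p) (simp_all add: con1_def[abs_def] c)
  show ?thesis by (simp add: con_def 1 2)
qed

lemma con_add:
  "con p q (\<lambda>\<xi> \<eta> M. \<Phi> \<xi> \<eta> M + \<Psi> \<xi> \<eta> M) = (\<lambda>\<xi> \<eta> M. con p q \<Phi> \<xi> \<eta> M + con p q \<Psi> \<xi> \<eta> M)"
  using con_lincomb[where I = UNIV and c = "\<lambda>_. 1" and \<Phi> = "\<lambda>b::bool. if b then \<Phi> else \<Psi>"] by (simp add: UNIV_bool add.commute)

lemma con_eq_0: "size M < p + q \<Longrightarrow> con p q \<Phi> \<xi> \<eta> M = 0"
proof (induction p arbitrary: \<xi> \<eta> M)
  case 0
  thus ?case
  proof (induction q arbitrary: \<xi> \<eta> M)
    case (Suc q)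
    have "contract (\<lambda>x. (con2 ^^ q) \<Phi> \<xi> (br \<eta> x)) M = contract (\<lambda>x N. 0) M"
      by (rule contract_cong) (use Suc in \<open>simp add: con_def\<close>)
    thus ?case by (simp add: con_def con2_def)
  qed simp
next
  case (Suc p)
  have "contract (\<lambda>x. con p q \<Phi> (br \<xi> x) \<eta>) M = contract (\<lambda>x N. 0) M"
    by (rule contract_cong) (use Suc in simp)
  thus ?case by (simp add: con_def con1_def)
qed

lemma con_swap: "con p q (\<lambda>\<xi> \<eta>. \<Phi> \<eta> \<xi>) = (\<lambda>\<xi> \<eta>. con q p \<Phi> \<eta> \<xi>)"
proof -
  have 2: "(con2 ^^ q) (\<lambda>\<xi> \<eta>. \<Phi> \<eta> \<xi>) = (\<lambda>\<xi> \<eta>. (con1 ^^ q) \<Phi> \<eta> \<xi>)" for \<Phi>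
    by (induction q) (simp_all add: con1_def[abs_def] con2_def[abs_def])
  have 1: "(con1 ^^ p) (\<lambda>\<xi> \<eta>. \<Phi> \<eta> \<xi>) = (\<lambda>\<xi> \<eta>. (con2 ^^ p) \<Phi> \<eta> \<xi>)" for \<Phi>
    by (induction p) (simp_all add: con1_def[abs_def] con2_def[abs_def])
  have 3: "(con2 ^^ p) ((con1 ^^ q) \<Phi>) = (con1 ^^ q) ((con2 ^^ p) \<Phi>)"
    by (induction p) (simp_all add: con1_pow_con2)
  show ?thesis by (simp add: con_def 1 2 3)
qed

definition insert2 :: "('g \<Rightarrow> 'g multiset \<Rightarrow> 'k) \<Rightarrow> 'g \<Rightarrow> 'g \<Rightarrow> 'g multiset \<Rightarrow> 'k" where
  "insert2 \<phi> \<xi> \<eta> M = \<phi> \<xi> (add_mset \<eta> M)"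

definition bracket_args :: "('g \<Rightarrow> 'g multiset \<Rightarrow> 'k) \<Rightarrow> 'g \<Rightarrow> 'g \<Rightarrow> 'g multiset \<Rightarrow> 'k" where
  "bracket_args \<phi> \<xi> \<eta> M = \<phi> (br \<xi> \<eta>) M"

text \<open>A contraction over the enlarged multiset meets either an element of \<open>M\<close> or
  the inserted \<eta>.\<close>

lemma insert2_ad_contract:
  "insert2 (ad_contract \<phi>) = (\<lambda>\<xi> \<eta> M. con1 (insert2 \<phi>) \<xi> \<eta> M + bracket_args \<phi> \<xi> \<eta> M)"
  by (intro ext) (simp add: insert2_def[abs_def] ad_contract_def contract_add_mset con1_def bracket_args_def)

text \<open>By Jacobi, contracting into a bracket contracts into either argument: in the variables,
  multiplication by x + y.\<close>

lemma bracket_args_ad_contract: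
  assumes "slot_linear \<phi>"
  shows "bracket_args (ad_contract \<phi>) =
    (\<lambda>\<xi> \<eta> M. con1 (bracket_args \<phi>) \<xi> \<eta> M + con2 (bracket_args \<phi>) \<xi> \<eta> M)"
proof (intro ext)
  fix \<xi> \<eta> M
  have "contract (\<lambda>x. \<phi> (br (br \<xi> \<eta>) x)) M = contract (\<lambda>x N. \<phi> (br (br \<xi> x) \<eta>) N + \<phi> (br \<xi> (br \<eta> x)) N) M"
    by (simp add: br_jacobi[of \<xi> \<eta>] slot_linear_fun(1)[OF assms])
  thus "bracket_args (ad_contract \<phi>) \<xi> \<eta> M = con1 (bracket_args \<phi>) \<xi> \<eta> M + con2 (bracket_args \<phi>) \<xi> \<eta> M"
    by (simp add: bracket_args_def[abs_def] ad_contract_def con1_def con2_def contract_add)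
qed

text \<open>In the variables, the power contributes x^k to the inserted part and ((x+y)^k - x^k)/y
  to the bracket part. This is the origin of the divided difference in the Todd identity.\<close>

lemma insert2_ad_contract_pow:
  assumes "multilin2 \<phi>"
  shows "insert2 ((ad_contract ^^ k) \<phi>) \<xi> \<eta> M = con k 0 (insert2 \<phi>) \<xi> \<eta> M +
    (\<Sum>r<k. of_nat (k choose Suc r) * con (k - Suc r) r (bracket_args \<phi>) \<xi> \<eta> M)"
  using assms
proof (induction k arbitrary: \<phi>)
  case (Suc k)
  have sl: "slot_linear \<phi>" using Suc.prems by (simp add: multilin2_def)
  define c where "c p r = con p r (bracket_args \<phi>) \<xi> \<eta> M" for p r
  have "insert2 ((ad_contract ^^ Suc k) \<phi>) \<xi> \<eta> M = insert2 ((ad_contract ^^ k) (ad_contract \<phi>)) \<xi> \<eta> M"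
    by (simp add: funpow_swap1)
  also have "\<dots> = con k 0 (insert2 (ad_contract \<phi>)) \<xi> \<eta> M +
    (\<Sum>r<k. of_nat (k choose Suc r) * con (k - Suc r) r (bracket_args (ad_contract \<phi>)) \<xi> \<eta> M)"
    by (rule Suc.IH[OF multilin2_ad_contract[OF Suc.prems]])
  also have "con k 0 (insert2 (ad_contract \<phi>)) \<xi> \<eta> M = con (Suc k) 0 (insert2 \<phi>) \<xi> \<eta> M + c k 0"
    by (simp add: insert2_ad_contract con_add con_con1 c_def)
  also have "(\<Sum>r<k. of_nat (k choose Suc r) * con (k - Suc r) r (bracket_args (ad_contract \<phi>)) \<xi> \<eta> M) =
      (\<Sum>r<k. of_nat (k choose Suc r) * c (k - r) r) + (\<Sum>r<k. of_nat (k choose Suc r) * c (k - Suc r) (Suc r))"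
    by (simp add: bracket_args_ad_contract[OF sl] con_add con_con1 con_con2 c_def distrib_left Suc_diff_Suc flip: sum.distrib)
  also have "(\<Sum>r<k. of_nat (k choose Suc r) * c (k - r) r) = (\<Sum>r<Suc k. of_nat (k choose Suc r) * c (k - r) r)"
    by (simp add: binomial_eq_0)
  also have "c k 0 + (\<Sum>r<k. of_nat (k choose Suc r) * c (k - Suc r) (Suc r)) =
      (\<Sum>r<Suc k. of_nat (k choose r) * c (k - r) r)"
    by (simp add: sum.lessThan_Suc_shift del: sum.lessThan_Suc)
  hence "con (Suc k) 0 (insert2 \<phi>) \<xi> \<eta> M + c k 0 + ((\<Sum>r<Suc k. of_nat (k choose Suc r) * c (k - r) r) +
      (\<Sum>r<k. of_nat (k choose Suc r) * c (k - Suc r) (Suc r))) =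
     con (Suc k) 0 (insert2 \<phi>) \<xi> \<eta> M + ((\<Sum>r<Suc k. of_nat (k choose Suc r) * c (k - r) r) +
      (\<Sum>r<Suc k. of_nat (k choose r) * c (k - r) r))"
    by (simp add: add_ac del: sum.lessThan_Suc)
  also have "(\<Sum>r<Suc k. of_nat (k choose Suc r) * c (k - r) r) + (\<Sum>r<Suc k. of_nat (k choose r) * c (k - r) r) =
      (\<Sum>r<Suc k. of_nat (Suc k choose Suc r) * c (Suc k - Suc r) r)"
    unfolding sum.distrib[symmetric] by (rule sum.cong) (simp_all add: algebra_simps)
  finally show ?case by (simp only: c_def)
qed (simp add: con_def)

lemma bracket_args_ad_contract_pow:
  assumes "multilin2 \<phi>"
  shows "bracket_args ((ad_contract ^^ k) \<phi>) \<xi> \<eta> M =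
    (\<Sum>r\<le>k. of_nat (k choose r) * con (k - r) r (bracket_args \<phi>) \<xi> \<eta> M)"
  using assms
proof (induction k arbitrary: \<phi>)
  case (Suc k)
  have sl: "slot_linear \<phi>" using Suc.prems by (simp add: multilin2_def)
  define c where "c p r = con p r (bracket_args \<phi>) \<xi> \<eta> M" for p r
  have "bracket_args ((ad_contract ^^ Suc k) \<phi>) \<xi> \<eta> M = bracket_args ((ad_contract ^^ k) (ad_contract \<phi>)) \<xi> \<eta> M"
    by (simp add: funpow_swap1)
  also have "\<dots> = (\<Sum>r\<le>k. of_nat (k choose r) * con (k - r) r (bracket_args (ad_contract \<phi>)) \<xi> \<eta> M)"
    by (rule Suc.IH[OF multilin2_ad_contract[OF Suc.prems]])
  also have "\<dots> = (\<Sum>r\<le>k. of_nat (k choose r) * c (Suc k - r) r) + (\<Sum>r\<le>k. of_nat (k choose r) * c (k - r) (Suc r))"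
    by (simp add: bracket_args_ad_contract[OF sl] con_add con_con1 con_con2 c_def distrib_left Suc_diff_le flip: sum.distrib)
  also have "(\<Sum>r\<le>k. of_nat (k choose r) * c (k - r) (Suc r)) =
      (\<Sum>r\<le>Suc k. (if r = 0 then 0 else of_nat (k choose (r - 1)) * c (Suc k - r) r))"
    by (simp add: sum.atMost_Suc_shift del: sum.atMost_Suc)
  also have "(\<Sum>r\<le>k. of_nat (k choose r) * c (Suc k - r) r) = (\<Sum>r\<le>Suc k. of_nat (k choose r) * c (Suc k - r) r)"
    by (simp add: binomial_eq_0)
  also have "(\<Sum>r\<le>Suc k. of_nat (k choose r) * c (Suc k - r) r) +
      (\<Sum>r\<le>Suc k. (if r = 0 then 0 else of_nat (k choose (r - 1)) * c (Suc k - r) r)) =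
      (\<Sum>r\<le>Suc k. of_nat (Suc k choose r) * c (Suc k - r) r)"
    unfolding sum.distrib[symmetric]
  proof (rule sum.cong[OF refl])
    fix r show "of_nat (k choose r) * c (Suc k - r) r +
      (if r = 0 then 0 else of_nat (k choose (r - 1)) * c (Suc k - r) r) = of_nat (Suc k choose r) * c (Suc k - r) r"
      by (cases r) (simp_all add: algebra_simps)
  qed
  finally show ?case by (simp only: c_def)
qed (simp add: con_def)

text \<open>With T the Todd series, the double action is T(x) T(y) on the part with both arguments
  inserted plus T(y) (T(x+y) - T(x))/y on the bracket part. Antisymmetrising cancels the former and
  adds to the latter its mirror image; by the Todd identity T(x+y) results, the action of the
  bracket.\<close>

lemma act_commutator:
  assumes "multilin \<mu>"
  shows "act (act \<mu> \<xi>) \<eta> M - act (act \<mu> \<eta>) \<xi> M = act \<mu> (br \<xi> \<eta>) M"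
proof -
  let ?b = "fps_nth (todd :: 'k fps)"
  define \<phi> where "\<phi> = insert_arg \<mu>"
  define s where "s = size M"
  have ml: "multilin2 \<phi>" unfolding \<phi>_def by (rule multilin2_insert_arg) fact
  define A where "A \<xi> \<eta> p q = con p q (bracket_args \<phi>) \<xi> \<eta> M" for \<xi> \<eta> p q
  define S where "S \<xi> \<eta> p q = con p q (insert2 \<phi>) \<xi> \<eta> M" for \<xi> \<eta> p q
  define G where "G p q = (\<Sum>j\<le>q. ?b j * ?b (p + q + 1 - j) * of_nat ((p + q + 1 - j) choose p))" for p q
  have A0: "A \<xi> \<eta> p q = 0" if "s < p + q" for \<xi> \<eta> p q
    using that by (simp add: A_def s_def con_eq_0)
  have A0': "A \<xi> \<eta> p q \<noteq> 0 \<Longrightarrow> p + q \<le> s" for \<xi> \<eta> p q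
    using A0 linorder_not_le by blast
  define T where "T = {(p, q). p + q \<le> s}"
  have finT: "finite T" by (rule finite_subset[of _ "{..s} \<times> {..s}"]) (auto simp: T_def)
  \<comment> \<open>The inner action is evaluated with \<eta> inserted, on up to
    \<open>Suc s\<close> elements; this bound is used for both Todd sums.\<close>
  have double: "act (act \<mu> \<xi>) \<eta> M =
      (\<Sum>j\<le>Suc s. \<Sum>k\<le>Suc s. ?b j * ?b k * S \<xi> \<eta> k j) + (\<Sum>(p, q)\<in>T. G p q * A \<xi> \<eta> p q)" for \<xi> \<eta>
  proof -
    define \<psi> where "\<psi> = (\<lambda>\<xi> \<eta> M. \<Sum>k\<le>Suc s. ?b k * insert2 ((ad_contract ^^ k) \<phi>) \<xi> \<eta> M)"
    have con0: "(con2 ^^ j) \<Psi> \<xi> = (ad_contract ^^ j) (\<Psi> \<xi>)" for j \<Psi> \<xi>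
    proof (induction j)
      case (Suc j)
      show ?case by (intro ext) (simp add: con2_def[of "(con2 ^^ _) _"] ad_contract_def[of "(ad_contract ^^ _) _"] Suc)
    qed simp
    have "act (act \<mu> \<xi>) \<eta> M = (\<Sum>j\<le>Suc s. ?b j * (ad_contract ^^ j) (insert_arg (act \<mu> \<xi>)) \<eta> M)"
      by (rule act_eq) (simp add: s_def)
    also have "\<dots> = (\<Sum>j\<le>Suc s. ?b j * (ad_contract ^^ j) (\<psi> \<xi>) \<eta> M)"
    proof (intro sum.cong refl arg_cong2[of _ _ _ _ "(*)"] ad_contract_pow_local[of s])
      fix \<eta> and N :: "'g multiset" assume "size N \<le> s"
      thus "insert_arg (act \<mu> \<xi>) \<eta> N = \<psi> \<xi> \<eta> N"
        unfolding insert_arg_def[of "act \<mu> \<xi>"] by (subst act_eq[of _ "Suc s"]) (simp_all add: \<psi>_def insert2_def \<phi>_def)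
    qed (simp add: s_def)
    also have "\<dots> = (\<Sum>j\<le>Suc s. ?b j * con 0 j \<psi> \<xi> \<eta> M)"
      by (simp only: con_def con0 funpow.simps id_def)
    also have "\<dots> = (\<Sum>j\<le>Suc s. \<Sum>k\<le>Suc s. ?b j * ?b k * con 0 j (insert2 ((ad_contract ^^ k) \<phi>)) \<xi> \<eta> M)"
      unfolding \<psi>_def con_lincomb by (simp only: sum_distrib_left mult.assoc)
    also have "\<dots> = (\<Sum>j\<le>Suc s. \<Sum>k\<le>Suc s. ?b j * ?b k * (S \<xi> \<eta> k j +
        (\<Sum>r<k. of_nat (k choose Suc r) * A \<xi> \<eta> (k - Suc r) (j + r))))"
    proof (intro sum.cong refl arg_cong2[of _ _ _ _ "(*)"])
      fix j k
      have e: "insert2 ((ad_contract ^^ k) \<phi>) = (\<lambda>\<xi> \<eta> M. con k 0 (insert2 \<phi>) \<xi> \<eta> M +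
          (\<Sum>r<k. of_nat (k choose Suc r) * con (k - Suc r) r (bracket_args \<phi>) \<xi> \<eta> M))"
        by (intro ext insert2_ad_contract_pow ml)
      have cc: "con 0 j (con p q \<Phi>) = con p (j + q) \<Phi>" for p q \<Phi>
        using con2_pow_con[of j p q \<Phi>] by (simp add: con_def)
      show "con 0 j (insert2 ((ad_contract ^^ k) \<phi>)) \<xi> \<eta> M = S \<xi> \<eta> k j +
        (\<Sum>r<k. of_nat (k choose Suc r) * A \<xi> \<eta> (k - Suc r) (j + r))"
        unfolding e con_add con_lincomb cc S_def A_def by simp
    qed
    also have "\<dots> = (\<Sum>j\<le>Suc s. \<Sum>k\<le>Suc s. ?b j * ?b k * S \<xi> \<eta> k j) +
        (\<Sum>j\<le>Suc s. \<Sum>k\<le>Suc s. \<Sum>r<k. ?b j * ?b k * of_nat (k choose Suc r) * A \<xi> \<eta> (k - Suc r) (j + r))"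
      by (simp only: distrib_left sum.distrib sum_distrib_left mult.assoc)
    also have "(\<Sum>j\<le>Suc s. \<Sum>k\<le>Suc s. \<Sum>r<k. ?b j * ?b k * of_nat (k choose Suc r) * A \<xi> \<eta> (k - Suc r) (j + r)) =
        (\<Sum>(j, k, r)\<in>(SIGMA j:{..Suc s}. SIGMA k:{..Suc s}. {..<k}).
          ?b j * ?b k * of_nat (k choose Suc r) * A \<xi> \<eta> (k - Suc r) (j + r))"
      by (simp only: sum.Sigma finite_atMost finite_lessThan finite_SigmaI ball_simps split_def)
         (simp add: sum.Sigma split_def del: sum.atMost_Suc)
    also have "\<dots> = (\<Sum>(j, k, r)\<in>{(j, k, r). r < k \<and> k - 1 + j \<le> s}.
          ?b j * ?b k * of_nat (k choose Suc r) * A \<xi> \<eta> (k - Suc r) (j + r))"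
      by (rule sum.mono_neutral_right) (auto dest!: A0')
    also have "\<dots> = (\<Sum>((p, q), j)\<in>(SIGMA pq:T. {..snd pq}).
        ?b j * ?b (p + q + 1 - j) * of_nat ((p + q + 1 - j) choose p) * A \<xi> \<eta> p q)"
    \<comment> \<open>Terms are sorted by p = k - 1 - r and q = j + r, so that k = p + q + 1 -
      j.\<close>
    proof (rule sum.reindex_bij_witness[of _ "\<lambda>((p, q), j). (j, p + q + 1 - j, q - j)" "\<lambda>(j, k, r). ((k - Suc r, j + r), j)"])
      fix a assume a: "a \<in> {(j, k, r). r < k \<and> k - 1 + j \<le> s}"
      obtain j k r where jkr: "a = (j, k, r)" by (cases a)
      with a have r: "r < k" "k - 1 + j \<le> s" by auto
      have e: "k - Suc r + (j + r) + 1 - j = k" using r by simp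
      have "k choose Suc r = k choose (k - Suc r)" using r by (intro binomial_symmetric) simp
      with e show "(case case a of (j, k, r) \<Rightarrow> ((k - Suc r, j + r), j) of
          (x, xa) \<Rightarrow> (case x of (p, q) \<Rightarrow> \<lambda>j. ?b j * ?b (p + q + 1 - j) * of_nat (p + q + 1 - j choose p) * A \<xi> \<eta> p q) xa) =
         (case a of (j, k, r) \<Rightarrow> ?b j * ?b k * of_nat (k choose Suc r) * A \<xi> \<eta> (k - Suc r) (j + r))"
        unfolding jkr prod.case e by simp
    qed (auto simp: T_def)
    also have "\<dots> = (\<Sum>pq\<in>T. \<Sum>j\<le>snd pq. case pq of (p, q) \<Rightarrow>
        ?b j * ?b (p + q + 1 - j) * of_nat ((p + q + 1 - j) choose p) * A \<xi> \<eta> p q)"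
      by (subst sum.Sigma) (auto simp: finT split_def)
    also have "\<dots> = (\<Sum>(p, q)\<in>T. G p q * A \<xi> \<eta> p q)"
      by (intro sum.cong refl) (auto simp: G_def sum_distrib_right)
    finally show ?thesis .
  qed
  \<comment> \<open>Two inserted arguments commute in a multiset; hence the inserted parts cancel in
    the commutator.\<close>
  have sym: "insert2 \<phi> = (\<lambda>\<xi> \<eta>. insert2 \<phi> \<eta> \<xi>)"
    unfolding insert2_def \<phi>_def insert_arg_def by (intro ext arg_cong[of _ _ \<mu>] add_mset_commute)
  have Ssym: "S \<eta> \<xi> p q = S \<xi> \<eta> q p" for p q
    using con_swap[of p q "insert2 \<phi>"] unfolding sym[symmetric] S_def by metis
  have sl: "slot_linear \<phi>" using ml by (simp add: multilin2_def)
  \<comment> \<open>The sign is written as a one-term linear combination so that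
    \<open>con_lincomb\<close> applies.\<close>
  have anti: "bracket_args \<phi> = (\<lambda>\<xi> \<eta> M. \<Sum>i\<in>{()}. - 1 * bracket_args \<phi> \<eta> \<xi> M)"
  proof (intro ext)
    fix \<xi> \<eta> M
    show "bracket_args \<phi> \<xi> \<eta> M = (\<Sum>i\<in>{()}. - 1 * bracket_args \<phi> \<eta> \<xi> M)"
      unfolding bracket_args_def by (subst br_antisym) (simp add: slot_linearD(4)[OF sl])
  qed
  have Aanti: "A \<eta> \<xi> p q = - A \<xi> \<eta> q p" for p q
    unfolding A_def by (subst anti) (simp only: con_lincomb con_swap[of _ _ "bracket_args \<phi>"], simp)
  have "(\<Sum>j\<le>Suc s. \<Sum>k\<le>Suc s. ?b j * ?b k * S \<eta> \<xi> k j) = (\<Sum>j\<le>Suc s. \<Sum>k\<le>Suc s. ?b k * ?b j * S \<xi> \<eta> j k)"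
    by (simp only: Ssym mult.commute)
  also have "\<dots> = (\<Sum>j\<le>Suc s. \<Sum>k\<le>Suc s. ?b j * ?b k * S \<xi> \<eta> k j)"
    by (rule sum.swap)
  finally have "act (act \<mu> \<xi>) \<eta> M - act (act \<mu> \<eta>) \<xi> M =
     (\<Sum>(p, q)\<in>T. G p q * A \<xi> \<eta> p q) + (\<Sum>(p, q)\<in>T. G p q * A \<xi> \<eta> q p)"
    unfolding double[of \<xi> \<eta>] double[of \<eta> \<xi>] Aanti by (simp add: split_def sum_negf)
  also have "(\<Sum>(p, q)\<in>T. G p q * A \<xi> \<eta> q p) = (\<Sum>(p, q)\<in>T. G q p * A \<xi> \<eta> p q)"
    by (rule sum.reindex_bij_witness[of _ prod.swap prod.swap]) (auto simp: T_def add.commute)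
  also have "(\<Sum>(p, q)\<in>T. G p q * A \<xi> \<eta> p q) + \<dots> = (\<Sum>(p, q)\<in>T. (G p q + G q p) * A \<xi> \<eta> p q)"
    by (simp add: split_def distrib_right flip: sum.distrib)
  also have "\<dots> = (\<Sum>(p, q)\<in>T. of_nat ((p + q) choose p) * ?b (p + q) * A \<xi> \<eta> p q)"
    unfolding G_def todd_coeffs ..
  also have "\<dots> = (\<Sum>k\<le>s. \<Sum>p\<le>k. of_nat (k choose p) * ?b k * A \<xi> \<eta> p (k - p))"
    unfolding T_def by (subst sum.triangle_reindex_eq) simp
  also have "\<dots> = (\<Sum>k\<le>s. \<Sum>r\<le>k. of_nat (k choose r) * ?b k * A \<xi> \<eta> (k - r) r)"
  proof (rule sum.cong[OF refl])
    fix k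
    show "(\<Sum>p\<le>k. of_nat (k choose p) * ?b k * A \<xi> \<eta> p (k - p)) = (\<Sum>r\<le>k. of_nat (k choose r) * ?b k * A \<xi> \<eta> (k - r) r)"
      by (rule sum.reindex_bij_witness[of _ "\<lambda>r. k - r" "\<lambda>p. k - p"]) (auto simp: binomial_symmetric[of _ k, symmetric])
  qed
  also have "\<dots> = (\<Sum>k\<le>s. ?b k * bracket_args ((ad_contract ^^ k) \<phi>) \<xi> \<eta> M)"
    unfolding bracket_args_ad_contract_pow[OF ml] A_def by (simp add: sum_distrib_left mult_ac)
  also have "\<dots> = act \<mu> (br \<xi> \<eta>) M"
    by (simp add: act_def s_def \<phi>_def bracket_args_def)
  finally show ?thesis .
qed

end

section \<open>Injectivity of the symmetrisation\<close>

lemma vector_space_mult: "vector_space ((*) :: 'k::field \<Rightarrow> 'k \<Rightarrow> 'k)"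
  by unfold_locales (simp_all add: algebra_simps)

text \<open>A basis of \<open>V\<close> stays independent when \<open>x\<close> is added, so a
  functional can be prescribed there and extended.\<close>

lemma (in vector_space) separating_functional:
  assumes V: "subspace V" and x: "x \<notin> V"
  shows "\<exists>l. Vector_Spaces.linear scale (*) l \<and> (\<forall>v\<in>V. l v = 0) \<and> l x = 1"
proof -
  interpret k: vector_space "(*) :: 'a \<Rightarrow> 'a \<Rightarrow> 'a" by (rule vector_space_mult)
  interpret p: vector_space_pair scale "(*) :: 'a \<Rightarrow> 'a \<Rightarrow> 'a" ..
  obtain B where B: "B \<subseteq> V" "independent B" "V \<subseteq> span B"
    using maximal_independent_subset[of V] by blast
  have "span B \<subseteq> V" using B(1) V by (simp add: span_minimal)
  hence "independent (insert x B)" using x B(2) by (intro independent_insertI) auto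
  then obtain l where l: "Vector_Spaces.linear scale (*) l" "\<forall>b\<in>insert x B. l b = (if b = x then 1 else 0)"
    using p.linear_independent_extend[of "insert x B" "\<lambda>b. if b = x then 1 else 0"] by blast
  have "x \<notin> B" using x B(1) by blast
  hence "\<forall>b\<in>B. l b = 0" using l(2) by auto
  hence "l v = 0" if "v \<in> V" for v
    using p.linear_eq_0_on_span[OF l(1), of B v] B(3) that by blast
  thus ?thesis using l by auto
qed

context char0_lie
begin

lemma act_add_fun: "act (\<lambda>M. \<mu> M + \<nu> M) \<xi> = (\<lambda>M. act \<mu> \<xi> M + act \<nu> \<xi> M)"
  and act_mult_fun: "act (\<lambda>M. c * \<mu> M) \<xi> = (\<lambda>M. c * act \<mu> \<xi> M)"
proof -
  have "(ad_contract ^^ k) (\<lambda>\<xi> M. \<phi> \<xi> M + \<psi> \<xi> M) = (\<lambda>\<xi> M. (ad_contract ^^ k) \<phi> \<xi> M + (ad_contract ^^ k) \<psi> \<xi> M)" for \<phi> \<psi> k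
    by (induction k) (simp_all add: ad_contract_def[abs_def] contract_add)
  moreover have "insert_arg (\<lambda>M. \<mu> M + \<nu> M) = (\<lambda>\<xi> M. insert_arg \<mu> \<xi> M + insert_arg \<nu> \<xi> M)"
    by (simp add: insert_arg_def[abs_def])
  ultimately show "act (\<lambda>M. \<mu> M + \<nu> M) \<xi> = (\<lambda>M. act \<mu> \<xi> M + act \<nu> \<xi> M)"
    by (intro ext) (simp add: act_def distrib_left sum.distrib)
  have "(ad_contract ^^ k) (\<lambda>\<xi> M. c * \<phi> \<xi> M) = (\<lambda>\<xi> M. c * (ad_contract ^^ k) \<phi> \<xi> M)" for \<phi> k
    by (induction k) (simp_all add: ad_contract_def[abs_def] contract_mult)
  moreover have "insert_arg (\<lambda>M. c * \<mu> M) = (\<lambda>\<xi> M. c * insert_arg \<mu> \<xi> M)"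
    by (simp add: insert_arg_def[abs_def])
  ultimately show "act (\<lambda>M. c * \<mu> M) \<xi> = (\<lambda>M. c * act \<mu> \<xi> M)"
    by (intro ext) (simp add: act_def sum_distrib_left mult_ac)
qed

lemma foldl_act_add: "foldl act (\<lambda>M. \<mu> M + \<nu> M) w = (\<lambda>M. foldl act \<mu> w M + foldl act \<nu> w M)"
  by (induction w arbitrary: \<mu> \<nu>) (simp_all add: act_add_fun)

lemma foldl_act_mult: "foldl act (\<lambda>M. c * \<mu> M) w = (\<lambda>M. c * foldl act \<mu> w M)"
  by (induction w arbitrary: \<mu>) (simp_all add: act_mult_fun)

lemma multilin_foldl_act: "multilin \<mu> \<Longrightarrow> multilin (foldl act \<mu> w)"
  by (induction w arbitrary: \<mu>) (simp_all add: multilin_act)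

lemma foldl_act_power:
  "multilin \<mu> \<Longrightarrow> foldl act \<mu> (replicate n \<eta>) (replicate_mset m \<eta>) = \<mu> (replicate_mset (n + m) \<eta>)"
  by (induction n arbitrary: \<mu>) (simp_all add: multilin_act act_power del: replicate_mset_Suc)

text \<open>\<open>L\<close> sends a word to the value of \<mu> after its letters have acted on 1,
  the empty multiset. Transposition reverses composition, so the letters are folded in from the
  left.\<close>

lemma dual_functional:
  assumes "multilin \<mu>"
  shows "\<exists>L. Vector_Spaces.linear fsc (*) L \<and> (\<forall>f\<in>idl br. L f = 0) \<and>
    (\<forall>n \<eta>. L (word (replicate n \<eta>)) = \<mu> (replicate_mset n \<eta>))"
proof -
  interpret k: vector_space "(*) :: 'k \<Rightarrow> 'k \<Rightarrow> 'k" by (rule vector_space_mult)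
  define L where "L = lext (*) (\<lambda>w. foldl act \<mu> w {#})"
  have lin: "Vector_Spaces.linear fsc (*) L" unfolding L_def by (rule lext_linear) unfold_locales
  have Lw: "L (word w) = foldl act \<mu> w {#}" for w unfolding L_def by (rule lext_word) unfold_locales
  have sl: "slot_linear (act (foldl act \<mu> u))" for u
    using multilin2_act[OF multilin_foldl_act[OF assms]] by (simp add: multilin2_def)
  have "L f = 0" if "f \<in> idl br" for f
  proof -
    have "L f \<in> {0}"
    proof (rule idl_linear_induct[OF lin _ _ _ _ that])
      show "k.subspace {0}" by (rule k.subspace_single_0)
      show "L (word (u @ (x + y) # v)) - (L (word (u @ x # v)) + L (word (u @ y # v))) \<in> {0}" for u x y v
        by (simp add: Lw slot_linear_fun[OF sl] foldl_act_add)
      show "L (word (u @ scale c x # v)) - c * L (word (u @ x # v)) \<in> {0}" for u c x v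
        by (simp add: Lw slot_linear_fun[OF sl] foldl_act_mult)
      show "L (word (u @ x # y # v)) - (L (word (u @ y # x # v)) + L (word (u @ br x y # v))) \<in> {0}" for u x y v
      proof -
        have "act (act (foldl act \<mu> u) x) y = (\<lambda>M. act (act (foldl act \<mu> u) y) x M + act (foldl act \<mu> u) (br x y) M)"
          using act_commutator[OF multilin_foldl_act[OF assms], of u x y] by (auto simp: algebra_simps)
        thus ?thesis by (simp add: Lw foldl_act_add)
      qed
    qed
    thus ?thesis by simp
  qed
  moreover have "L (word (replicate n \<eta>)) = \<mu> (replicate_mset n \<eta>)" for n \<eta>
    using foldl_act_power[OF assms, of n \<eta> 0] by (simp add: Lw)
  ultimately show ?thesis using lin by blast
qed

text \<open>A functional vanishing on \<open>idl0\<close> but not at \<open>f\<close> is a function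
  \<mu> on multisets. The dual functional \<open>L\<close> composed with \<open>symm\<close> agrees
  with it on powers, hence everywhere, so \<open>L (symm f)\<close> would be both 0 and 1.\<close>

theorem symm_injective:
  assumes "symm f \<in> idl br"
  shows "f \<in> idl0"
proof (rule ccontr)
  assume "f \<notin> idl0"
  then obtain l where l: "Vector_Spaces.linear fsc (*) l" "\<And>v. v \<in> idl0 \<Longrightarrow> l v = 0" "l f = 1"
    using fs.separating_functional[OF subspace_idl] by blast
  interpret l: Vector_Spaces.linear fsc "(*)" l by fact
  have l0: "l g = l h" if "cg0 g h" for g h
    using l(2)[of "g - h"] that by (simp add: cg_def l.diff)
  define \<mu> where "\<mu> M = l (word (SOME w. mset w = M))" for M
  have \<mu>: "\<mu> (mset w) = l (word w)" for w
    unfolding \<mu>_def by (rule l0, rule cg0_mset, rule someI[of _ w]) simp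
  have "multilin \<mu>" unfolding multilin_def slot_linear_def
  proof (intro conjI allI)
    fix x y c and M :: "'g multiset"
    obtain w where w: "M = mset w" using ex_mset by metis
    show "\<mu> (add_mset (x + y) M) = \<mu> (add_mset x M) + \<mu> (add_mset y M)"
      using l0[OF cg_word_add[of _ "[]" x y w]] \<mu>[of "_ # w"] by (simp add: w l.add)
    show "\<mu> (add_mset (scale c x) M) = c * \<mu> (add_mset x M)"
      using l0[OF cg_word_scale[of _ "[]" c x w]] \<mu>[of "_ # w"] by (simp add: w l.scale)
  qed
  then obtain L where L: "Vector_Spaces.linear fsc (*) L" "\<And>f. f \<in> idl br \<Longrightarrow> L f = 0"
    "\<And>n \<eta>. L (word (replicate n \<eta>)) = \<mu> (replicate_mset n \<eta>)"
    using dual_functional by blast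
  have "L (symm f) = l f"
  proof (rule linear_eq_on_powers[OF _ l(1), where L = "\<lambda>f. L (symm f)"])
    show "Vector_Spaces.linear fsc (*) (\<lambda>f. L (symm f))"
      using Vector_Spaces.linear_compose[OF flinear_sym L(1)] by (simp add: comp_def)
    show "L (symm f) = l f" if "f \<in> idl0" for f
      using that l(2) L(2) symm_idl0 by simp
    show "L (symm (word (replicate n x))) = l (word (replicate n x))" for n x
      using \<mu>[of "replicate n x"] by (simp add: symm_of_word sym_word_replicate L(3))
  qed
  thus False using L(2)[OF assms] l(3) by simp
qed

text \<open>Letters are fixed by \<open>symm\<close>, which reduces the claim to the commutative
  ideal, where a functional living in degree one separates them. This will make the value in
  \<open>bch\<close> unique.\<close>

lemma gen_injective:
  assumes "cg br (word [x]) (word [y])"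
  shows "x = y"
proof (rule ccontr)
  assume "x \<noteq> y"
  interpret k: vector_space "(*) :: 'k \<Rightarrow> 'k \<Rightarrow> 'k" by (rule vector_space_mult)
  from \<open>x \<noteq> y\<close> have "x - y \<notin> {0}" by simp
  then obtain l where l: "Vector_Spaces.linear scale (*) l" "l (x - y) = 1"
    using separating_functional[OF subspace_single_0] by blast
  interpret l: Vector_Spaces.linear scale "(*)" l by fact
  define L where "L = lext (*) (\<lambda>w. if length w = 1 then l (hd w) else 0)"
  have lin: "Vector_Spaces.linear fsc (*) L" unfolding L_def by (rule lext_linear) (rule vector_space_mult)
  have Lw: "L (word w) = (if length w = 1 then l (hd w) else 0)" for w
    unfolding L_def by (rule lext_word) (rule vector_space_mult)
  interpret L: Vector_Spaces.linear fsc "(*)" L by fact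
  have sw: "symm (word [a]) = word [a]" for a :: 'g
    using sym_word_replicate[of 1 a] by (simp add: symm_of_word)
  have "symm (word [x] - word [y]) \<in> idl br"
    using assms by (simp add: symm.diff sw cg_def)
  hence "word [x] - word [y] \<in> idl0" by (rule symm_injective)
  hence "L (word [x] - word [y]) \<in> {0}"
    by (rule idl0_linear_induct[OF lin k.subspace_single_0, rotated -1])
       (auto simp: Lw l.add l.scale hd_append)
  thus False using l(2) by (simp add: L.diff Lw l.diff)
qed

end

section \<open>The product on representatives\<close>

definition filt :: "nat \<Rightarrow> ('x list \<Rightarrow>\<^sub>0 'k::field) set" where
  "filt d = fs.span {word w | w. length w \<le> d}"

lemma subspace_filt: "fs.subspace (filt d)"
  by (simp add: filt_def)

lemma word_in_filt: "length w \<le> d \<Longrightarrow> word w \<in> filt d"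
  unfolding filt_def by (rule fs.span_base) blast

lemma filt_mono: "d \<le> e \<Longrightarrow> filt d \<subseteq> filt e"
  unfolding filt_def by (rule fs.span_mono) auto

lemma filt_0: "0 \<in> filt d"
  by (rule fs.subspace_0[OF subspace_filt])

lemma homog_filt: "homog n \<subseteq> filt n"
  unfolding homog_def filt_def by (rule fs.span_mono) auto

lemma in_filt: "\<exists>d. f \<in> filt d"
proof (induction f rule: free_induct)
  case zero
  show ?case using filt_0 by blast
next
  case (step c w f)
  then obtain d where "f \<in> filt d" by blast
  hence "f \<in> filt (max d (length w))" using filt_mono[of d "max d (length w)"] by auto
  hence "fsc c (word w) + f \<in> filt (max d (length w))"
    by (intro fs.subspace_add fs.subspace_scale subspace_filt word_in_filt) auto
  thus ?case by blast
qed

lemma flinear_filt: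
  assumes "flinear L" "fs.subspace V" "\<And>w. length w \<le> d \<Longrightarrow> L (word w) \<in> V" "f \<in> filt d"
  shows "L f \<in> V"
  by (rule linear_span_subset[OF assms(1,2) _ assms(4)[unfolded filt_def]]) (use assms(3) in auto)

lemma filt_mult:
  assumes "f \<in> filt d" "g \<in> filt e"
  shows "f * g \<in> filt (d + e)"
proof (rule flinear_filt[OF flinear_mult_right subspace_filt _ assms(1)])
  fix w :: "'a list" assume "length w \<le> d"
  thus "word w * g \<in> filt (d + e)"
    by (intro flinear_filt[OF flinear_mult_left subspace_filt _ assms(2)])
       (simp add: word_mult word_in_filt)
qed

lemma symm_filt: "f \<in> filt d \<Longrightarrow> symm f \<in> filt d"
  by (rule flinear_filt[OF flinear_sym subspace_filt])
     (use symm_homog word_in_homog homog_filt filt_mono in blast)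

lemma symm_power: "symm (word (replicate n x)) = word (replicate n x)"
  unfolding symm_of_word by (rule sym_word_replicate)

text \<open>The square of exponent pairs is cut along its antidiagonals. For m \<le> N an
  antidiagonal is complete; only these will be used.\<close>

lemma fsc_sum_double:
  "(\<Sum>a\<le>N. \<Sum>b\<le>N. fsc (z ^ (a + b)) (X a b)) =
   (\<Sum>m\<le>2 * N. fsc (z ^ m) (\<Sum>a\<in>{a. a \<le> m \<and> a \<le> N \<and> m - a \<le> N}. X a (m - a)))"
proof -
  have fin: "finite {a. a \<le> m \<and> a \<le> N \<and> m - a \<le> N}" for m :: nat
    by (rule finite_subset[of _ "{..N}"]) auto
  have "(\<Sum>a\<le>N. \<Sum>b\<le>N. fsc (z ^ (a + b)) (X a b)) = (\<Sum>(a, b)\<in>{..N} \<times> {..N}. fsc (z ^ (a + b)) (X a b))"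
    by (simp add: sum.cartesian_product)
  also have "\<dots> = (\<Sum>(m, a)\<in>(SIGMA m:{..2 * N}. {a. a \<le> m \<and> a \<le> N \<and> m - a \<le> N}). fsc (z ^ m) (X a (m - a)))"
    by (rule sum.reindex_bij_witness[of _ "\<lambda>(m, a). (a, m - a)" "\<lambda>(a, b). (a + b, a)"]) auto
  also have "\<dots> = (\<Sum>m\<le>2 * N. \<Sum>a\<in>{a. a \<le> m \<and> a \<le> N \<and> m - a \<le> N}. fsc (z ^ m) (X a (m - a)))"
    by (subst sum.Sigma) (auto simp: fin)
  finally show ?thesis by (simp add: fs.scale_sum_right)
qed

context char0_lie
begin

definition brz :: "'k \<Rightarrow> 'g \<Rightarrow> 'g \<Rightarrow> 'g" where
  "brz z x y = scale z (br x y)"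

lemma brz_alt: "brz z = (\<lambda>x y. scale z (br x y))"
  by (simp add: brz_def[abs_def])

text \<open>Scaling the bracket multiplies the Jacobi sum by z^2. Through this instance injectivity
  is available for every z.\<close>

lemma char0_lie_brz: "char0_lie scale (brz z)"
proof unfold_locales
  fix x y w :: 'g and c
  show "brz z (x + y) w = brz z x w + brz z y w" "brz z w (x + y) = brz z w x + brz z w y"
    "brz z (scale c x) y = scale c (brz z x y)" "brz z x (scale c y) = scale c (brz z x y)" "brz z x x = 0"
    by (simp_all add: brz_def bracket_add_left bracket_add_right bracket_scale_left bracket_scale_right
        bracket_self scale_right_distrib mult.commute)
  have "brz z x (brz z y w) + brz z y (brz z w x) + brz z w (brz z x y) =
      scale (z * z) (br x (br y w) + br y (br w x) + br w (br x y))"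
    by (simp add: brz_def bracket_scale_right scale_right_distrib)
  thus "brz z x (brz z y w) + brz z y (brz z w x) + brz z w (brz z x y) = 0" by (simp add: jacobi)
qed

lemma symm_inj_z: "symm f \<in> idl (brz z) \<Longrightarrow> f \<in> idl0"
proof -
  interpret z: char0_lie scale "brz z" by (rule char0_lie_brz)
  show "symm f \<in> idl (brz z) \<Longrightarrow> f \<in> idl0" by (rule z.symm_injective)
qed

lemma coeffs_in_idl:
  assumes "\<And>z. (\<Sum>j\<le>N. fsc (z ^ j) (v j)) \<in> idl b" "j \<le> N"
  shows "v j \<in> idl b"
  by (rule fs.polynomial_coeffs_in_subspace[OF _ subspace_idl assms]) simp

lemma double_coeffs_in_idl:
  assumes "\<And>z. (\<Sum>a\<le>N. \<Sum>b\<le>N. fsc (z ^ (a + b)) (X a b)) \<in> idl c" "m \<le> N"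
  shows "(\<Sum>a\<le>m. X a (m - a)) \<in> idl c"
proof -
  have "(\<Sum>a\<in>{a. a \<le> m \<and> a \<le> N \<and> m - a \<le> N}. X a (m - a)) \<in> idl c"
    by (rule coeffs_in_idl[where N = "2 * N" and v = "\<lambda>m. \<Sum>a\<in>{a. a \<le> m \<and> a \<le> N \<and> m - a \<le> N}. X a (m - a)"])
       (use assms in \<open>simp_all add: fsc_sum_double\<close>)
  moreover have "{a. a \<le> m \<and> a \<le> N \<and> m - a \<le> N} = {..m}" using assms(2) by auto
  ultimately show ?thesis by simp
qed

lemma cg_symm_homog:
  assumes "f \<in> homog n"
  shows "\<exists>r. (n = 0 \<longrightarrow> r = 0) \<and> r \<in> homog (n - 1) \<and> (\<forall>z. cg (brz z) f (symm f + fsc z r))"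
  using assms
proof (induction rule: homog_induct)
  case zero
  show ?case by (auto intro!: exI[of _ 0] simp: homog_0 symm.zero)
next
  case (step c w f)
  then obtain r where r: "n = 0 \<longrightarrow> r = 0" "r \<in> homog (n - 1)" "\<And>z. cg (brz z) f (symm f + fsc z r)" by blast
  obtain r' where r': "length w = 0 \<longrightarrow> r' = 0" "r' \<in> homog (length w - 1)"
    "\<And>z. cg (brz z) (word w) (symm (word w) + fsc z r')"
    using cg_symm_word[of w br] unfolding brz_alt by blast
  have "cg (brz z) (fsc c (word w) + f) (symm (fsc c (word w) + f) + fsc z (fsc c r' + r))" for z
    using cg_add[OF cg_fsc[OF r'(3)[of z], of c] r(3)[of z]]
    by (simp add: symm.add symm.scale fs.scale_right_distrib add_ac mult.commute)
  moreover have "fsc c r' + r \<in> homog (n - 1)" using r r' step(1)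
    by (auto intro!: fs.subspace_add fs.subspace_scale subspace_homog)
  moreover have "n = 0 \<longrightarrow> fsc c r' + r = 0" using r(1) r'(1) step(1) by simp
  ultimately show ?case by blast
qed

text \<open>\<open>cg_symm_homog\<close> is applied again to its own remainder, which has lower
  degree; the j-th remainder comes with the factor z^j.\<close>

lemma symm_expansion:
  assumes "f \<in> homog n"
  shows "\<exists>u. u 0 = f \<and> (\<forall>j. u j \<in> homog (n - j)) \<and> (\<forall>j>n. u j = 0) \<and>
    (\<forall>z. cg (brz z) f (\<Sum>j\<le>n. fsc (z ^ j) (symm (u j))))"
  using assms
proof (induction n arbitrary: f)
  case 0
  then obtain r where "r = 0" "\<And>z. cg (brz z) f (symm f + fsc z r)" using cg_symm_homog by blast
  thus ?case using 0 by (intro exI[of _ "\<lambda>j. if j = 0 then f else 0"]) (auto simp: homog_0)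
next
  case (Suc n)
  then obtain r where r: "r \<in> homog n" "\<And>z. cg (brz z) f (symm f + fsc z r)"
    using cg_symm_homog[of f "Suc n"] by auto
  from Suc.IH[OF r(1)] obtain u where u: "\<And>j. u j \<in> homog (n - j)" "\<And>j. n < j \<Longrightarrow> u j = 0"
    "\<And>z. cg (brz z) r (\<Sum>j\<le>n. fsc (z ^ j) (symm (u j)))" by blast
  \<comment> \<open>The shift by one accounts for the factor z in front of the remainder.\<close>
  define v where "v j = (if j = 0 then f else u (j - 1))" for j
  have "cg (brz z) f (\<Sum>j\<le>Suc n. fsc (z ^ j) (symm (v j)))" for z
  proof -
    have "cg (brz z) f (symm f + fsc z (\<Sum>j\<le>n. fsc (z ^ j) (symm (u j))))"
      by (rule cg_trans[OF r(2)]) (intro cg_add cg_refl cg_fsc u)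
    thus ?thesis by (simp add: v_def sum.atMost_Suc_shift fs.scale_sum_right del: sum.atMost_Suc)
  qed
  moreover have "v j \<in> homog (Suc n - j)" for j
    using u(1)[of "j - 1"] Suc.prems by (cases j) (auto simp: v_def)
  ultimately show ?case using u(2) by (intro exI[of _ v]) (auto simp: v_def)
qed

text \<open>Chosen on words and extended linearly afterwards; separate choices for all elements need
  not be linear.\<close>

definition low_word :: "'g list \<Rightarrow> nat \<Rightarrow> 'g list \<Rightarrow>\<^sub>0 'k" where
  "low_word w = (SOME u. u 0 = word w \<and> (\<forall>j. u j \<in> homog (length w - j)) \<and> (\<forall>j>length w. u j = 0) \<and>
    (\<forall>z. cg (brz z) (word w) (\<Sum>j\<le>length w. fsc (z ^ j) (symm (u j)))))"

lemma low_word: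
  "low_word w 0 = word w" "low_word w j \<in> homog (length w - j)" "length w < j \<Longrightarrow> low_word w j = 0"
  "cg (brz z) (word w) (\<Sum>j\<le>length w. fsc (z ^ j) (symm (low_word w j)))"
proof -
  have "low_word w 0 = word w \<and> (\<forall>j. low_word w j \<in> homog (length w - j)) \<and> (\<forall>j>length w. low_word w j = 0) \<and>
    (\<forall>z. cg (brz z) (word w) (\<Sum>j\<le>length w. fsc (z ^ j) (symm (low_word w j))))"
    unfolding low_word_def by (rule someI_ex[OF symm_expansion]) (simp add: word_in_homog)
  thus "low_word w 0 = word w" "low_word w j \<in> homog (length w - j)" "length w < j \<Longrightarrow> low_word w j = 0"
    "cg (brz z) (word w) (\<Sum>j\<le>length w. fsc (z ^ j) (symm (low_word w j)))" by auto
qed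

text \<open>The inverse of the symmetrisation with values in the enveloping algebra of the bracket scaled
  by \<open>z\<close> is \<open>\<Sum>\<^sub>j z\<^sup>j low j\<close>, where \<open>low j\<close> lowers the degree by \<open>j\<close> and does not depend on \<open>z\<close>.\<close>

definition low :: "nat \<Rightarrow> ('g list \<Rightarrow>\<^sub>0 'k) \<Rightarrow> 'g list \<Rightarrow>\<^sub>0 'k" where
  "low j = lext fsc (\<lambda>w. low_word w j)"

definition unsymm :: "'k \<Rightarrow> ('g list \<Rightarrow>\<^sub>0 'k) \<Rightarrow> 'g list \<Rightarrow>\<^sub>0 'k" where
  "unsymm z = lext fsc (\<lambda>w. \<Sum>j\<le>length w. fsc (z ^ j) (low_word w j))"

lemma flinear_low: "flinear (low j)" and flinear_unsymm: "flinear (unsymm z)"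
  unfolding low_def unsymm_def by (intro lext_linear fs.vector_space_axioms)+

lemma low_of_word: "low j (word w) = low_word w j"
  and unsymm_of_word: "unsymm z (word w) = (\<Sum>j\<le>length w. fsc (z ^ j) (low_word w j))"
  unfolding low_def unsymm_def by (intro lext_word fs.vector_space_axioms)+

sublocale low: Vector_Spaces.linear fsc fsc "low j" by (rule flinear_low)

sublocale unsymm: Vector_Spaces.linear fsc fsc "unsymm z" by (rule flinear_unsymm)

lemma low_0: "low 0 f = f"
  by (rule linear_eq_on_words[OF flinear_low fs.linear_id[unfolded id_def]]) (simp add: low_of_word low_word)

lemma low_homog: "f \<in> homog n \<Longrightarrow> low j f \<in> homog (n - j)"
  by (induction rule: homog_induct)
     (auto simp: homog_0 low.zero low.add low.scale low_of_word low_word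
       intro!: fs.subspace_add fs.subspace_scale subspace_homog)

lemma low_filt: "f \<in> filt d \<Longrightarrow> low j f \<in> filt d"
proof (rule flinear_filt[OF flinear_low subspace_filt])
  fix w :: "'g list" assume "length w \<le> d"
  hence "filt (length w - j) \<subseteq> filt d" by (intro filt_mono) simp
  thus "low j (word w) \<in> filt d"
    using low_word(2)[of w j] homog_filt[of "length w - j"] by (auto simp: low_of_word)
qed

lemma low_eq_0: "f \<in> filt d \<Longrightarrow> d < j \<Longrightarrow> low j f = 0"
  using flinear_filt[OF flinear_low fs.subspace_single_0, of d j f] by (simp add: low_of_word low_word)

lemma unsymm_eq:
  assumes "f \<in> filt d" "d \<le> N"
  shows "unsymm z f = (\<Sum>j\<le>N. fsc (z ^ j) (low j f))"
proof -
  have "unsymm z f - (\<Sum>j\<le>N. fsc (z ^ j) (low j f)) \<in> {0}"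
  proof (rule flinear_filt[OF _ fs.subspace_single_0 _ assms(1),
        where L = "\<lambda>f. unsymm z f - (\<Sum>j\<le>N. fsc (z ^ j) (low j f))"])
    show "flinear (\<lambda>f. unsymm z f - (\<Sum>j\<le>N. fsc (z ^ j) (low j f)))"
      by (rule flinearI)
         (simp_all add: unsymm.add low.add unsymm.scale low.scale fs.scale_right_distrib sum.distrib
           fs.scale_right_diff_distrib fs.scale_sum_right mult.commute)
    fix w :: "'g list" assume "length w \<le> d"
    hence "(\<Sum>j\<le>length w. fsc (z ^ j) (low_word w j)) = (\<Sum>j\<le>N. fsc (z ^ j) (low_word w j))"
      using assms(2) by (intro sum.mono_neutral_left) (auto simp: low_word(3))
    thus "unsymm z (word w) - (\<Sum>j\<le>N. fsc (z ^ j) (low j (word w))) \<in> {0}"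
      by (simp add: unsymm_of_word low_of_word)
  qed
  thus ?thesis by simp
qed

lemma cg_symm_unsymm: "cg (brz z) (symm (unsymm z f)) f"
proof -
  have "symm (unsymm z f) - f \<in> idl (brz z)"
  proof (rule linear_in_subspace_words[OF _ subspace_idl, where L = "\<lambda>f. symm (unsymm z f) - f"])
    show "flinear (\<lambda>f. symm (unsymm z f) - f)"
      by (rule flinearI) (simp_all add: unsymm.add symm.add unsymm.scale symm.scale fs.scale_right_diff_distrib)
    show "symm (unsymm z (word w)) - word w \<in> idl (brz z)" for w
      using cg_sym[OF low_word(4)[of z w]] by (simp add: unsymm_of_word symm.sum symm.scale cg_def)
  qed
  thus ?thesis by (simp add: cg_def)
qed

text \<open>Built from choices, \<open>unsymm\<close> is not visibly compatible with the ideals;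
  injectivity of \<open>symm\<close> forces it to be.\<close>

lemma unsymm_cong:
  assumes "cg (brz z) f g"
  shows "cg0 (unsymm z f) (unsymm z g)"
proof -
  have "cg (brz z) (symm (unsymm z f)) (symm (unsymm z g))"
    by (rule cg_trans[OF cg_symm_unsymm cg_trans[OF assms cg_sym[OF cg_symm_unsymm]]])
  thus ?thesis using symm_inj_z[of "unsymm z f - unsymm z g" z] by (simp add: cg_def symm.diff)
qed

lemma unsymm_symm: "cg0 (unsymm z (symm f)) f"
  using symm_inj_z[of "unsymm z (symm f) - f" z] cg_symm_unsymm[of z "symm f"]
  by (simp add: cg_def symm.diff)

section \<open>The star product and its coefficients on representatives\<close>

definition star :: "'k \<Rightarrow> ('g list \<Rightarrow>\<^sub>0 'k) \<Rightarrow> ('g list \<Rightarrow>\<^sub>0 'k) \<Rightarrow> 'g list \<Rightarrow>\<^sub>0 'k" where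
  "star z f g = unsymm z (symm f * symm g)"

definition coef :: "nat \<Rightarrow> ('g list \<Rightarrow>\<^sub>0 'k) \<Rightarrow> ('g list \<Rightarrow>\<^sub>0 'k) \<Rightarrow> 'g list \<Rightarrow>\<^sub>0 'k" where
  "coef n f g = low n (symm f * symm g)"

lemma flinear_star: "flinear (star z f)" "flinear (\<lambda>f. star z f g)"
  by (rule flinearI; simp add: star_def symm.add symm.scale distrib_left distrib_right unsymm.add
      fsc_mult_left fsc_mult_right unsymm.scale)+

lemma flinear_coef: "flinear (coef n f)" "flinear (\<lambda>f. coef n f g)"
  by (rule flinearI; simp add: coef_def symm.add symm.scale distrib_left distrib_right low.add
      fsc_mult_left fsc_mult_right low.scale)+

lemma star_eq:
  assumes "f \<in> filt d" "g \<in> filt e" "d + e \<le> N"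
  shows "star z f g = (\<Sum>n\<le>N. fsc (z ^ n) (coef n f g))"
  unfolding star_def coef_def by (rule unsymm_eq[OF filt_mult[OF symm_filt symm_filt]]) (use assms in auto)

lemma coef_eq_0: "f \<in> filt d \<Longrightarrow> g \<in> filt e \<Longrightarrow> d + e < n \<Longrightarrow> coef n f g = 0"
  unfolding coef_def by (rule low_eq_0[OF filt_mult[OF symm_filt symm_filt]])

lemma coef_filt: "f \<in> filt d \<Longrightarrow> g \<in> filt e \<Longrightarrow> coef n f g \<in> filt (d + e)"
  unfolding coef_def by (intro low_filt filt_mult symm_filt)

lemma star_cong: "cg0 f f' \<Longrightarrow> cg0 g g' \<Longrightarrow> cg0 (star z f g) (star z f' g')"
  unfolding star_def by (intro unsymm_cong cg_mult symm_cg)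

lemma star_assoc: "cg0 (star z (star z f g) h) (star z f (star z g h))"
proof -
  have "cg (brz z) (symm (star z f g) * symm h) (symm f * symm g * symm h)"
    unfolding star_def by (intro cg_mult cg_symm_unsymm cg_refl)
  moreover have "cg (brz z) (symm f * (symm g * symm h)) (symm f * symm (star z g h))"
    unfolding star_def by (intro cg_mult cg_sym[OF cg_symm_unsymm] cg_refl)
  ultimately have "cg (brz z) (symm (star z f g) * symm h) (symm f * symm (star z g h))"
    by (metis cg_trans mult.assoc)
  \<comment> \<open>Only the outer product on each side is unfolded; the inner ones stay under
    \<open>symm\<close>.\<close>
  thus ?thesis by (subst (1 3) star_def) (rule unsymm_cong)
qed

lemma symm_1: "symm 1 = 1"
  using symm_power[of 0] by simp

lemma star_1: "cg0 (star z 1 f) f" "cg0 (star z f 1) f"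
  unfolding star_def by (simp_all add: symm_1 unsymm_symm)

lemma coef_0: "cg0 (coef 0 f g) (f * g)"
  unfolding coef_def low_0 by (intro cg_mult cg0_symm)

text \<open>The product is a polynomial in z with all its values in the ideal; comparing
  coefficients separates the orders.\<close>

lemma coef_idl0:
  assumes "f \<in> idl0 \<or> g \<in> idl0"
  shows "coef n f g \<in> idl0"
proof -
  obtain d where d: "f \<in> filt d" using in_filt by blast
  obtain e where e: "g \<in> filt e" using in_filt by blast
  have "star z f g \<in> idl0" for z
  proof -
    have "cg0 f 0 \<or> cg0 g 0" using assms by (simp add: cg_0)
    hence "cg0 (star z f g) (star z 0 g) \<or> cg0 (star z f g) (star z f 0)"
      using star_cong[OF _ cg_refl] star_cong[OF cg_refl] by blast
    thus ?thesis by (auto simp: star_def symm.zero unsymm.zero cg_0)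
  qed
  hence "(\<Sum>n\<le>d + e. fsc (z ^ n) (coef n f g)) \<in> idl0" for z
    using star_eq[OF d e order_refl, of z] by metis
  thus ?thesis
    using coeffs_in_idl[where N = "d + e" and v = "\<lambda>n. coef n f g" and j = n] coef_eq_0[OF d e, of n]
    by (cases "n \<le> d + e") (auto simp: fs.subspace_0[OF subspace_idl])
qed

lemma coef_cong:
  assumes "cg0 f f'" "cg0 g g'"
  shows "cg0 (coef n f g) (coef n f' g')"
proof -
  interpret L: Vector_Spaces.linear fsc fsc "coef n h" for h by (rule flinear_coef)
  interpret R: Vector_Spaces.linear fsc fsc "\<lambda>f. coef n f h" for h by (rule flinear_coef)
  have "coef n f g - coef n f' g' = coef n (f - f') g + coef n f' (g - g')"
    by (simp add: L.diff R.diff)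
  moreover have "coef n (f - f') g \<in> idl0" "coef n f' (g - g') \<in> idl0"
    using assms coef_idl0 by (simp_all add: cg_def)
  ultimately show ?thesis using fs.subspace_add[OF subspace_idl] by (simp add: cg_def)
qed

subsection \<open>The Poisson bracket\<close>

definition comm :: "nat \<Rightarrow> ('g list \<Rightarrow>\<^sub>0 'k) \<Rightarrow> ('g list \<Rightarrow>\<^sub>0 'k) \<Rightarrow> 'g list \<Rightarrow>\<^sub>0 'k" where
  "comm n f g = coef n f g - coef n g f"

lemma flinear_comm: "flinear (comm n f)" "flinear (\<lambda>f. comm n f g)"
proof -
  interpret L: Vector_Spaces.linear fsc fsc "coef n h" for h by (rule flinear_coef)
  interpret R: Vector_Spaces.linear fsc fsc "\<lambda>f. coef n f h" for h by (rule flinear_coef)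
  show "flinear (comm n f)" "flinear (\<lambda>f. comm n f g)"
    by (rule flinearI; simp add: comm_def L.add R.add L.scale R.scale fs.scale_right_diff_distrib)+
qed

lemma comm_cong: "cg0 f f' \<Longrightarrow> cg0 g g' \<Longrightarrow> cg0 (comm n f g) (comm n f' g')"
  unfolding comm_def by (intro cg_diff coef_cong)

lemma comm_idl0: "f \<in> idl0 \<or> g \<in> idl0 \<Longrightarrow> comm n f g \<in> idl0"
  unfolding comm_def by (intro fs.subspace_diff subspace_idl coef_idl0) auto

lemma comm_0: "comm 0 f g \<in> idl0"
proof -
  have "cg0 (coef 0 f g) (coef 0 g f)"
    by (rule cg_trans[OF coef_0 cg_trans[OF cg0_mult_commute cg_sym[OF coef_0]]])
  thus ?thesis by (simp add: cg_def comm_def)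
qed

definition starcomm :: "'k \<Rightarrow> ('g list \<Rightarrow>\<^sub>0 'k) \<Rightarrow> ('g list \<Rightarrow>\<^sub>0 'k) \<Rightarrow> 'g list \<Rightarrow>\<^sub>0 'k" where
  "starcomm z f g = star z f g - star z g f"

lemma starcomm_eq:
  assumes "f \<in> filt d" "g \<in> filt e" "d + e \<le> N"
  shows "starcomm z f g = (\<Sum>n\<le>N. fsc (z ^ n) (comm n f g))"
  using star_eq[OF assms] star_eq[OF assms(2,1), where N = N] assms(3)
  by (simp add: starcomm_def comm_def fs.scale_right_diff_distrib sum_subtractf add.commute)

lemma comm_filt: "f \<in> filt d \<Longrightarrow> g \<in> filt e \<Longrightarrow> comm n f g \<in> filt (d + e)"
  unfolding comm_def using coef_filt[of f d g e] coef_filt[of g e f d]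
  by (auto simp: add.commute intro!: fs.subspace_diff subspace_filt)

text \<open>Order z^1 of the fact that commutators of an associative product are derivations of it.
  In \<open>X a b\<close> the outer operation has order a, the inner one order b; commutators of
  order 0 vanish modulo \<open>idl0\<close>.\<close>

lemma comm_leibniz: "cg0 (comm 1 f (g * h)) (comm 1 f g * h + g * comm 1 f h)"
proof -
  obtain d where d: "f \<in> filt d" using in_filt by blast
  obtain e where e: "g \<in> filt e" using in_filt by blast
  obtain l where l: "h \<in> filt l" using in_filt by blast
  \<comment> \<open>\<open>Suc\<close> guarantees 1 \<le> N, the order to be extracted.\<close>
  define N where "N = Suc (d + e + l)"
  have le: "e + l \<le> N" "d + e \<le> N" "d + l \<le> N" by (simp_all add: N_def)
  interpret SL: Vector_Spaces.linear fsc fsc "star z' f'" for z' f' by (rule flinear_star)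
  interpret SR: Vector_Spaces.linear fsc fsc "\<lambda>f. star z' f g'" for z' g' by (rule flinear_star)
  define X where "X a b = comm a f (coef b g h) - (coef a (comm b f g) h + coef a g (comm b f h))" for a b
  have "(\<Sum>a\<le>N. \<Sum>b\<le>N. fsc (z ^ (a + b)) (X a b)) \<in> idl0" for z
  proof -
    have sw: "(\<Sum>b\<le>N. fsc (z ^ b) (\<Sum>a\<le>N. fsc (z ^ a) (Y a b))) = (\<Sum>a\<le>N. \<Sum>b\<le>N. fsc (z ^ (a + b)) (Y a b))"
      for Y :: "nat \<Rightarrow> nat \<Rightarrow> 'g list \<Rightarrow>\<^sub>0 'k"
      by (subst sum.swap) (simp add: fs.scale_sum_right power_add mult.commute)
    have 1: "starcomm z f (star z g h) = (\<Sum>a\<le>N. \<Sum>b\<le>N. fsc (z ^ (a + b)) (comm a f (coef b g h)))"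
    proof -
      have "starcomm z f (star z g h) = (\<Sum>b\<le>N. fsc (z ^ b) (starcomm z f (coef b g h)))"
        unfolding star_eq[OF e l le(1)]
        by (simp add: starcomm_def SL.sum SR.sum SL.scale SR.scale fs.scale_right_diff_distrib sum_subtractf)
      also have "\<dots> = (\<Sum>b\<le>N. fsc (z ^ b) (\<Sum>a\<le>N. fsc (z ^ a) (comm a f (coef b g h))))"
        by (intro sum.cong refl arg_cong2[of _ _ _ _ fsc] starcomm_eq[OF d coef_filt[OF e l]]) (simp add: N_def)
      finally show ?thesis by (simp only: sw)
    qed
    have 2: "star z (starcomm z f g) h = (\<Sum>a\<le>N. \<Sum>b\<le>N. fsc (z ^ (a + b)) (coef a (comm b f g) h))"
    proof -
      have "star z (starcomm z f g) h = (\<Sum>b\<le>N. fsc (z ^ b) (star z (comm b f g) h))"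
        unfolding starcomm_eq[OF d e le(2)] by (simp add: SR.sum SR.scale)
      also have "\<dots> = (\<Sum>b\<le>N. fsc (z ^ b) (\<Sum>a\<le>N. fsc (z ^ a) (coef a (comm b f g) h)))"
        by (intro sum.cong refl arg_cong2[of _ _ _ _ fsc] star_eq[OF comm_filt[OF d e] l]) (simp add: N_def)
      finally show ?thesis by (simp only: sw)
    qed
    have 3: "star z g (starcomm z f h) = (\<Sum>a\<le>N. \<Sum>b\<le>N. fsc (z ^ (a + b)) (coef a g (comm b f h)))"
    proof -
      have "star z g (starcomm z f h) = (\<Sum>b\<le>N. fsc (z ^ b) (star z g (comm b f h)))"
        unfolding starcomm_eq[OF d l le(3)] by (simp add: SL.sum SL.scale)
      also have "\<dots> = (\<Sum>b\<le>N. fsc (z ^ b) (\<Sum>a\<le>N. fsc (z ^ a) (coef a g (comm b f h))))"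
        by (intro sum.cong refl arg_cong2[of _ _ _ _ fsc] star_eq[OF e comm_filt[OF d l]]) (simp add: N_def)
      finally show ?thesis by (simp only: sw)
    qed
    \<comment> \<open>The last summand is an associator: it cancels the two terms before it and is
      itself congruent to 0.\<close>
    have "cg0 (star z f (star z g h) - star z (star z g h) f)
      (star z (star z f g) h - star z g (star z h f) - star z (star z g f) h + star z g (star z f h) + (star z (star z g f) h - star z g (star z f h)))"
    proof -
      have "star z (star z f g) h - star z g (star z h f) - star z (star z g f) h + star z g (star z f h) + (star z (star z g f) h - star z g (star z f h))
        = star z (star z f g) h - star z g (star z h f)" by simp
      thus ?thesis by (auto intro!: cg_diff cg_sym[OF star_assoc] star_assoc)
    qed
    moreover have "cg0 (star z (star z f g) h - star z g (star z h f) - star z (star z g f) h + star z g (star z f h) + (star z (star z g f) h - star z g (star z f h)))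
       (star z (star z f g) h - star z g (star z h f) - star z (star z g f) h + star z g (star z f h) + 0)"
      using star_assoc[of z g f h] by (intro cg_add cg_refl) (simp add: cg_def)
    ultimately have "cg0 (starcomm z f (star z g h)) (star z (starcomm z f g) h + star z g (starcomm z f h))"
      unfolding starcomm_def SR.diff SL.diff by (elim cg_trans) (simp add: algebra_simps)
    hence "starcomm z f (star z g h) - (star z (starcomm z f g) h + star z g (starcomm z f h)) \<in> idl0"
      by (simp add: cg_def)
    thus ?thesis unfolding 1 2 3 X_def
      by (simp add: fs.scale_right_diff_distrib fs.scale_right_distrib sum.distrib sum_subtractf del: sum.atMost_Suc)
  qed
  hence "(\<Sum>a\<le>1. X a (1 - a)) \<in> idl0"
    by (rule double_coeffs_in_idl[where X = X]) (simp add: N_def)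
  hence X: "X 0 1 + X 1 0 \<in> idl0" by (simp add: add.commute)
  have "cg0 (X 0 1) (0 - (comm 1 f g * h + g * comm 1 f h))"
    unfolding X_def using comm_0 by (intro cg_diff cg_add coef_0) (simp add: cg_0)
  moreover have "cg0 (X 1 0) (comm 1 f (g * h) - (0 + 0))"
    unfolding X_def using comm_0 coef_idl0 by (intro cg_diff cg_add comm_cong cg_refl coef_0) (simp_all add: cg_0)
  ultimately have "cg0 (X 0 1 + X 1 0) (0 - (comm 1 f g * h + g * comm 1 f h) + (comm 1 f (g * h) - (0 + 0)))"
    by (rule cg_add)
  from cg_in[OF this] X show ?thesis by (simp add: cg_def algebra_simps)
qed

text \<open>Order z^2 of the Jacobi identity for the star commutator; the orders (0, 2) and (2, 0)
  contain a commutator of order 0.\<close>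

lemma comm_jacobi: "comm 1 f (comm 1 g h) + comm 1 g (comm 1 h f) + comm 1 h (comm 1 f g) \<in> idl0"
proof -
  obtain d where d: "f \<in> filt d" using in_filt by blast
  obtain e where e: "g \<in> filt e" using in_filt by blast
  obtain l where l: "h \<in> filt l" using in_filt by blast
  define N where "N = Suc (Suc (d + e + l))"
  have le: "d + e + l \<le> N" "e + l + d \<le> N" "l + d + e \<le> N" by (simp_all add: N_def)
  interpret SL: Vector_Spaces.linear fsc fsc "star z' f'" for z' f' by (rule flinear_star)
  interpret SR: Vector_Spaces.linear fsc fsc "\<lambda>f. star z' f g'" for z' g' by (rule flinear_star)
  define X where "X a b = comm a f (comm b g h) + comm a g (comm b h f) + comm a h (comm b f g)" for a b
  have "(\<Sum>a\<le>N. \<Sum>b\<le>N. fsc (z ^ (a + b)) (X a b)) \<in> idl0" for z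
  proof -
    have sc: "starcomm z f (starcomm z g h) = (\<Sum>a\<le>N. \<Sum>b\<le>N. fsc (z ^ (a + b)) (comm a f (comm b g h)))"
      if "f \<in> filt d" "g \<in> filt e" "h \<in> filt l" "d + e + l \<le> N" for f g h d e l
    proof -
      have le: "e + l \<le> N" using that(4) by simp
      have "starcomm z f (starcomm z g h) = (\<Sum>b\<le>N. fsc (z ^ b) (starcomm z f (comm b g h)))"
        unfolding starcomm_eq[OF that(2,3) le]
        by (simp add: starcomm_def SL.sum SR.sum SL.scale SR.scale fs.scale_right_diff_distrib sum_subtractf)
      also have "\<dots> = (\<Sum>b\<le>N. fsc (z ^ b) (\<Sum>a\<le>N. fsc (z ^ a) (comm a f (comm b g h))))"
        by (intro sum.cong refl arg_cong2[of _ _ _ _ fsc] starcomm_eq[OF that(1) comm_filt[OF that(2,3)]])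
           (use that(4) in simp)
      finally show ?thesis
        by (subst sum.swap) (simp add: fs.scale_sum_right power_add mult.commute)
    qed
    define A where "A f g h = star z (star z f g) h - star z f (star z g h)" for f g h
    have A: "A f g h \<in> idl0" for f g h
      using star_assoc by (simp add: A_def cg_def)
    \<comment> \<open>Written out, the Jacobi sum is an alternating sum of six associators.\<close>
    have "starcomm z f (starcomm z g h) + starcomm z g (starcomm z h f) + starcomm z h (starcomm z f g) =
        (A h g f - A g h f) + (A f h g - A h f g) + (A g f h - A f g h)"
      by (simp add: starcomm_def SL.diff SR.diff A_def algebra_simps)
    also have "\<dots> \<in> idl0"
      by (intro fs.subspace_add fs.subspace_diff subspace_idl A)
    finally show ?thesis
      unfolding sc[OF d e l le(1)] sc[OF e l d le(2)] sc[OF l d e le(3)]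
      by (simp add: X_def fs.scale_right_distrib sum.distrib del: sum.atMost_Suc)
  qed
  hence "(\<Sum>a\<le>2. X a (2 - a)) \<in> idl0"
    by (rule double_coeffs_in_idl[where X = X]) (simp add: N_def)
  hence X: "X 0 2 + X 1 1 + X 2 0 \<in> idl0" by (simp add: numeral_2_eq_2)
  have "X 0 2 \<in> idl0" "X 2 0 \<in> idl0"
    unfolding X_def by (intro fs.subspace_add subspace_idl comm_0 comm_idl0 disjI2)+
  with X have "X 0 2 + X 1 1 + X 2 0 - X 0 2 - X 2 0 \<in> idl0"
    by (intro fs.subspace_diff subspace_idl)
  thus ?thesis by (simp add: X_def)
qed

lemma symm_gen: "symm (word [x]) = word [x]"
  using symm_power[of 1 x] by simp

text \<open>Symmetrisation fixes letters, so modulo \<open>idl0\<close> their star commutator is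
  exactly z times the bracket.\<close>

lemma comm_gen: "cg0 (comm 1 (word [x]) (word [y])) (word [br x y])"
proof -
  have f1: "word [a] \<in> filt 1" for a :: 'g by (rule word_in_filt) simp
  have le2: "1 + 1 \<le> (2::nat)" by simp
  define v where "v n = comm n (word [x]) (word [y]) - (if n = 1 then word [br x y] else 0)" for n
  have "(\<Sum>n\<le>2. fsc (z ^ n) (v n)) \<in> idl0" for z
  proof -
    have "starcomm z (word [x]) (word [y]) = unsymm z (word [x] * word [y] - word [y] * word [x])"
      by (simp add: starcomm_def star_def symm_gen unsymm.diff)
    also have "cg0 \<dots> (unsymm z (fsc z (word [br x y])))"
    proof (rule unsymm_cong)
      have "cg (brz z) (word [x] * word [y] - word [y] * word [x])
         (word [y] * word [x] + word [brz z x y] - word [y] * word [x])"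
        by (intro cg_diff gen_swap cg_refl)
      also have "cg (brz z) \<dots> (word [y] * word [x] + fsc z (word [br x y]) - word [y] * word [x])"
        unfolding brz_def[of z x y] by (intro cg_diff cg_add gen_scale cg_refl)
      finally show "cg (brz z) (word [x] * word [y] - word [y] * word [x]) (fsc z (word [br x y]))" by simp
    qed
    also have "cg0 (unsymm z (fsc z (word [br x y]))) (fsc z (word [br x y]))"
      using unsymm_symm[of z "fsc z (word [br x y])"] by (simp add: symm.scale symm_gen)
    finally have "starcomm z (word [x]) (word [y]) - fsc z (word [br x y]) \<in> idl0" by (simp add: cg_def)
    thus ?thesis
      unfolding starcomm_eq[OF f1 f1 le2]
      by (simp add: v_def fs.scale_right_diff_distrib numeral_2_eq_2 algebra_simps)
  qed
  hence "v 1 \<in> idl0" by (rule coeffs_in_idl[where v = v]) simp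
  thus ?thesis by (simp add: v_def cg_def)
qed

end

section \<open>Power series in a nilpotent element\<close>

locale central_algebra = vector_space s
  for s :: "'k::field_char_0 \<Rightarrow> 'r::ring_1 \<Rightarrow> 'r" +
  assumes s_mult_left: "s c x * y = s c (x * y)" and s_mult_right: "x * s c y = s c (x * y)"
begin

definition ev :: "nat \<Rightarrow> 'k fps \<Rightarrow> 'r \<Rightarrow> 'r" where
  "ev n f x = (\<Sum>i\<le>n. s (fps_nth f i) (x ^ i))"

end

text \<open>Power series calculus modulo an ideal \<open>I\<close> without forming the quotient.
  \<open>N\<close> is the degree of truncation; nilpotence is assumed only of the elements that are
  inserted.\<close>

locale nilpotent_mod = central_algebra s
  for s :: "'k::field_char_0 \<Rightarrow> 'r::ring_1 \<Rightarrow> 'r" +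
  fixes I :: "'r set" and N :: nat
  assumes subI: "subspace I" and I_left: "x \<in> I \<Longrightarrow> a * x \<in> I" and I_right: "x \<in> I \<Longrightarrow> x * a \<in> I"
begin

definition eqm :: "'r \<Rightarrow> 'r \<Rightarrow> bool" where
  "eqm x y \<longleftrightarrow> x - y \<in> I"

lemma eqm_refl [simp, intro]: "eqm x x"
  by (simp add: eqm_def subspace_0[OF subI])

lemma eqm_sym: "eqm x y \<Longrightarrow> eqm y x"
  using subspace_neg[OF subI, of "x - y"] by (simp add: eqm_def)

lemma eqm_trans [trans]: "eqm x y \<Longrightarrow> eqm y z \<Longrightarrow> eqm x z"
  using subspace_add[OF subI, of "x - y" "y - z"] by (simp add: eqm_def)

lemma eqm_mult: "eqm x y \<Longrightarrow> eqm x' y' \<Longrightarrow> eqm (x * x') (y * y')"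
proof -
  assume *: "eqm x y" "eqm x' y'"
  have "x * x' - y * y' = (x - y) * x' + y * (x' - y')" by (simp add: algebra_simps)
  with * show ?thesis by (simp add: eqm_def subspace_add[OF subI] I_left I_right)
qed

lemma eqm_power: "eqm x y \<Longrightarrow> eqm (x ^ n) (y ^ n)"
  by (induction n) (simp_all add: eqm_mult)

lemma eqm_sum: "(\<And>i. i \<in> A \<Longrightarrow> eqm (f i) (g i)) \<Longrightarrow> eqm (sum f A) (sum g A)"
  unfolding eqm_def sum_subtractf[symmetric] by (rule subspace_sum[OF subI])

lemma eqm_scale: "eqm x y \<Longrightarrow> eqm (s c x) (s c y)"
  using subspace_scale[OF subI, of "x - y" c] by (simp add: eqm_def scale_right_diff_distrib)

lemma ev_cong: "eqm x y \<Longrightarrow> eqm (ev N f x) (ev N f y)"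
  unfolding ev_def by (intro eqm_sum eqm_scale eqm_power)

lemma double_sum_eqm:
  assumes "\<And>i j. i \<le> N \<Longrightarrow> j \<le> N \<Longrightarrow> N < i + j \<Longrightarrow> X i j \<in> I"
  shows "eqm (\<Sum>i\<le>N. \<Sum>j\<le>N. X i j) (\<Sum>n\<le>N. \<Sum>i\<le>n. X i (n - i))"
proof -
  have "(\<Sum>i\<le>N. \<Sum>j\<le>N. X i j) = (\<Sum>(i, j)\<in>{..N} \<times> {..N}. X i j)"
    by (simp add: sum.cartesian_product)
  also have "{..N} \<times> {..N} = {(i, j). i + j \<le> N} \<union> {(i, j). i \<le> N \<and> j \<le> N \<and> N < i + j}" by auto
  also have "(\<Sum>(i, j)\<in>\<dots>. X i j) = (\<Sum>(i, j)\<in>{(i, j). i + j \<le> N}. X i j) +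
      (\<Sum>(i, j)\<in>{(i, j). i \<le> N \<and> j \<le> N \<and> N < i + j}. X i j)"
  proof (rule sum.union_disjoint)
    show "finite {(i, j). i + j \<le> N}" "finite {(i, j). i \<le> N \<and> j \<le> N \<and> N < i + j}"
      by (rule finite_subset[of _ "{..N} \<times> {..N}"]; auto)+
  qed auto
  finally have "(\<Sum>i\<le>N. \<Sum>j\<le>N. X i j) - (\<Sum>(i, j)\<in>{(i, j). i + j \<le> N}. X i j) =
      (\<Sum>(i, j)\<in>{(i, j). i \<le> N \<and> j \<le> N \<and> N < i + j}. X i j)" by simp
  also have "\<dots> \<in> I" by (rule subspace_sum[OF subI]) (use assms in auto)
  finally show ?thesis by (simp add: eqm_def sum.triangle_reindex_eq)
qed

lemma nil_powers: "x ^ Suc N \<in> I \<Longrightarrow> N < n \<Longrightarrow> x ^ n \<in> I"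
  using I_left[of "x ^ Suc N" "x ^ (n - Suc N)"] unfolding power_add[symmetric] by simp

lemma ev_mult:
  assumes "x ^ Suc N \<in> I"
  shows "eqm (ev N f x * ev N g x) (ev N (f * g) x)"
proof -
  have "ev N f x * ev N g x = (\<Sum>i\<le>N. \<Sum>j\<le>N. s (fps_nth f i * fps_nth g j) (x ^ (i + j)))"
    by (simp add: ev_def sum_product s_mult_left s_mult_right power_add mult.commute[of "fps_nth g _"])
  also have "eqm \<dots> (\<Sum>n\<le>N. \<Sum>i\<le>n. s (fps_nth f i * fps_nth g (n - i)) (x ^ (i + (n - i))))"
    by (rule double_sum_eqm) (rule subspace_scale[OF subI nil_powers[OF assms]])
  also have "(\<Sum>n\<le>N. \<Sum>i\<le>n. s (fps_nth f i * fps_nth g (n - i)) (x ^ (i + (n - i)))) = ev N (f * g) x"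
    by (simp add: ev_def fps_mult_nth atLeast0AtMost scale_sum_left)
  finally show ?thesis .
qed

lemma ev_power:
  assumes "x ^ Suc N \<in> I"
  shows "eqm (ev N g x ^ i) (ev N (g ^ i) x)"
proof (induction i)
  case 0
  have "ev N 1 x = (\<Sum>i\<in>{0}. s (fps_nth 1 i) (x ^ i))"
    unfolding ev_def by (rule sum.mono_neutral_right) auto
  thus ?case by simp
next
  case (Suc i)
  show ?case using eqm_trans[OF eqm_mult[OF eqm_refl Suc] ev_mult[OF assms]] by simp
qed

text \<open>As \<open>g\<close> has no constant term, \<open>g ^ i\<close> reaches the coefficient n
  only for i \<le> n, so the truncated sums agree.\<close>

lemma ev_compose:
  assumes "x ^ Suc N \<in> I" "fps_nth g 0 = 0"
  shows "eqm (ev N f (ev N g x)) (ev N (f oo g) x)"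
proof -
  have z: "fps_nth (g ^ i) n = 0" if "n < i" for n i
    using startsby_zero_power_prefix[OF assms(2)] that by blast
  have "ev N f (ev N g x) = (\<Sum>i\<le>N. s (fps_nth f i) (ev N g x ^ i))" by (simp add: ev_def)
  also have "eqm \<dots> (\<Sum>i\<le>N. s (fps_nth f i) (ev N (g ^ i) x))"
    by (intro eqm_sum eqm_scale ev_power assms)
  also have "(\<Sum>i\<le>N. s (fps_nth f i) (ev N (g ^ i) x)) =
      (\<Sum>n\<le>N. s (\<Sum>i\<le>N. fps_nth f i * fps_nth (g ^ i) n) (x ^ n))"
    unfolding ev_def by (simp add: scale_sum_right scale_sum_left, subst sum.swap) simp
  also have "\<dots> = ev N (f oo g) x"
    unfolding ev_def fps_compose_nth atLeast0AtMost
  proof (rule sum.cong[OF refl], rule arg_cong2[of _ _ _ _ s, OF _ refl])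
    fix n assume "n \<in> {..N}"
    thus "(\<Sum>i\<le>N. fps_nth f i * fps_nth (g ^ i) n) = (\<Sum>i\<le>n. fps_nth f i * fps_nth (g ^ i) n)"
      by (intro sum.mono_neutral_right) (auto simp: z)
  qed
  finally show ?thesis .
qed

end

definition exp1 :: "'k::field_char_0 fps" where
  "exp1 = fps_exp 1 - 1"

lemma exp1_0: "fps_nth exp1 0 = 0"
  by (simp add: exp1_def)

text \<open>\<open>fps_ln 1\<close> is log (1 + x), the compositional inverse of
  \<open>exp1\<close>.\<close>

lemma exp_compose_ln: "fps_exp 1 oo fps_ln 1 = (1 + fps_X :: 'k::field_char_0 fps)"
proof -
  have "exp1 oo fps_inv exp1 = (fps_X :: 'k fps)"
    by (rule fps_inv_right) (simp_all add: exp1_def)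
  hence "exp1 oo fps_ln 1 = (fps_X :: 'k fps)"
    by (simp add: exp1_def fps_ln_fps_exp_inv)
  thus ?thesis by (simp add: exp1_def fps_compose_sub_distrib algebra_simps)
qed

lemma ln_compose_exp: "fps_ln 1 oo exp1 = (fps_X :: 'k::field_char_0 fps)"
proof -
  have "fps_inv exp1 oo exp1 = (fps_X :: 'k fps)"
    by (rule fps_inv) (simp_all add: exp1_def)
  thus ?thesis by (simp add: exp1_def fps_ln_fps_exp_inv)
qed

section \<open>The differential of the exponential\<close>

text \<open>This is (- ad Z)^j X; the sign fits the derivative of exp Z with exp Z written on the
  left.\<close>

primrec ad_iter :: "'r::ring_1 \<Rightarrow> 'r \<Rightarrow> nat \<Rightarrow> 'r" where
  "ad_iter Z X 0 = X"
| "ad_iter Z X (Suc j) = ad_iter Z X j * Z - Z * ad_iter Z X j"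

text \<open>Each factor Z to the right of D Z is moved to the left at the cost of a commutator;
  Pascal's rule collects the terms.\<close>

lemma deriv_power:
  fixes D :: "'r::ring_1 \<Rightarrow> 'r"
  assumes D: "\<And>x y. D (x * y) = x * D y + D x * y" and D1: "D 1 = 0"
  shows "D (Z ^ n) = (\<Sum>j<n. of_nat (n choose Suc j) * (Z ^ (n - Suc j) * ad_iter Z (D Z) j))"
proof (induction n)
  case (Suc n)
  let ?A = "ad_iter Z (D Z)"
  define c where "c m j = Z ^ m * ?A j" for m j
  have c_mult: "c m j * Z = c (Suc m) j + c m (Suc j)" for m j
  proof -
    have "Z ^ m * (Z * y) = Z * (Z ^ m * y)" for y by (simp add: power_commutes flip: mult.assoc)
    thus ?thesis by (simp add: c_def algebra_simps)
  qed
  have "D (Z ^ Suc n) = Z ^ n * D Z + D (Z ^ n) * Z" by (simp add: D power_Suc2 del: power_Suc)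
  also have "D (Z ^ n) * Z = (\<Sum>j<n. of_nat (n choose Suc j) * c (Suc n - Suc j) j) +
      (\<Sum>j<n. of_nat (n choose Suc j) * c (n - Suc j) (Suc j))"
    unfolding Suc sum_distrib_right sum.distrib[symmetric]
    by (intro sum.cong refl) (simp add: c_mult mult.assoc distrib_left Suc_diff_Suc flip: c_def)
  also have "(\<Sum>j<n. of_nat (n choose Suc j) * c (Suc n - Suc j) j) =
      (\<Sum>j<Suc n. of_nat (n choose Suc j) * c (Suc n - Suc j) j)"
    by (simp add: binomial_eq_0)
  finally have "D (Z ^ Suc n) = (\<Sum>j<Suc n. of_nat (n choose Suc j) * c (Suc n - Suc j) j) +
      (c n 0 + (\<Sum>j<n. of_nat (n choose Suc j) * c (n - Suc j) (Suc j)))"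
    by (simp add: c_def add_ac del: sum.lessThan_Suc)
  also have "c n 0 + (\<Sum>j<n. of_nat (n choose Suc j) * c (n - Suc j) (Suc j)) =
      (\<Sum>j<Suc n. of_nat (n choose j) * c (Suc n - Suc j) j)"
    by (simp add: sum.lessThan_Suc_shift del: sum.lessThan_Suc)
  also have "(\<Sum>j<Suc n. of_nat (n choose Suc j) * c (Suc n - Suc j) j) + \<dots> =
      (\<Sum>j<Suc n. of_nat (Suc n choose Suc j) * c (Suc n - Suc j) j)"
    unfolding sum.distrib[symmetric] by (intro sum.cong refl) (simp add: algebra_simps)
  finally show ?case by (simp only: c_def)
qed (simp add: D1)

context nilpotent_mod
begin

text \<open>Dividing the binomials in \<open>deriv_power\<close> by n! leaves 1 / (i! (j+1)!) with n
  = i + j + 1. This shift explains \<open>Suc N\<close> against \<open>N\<close>.\<close>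

lemma deriv_exp:
  fixes D :: "'r \<Rightarrow> 'r"
  assumes D: "\<And>x y. D (x * y) = x * D y + D x * y" and D1: "D 1 = 0"
    and Dadd: "\<And>x y. D (x + y) = D x + D y" and Ds: "\<And>c x. D (s c x) = s c (D x)"
    and nil: "\<And>i j. N < i + j \<Longrightarrow> Z ^ i * ad_iter Z (D Z) j \<in> I"
  shows "eqm (D (ev (Suc N) (fps_exp 1) Z))
     (ev N (fps_exp 1) Z * (\<Sum>j\<le>N. s (1 / fact (Suc j)) (ad_iter Z (D Z) j)))"
proof -
  let ?A = "ad_iter Z (D Z)"
  let ?X = "\<lambda>i j. s (1 / (fact i * fact (Suc j))) (Z ^ i * ?A j)"
  have D0: "D 0 = 0" using Dadd[of 0 0] by simp
  have Dsum: "D (sum f A) = (\<Sum>i\<in>A. D (f i))" if "finite A" for f and A :: "nat set"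
    using that by (induction A rule: finite_induct) (simp_all add: D0 Dadd)
  have of_nat_s: "of_nat m * x = s (of_nat m) x" for m x
    by (induction m) (simp_all add: scale_left_distrib distrib_right)
  have summand: "s (1 / fact n) (of_nat (n choose Suc j) * (Z ^ (n - Suc j) * ?A j)) = ?X (n - Suc j) j"
    if "j < n" for n j
  proof -
    have "1 / fact n * of_nat (n choose Suc j) = (1 / (fact (n - Suc j) * fact (Suc j)) :: 'k)"
      using that by (subst binomial_fact) (auto simp: field_simps)
    thus ?thesis unfolding of_nat_s by simp
  qed
  have "ev N (fps_exp 1) Z * (\<Sum>j\<le>N. s (1 / fact (Suc j)) (?A j)) = (\<Sum>i\<le>N. \<Sum>j\<le>N. ?X i j)"
    by (simp add: ev_def sum_product s_mult_left s_mult_right mult.commute[of "fact (Suc _)"] del: fact_Suc)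
  also have "eqm \<dots> (\<Sum>n\<le>N. \<Sum>i\<le>n. ?X i (n - i))"
    by (rule double_sum_eqm) (rule subspace_scale[OF subI nil])
  also have "(\<Sum>n\<le>N. \<Sum>i\<le>n. ?X i (n - i)) = (\<Sum>n\<le>N. \<Sum>j\<le>n. ?X (n - j) j)"
  proof (rule sum.cong[OF refl])
    fix n show "(\<Sum>i\<le>n. ?X i (n - i)) = (\<Sum>j\<le>n. ?X (n - j) j)"
      by (rule sum.reindex_bij_witness[of _ "\<lambda>i. n - i" "\<lambda>i. n - i"]) auto
  qed
  also have "\<dots> = (\<Sum>n\<le>N. \<Sum>j<Suc n. s (1 / fact (Suc n)) (of_nat (Suc n choose Suc j) * (Z ^ (Suc n - Suc j) * ?A j)))"
  proof (intro sum.cong)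
    fix n j assume "j \<in> {..<Suc n}"
    thus "?X (n - j) j = s (1 / fact (Suc n)) (of_nat (Suc n choose Suc j) * (Z ^ (Suc n - Suc j) * ?A j))"
      using summand[of j "Suc n"] by (simp only: lessThan_iff diff_Suc_Suc)
  qed auto
  also have "\<dots> = (\<Sum>n\<le>N. s (1 / fact (Suc n)) (D (Z ^ Suc n)))"
    unfolding deriv_power[where D = D, OF D D1] scale_sum_right ..
  also have "\<dots> = (\<Sum>n\<le>Suc N. s (1 / fact n) (D (Z ^ n)))"
    by (subst sum.atMost_Suc_shift) (simp add: D1)
  also have "\<dots> = D (ev (Suc N) (fps_exp 1) Z)"
    unfolding ev_def by (subst Dsum) (simp_all add: Ds)
  finally show ?thesis by (rule eqm_sym)
qed

end

section \<open>The Baker-Campbell-Hausdorff series\<close>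

text \<open>Series \<open>\<Sum> X k l t\<^sup>k s\<^sup>l\<close> are represented by series in \<open>s\<close> with coefficients in series in \<open>t\<close>, i.e.
  \<open>X k l\<close> is \<^term>\<open>fps_nth (fps_nth X l) k\<close>.\<close>

definition rsc :: "'k::field_char_0 \<Rightarrow> ('x list \<Rightarrow>\<^sub>0 'k) fps fps \<Rightarrow> ('x list \<Rightarrow>\<^sub>0 'k) fps fps" where
  "rsc c X = fps_const (fps_const (Poly_Mapping.single 0 c)) * X"

lemma rsc_nth: "fps_nth (fps_nth (rsc c X) l) k = fsc c (fps_nth (fps_nth X l) k)"
  by (simp add: rsc_def fsc_def)

lemma mult_nth2:
  fixes X Y :: "'a::ring_1 fps fps"
  shows "fps_nth (fps_nth (X * Y) l) k =
     (\<Sum>j\<le>l. \<Sum>i\<le>k. fps_nth (fps_nth X j) i * fps_nth (fps_nth Y (l - j)) (k - i))"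
  by (simp add: fps_mult_nth[where 'a = "'a fps"] fps_sum_nth fps_mult_nth atLeast0AtMost)

text \<open>Indexing by the second factor lets the two products of a commutator be combined term by
  term.\<close>

lemma mult_nth2_rev:
  fixes X Y :: "'a::ring_1 fps fps"
  shows "fps_nth (fps_nth (X * Y) l) k =
     (\<Sum>j\<le>l. \<Sum>i\<le>k. fps_nth (fps_nth X (l - j)) (k - i) * fps_nth (fps_nth Y j) i)"
proof -
  have rev: "(\<Sum>i\<le>n. f i) = (\<Sum>i\<le>n. f (n - i))" for f :: "nat \<Rightarrow> 'b::comm_monoid_add" and n
    by (rule sum.reindex_bij_witness[of _ "\<lambda>i. n - i" "\<lambda>i. n - i"]) auto
  have "fps_nth (fps_nth (X * Y) l) k =
     (\<Sum>j\<le>l. \<Sum>i\<le>k. fps_nth (fps_nth X (l - j)) i * fps_nth (fps_nth Y (l - (l - j))) (k - i))"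
    unfolding mult_nth2 by (rule rev)
  also have "\<dots> = (\<Sum>j\<le>l. \<Sum>i\<le>k. fps_nth (fps_nth X (l - j)) (k - i) * fps_nth (fps_nth Y (l - (l - j))) (k - (k - i)))"
    by (intro sum.cong refl rev)
  finally show ?thesis by simp
qed

lemma fps2_ext: "(\<And>k l. fps_nth (fps_nth X l) k = fps_nth (fps_nth Y l) k) \<Longrightarrow> X = Y"
  by (rule fps_ext, rule fps_ext)

interpretation rs: central_algebra rsc
proof unfold_locales
  fix a b :: "'k::field_char_0" and x y :: "('x list \<Rightarrow>\<^sub>0 'k) fps fps"
  show "rsc a (x + y) = rsc a x + rsc a y" "rsc (a + b) x = rsc a x + rsc b x"
    "rsc a (rsc b x) = rsc (a * b) x" "rsc 1 x = x"
    by (rule fps2_ext; simp add: rsc_nth fs.scale_right_distrib fs.scale_left_distrib)+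
  show "rsc a x * y = rsc a (x * y)" "x * rsc a y = rsc a (x * y)"
    by (rule fps2_ext; simp add: mult_nth2 rsc_nth fs.scale_sum_right fsc_mult_left fsc_mult_right)+
qed

lemma nth2_sum: "fps_nth (fps_nth (sum f A) l) k = (\<Sum>i\<in>A. fps_nth (fps_nth (f i) l) k)"
  by (simp add: fps_sum_nth)

lemma ev_nth: "fps_nth (fps_nth (rs.ev n f X) l) k = (\<Sum>i\<le>n. fsc (fps_nth f i) (fps_nth (fps_nth (X ^ i) l) k))"
  by (simp add: rs.ev_def fps_sum_nth rsc_nth)

section \<open>Filtration of double series by total order\<close>

definition ordi :: "nat \<Rightarrow> ('a::ring_1) fps fps set" where
  "ordi n = {X. \<forall>k l. k + l < n \<longrightarrow> fps_nth (fps_nth X l) k = 0}"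

lemma ordiD: "X \<in> ordi n \<Longrightarrow> k + l < n \<Longrightarrow> fps_nth (fps_nth X l) k = 0"
  by (simp add: ordi_def)

lemma ordi_mono: "m \<le> n \<Longrightarrow> ordi n \<subseteq> ordi m"
  by (auto simp: ordi_def)

lemma ordi_mult:
  assumes "X \<in> ordi m" "Y \<in> ordi n"
  shows "X * Y \<in> ordi (m + n)"
  unfolding ordi_def
proof (intro CollectI allI impI)
  fix k l assume kl: "k + l < m + n"
  show "fps_nth (fps_nth (X * Y) l) k = 0" unfolding mult_nth2
  proof (intro sum.neutral ballI)
    fix j i assume "j \<in> {..l}" "i \<in> {..k}"
    hence "i + j < m \<or> (k - i) + (l - j) < n" using kl by auto
    thus "fps_nth (fps_nth X j) i * fps_nth (fps_nth Y (l - j)) (k - i) = 0"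
      using ordiD[OF assms(1)] ordiD[OF assms(2)] by auto
  qed
qed

lemma ordi_0: "X \<in> ordi 0"
  by (simp add: ordi_def)

lemma ordi_power: "X \<in> ordi 1 \<Longrightarrow> X ^ n \<in> ordi n"
proof (induction n)
  case (Suc n)
  thus ?case using ordi_mult[of X 1 "X ^ n" n] by simp
qed (simp add: ordi_0)

lemma nilpotent_mod_ordi: "nilpotent_mod rsc (ordi (Suc N))"
proof unfold_locales
  show "rs.subspace (ordi (Suc N))"
    by (simp add: rs.subspace_def ordi_def rsc_nth)
  show "a * x \<in> ordi (Suc N)" "x * a \<in> ordi (Suc N)" if "x \<in> ordi (Suc N)" for a x :: "('b list \<Rightarrow>\<^sub>0 'a) fps fps"
    using ordi_mult[OF that ordi_0[of a]] ordi_mult[OF ordi_0[of a] that] by simp_all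
qed

subsection \<open>Translation of the double series\<close>

definition to_fps :: "(nat \<Rightarrow> nat \<Rightarrow> 'a) \<Rightarrow> 'a::zero fps fps" where
  "to_fps F = Abs_fps (\<lambda>l. Abs_fps (\<lambda>k. F k l))"

definition of_fps :: "'a::zero fps fps \<Rightarrow> nat \<Rightarrow> nat \<Rightarrow> 'a" where
  "of_fps X k l = fps_nth (fps_nth X l) k"

lemma of_to_fps [simp]: "of_fps (to_fps F) = F"
  by (simp add: of_fps_def[abs_def] to_fps_def)

lemma to_of_fps [simp]: "to_fps (of_fps X) = X"
  by (rule fps2_ext) (simp add: of_fps_def to_fps_def)

lemma free_alg_simps [simp]:
  "carrier free_alg = UNIV" "mult free_alg = (*)" "one free_alg = 1" "zero free_alg = 0"
  "add free_alg = (+)" "smult free_alg = fsc"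
  by (simp_all add: free_alg_def fsc_def[abs_def])

lemma ring_free_alg: "ring (free_alg :: ('k::field, 'x list \<Rightarrow>\<^sub>0 'k) module)"
proof (rule ringI)
  show "abelian_group (free_alg :: ('k::field, 'x list \<Rightarrow>\<^sub>0 'k) module)"
  proof (rule abelian_groupI)
    fix x :: "'x list \<Rightarrow>\<^sub>0 'k"
    show "\<exists>y\<in>carrier free_alg. y \<oplus>\<^bsub>free_alg\<^esub> x = \<zero>\<^bsub>free_alg\<^esub>"
      by (rule bexI[of _ "- x"]) auto
  qed (auto simp: add_ac)
  show "monoid (free_alg :: ('k::field, 'x list \<Rightarrow>\<^sub>0 'k) module)"
    by (rule monoidI) (auto simp: mult.assoc)
qed (auto simp: algebra_simps)

lemma finsum_free_alg:
  fixes f :: "'i \<Rightarrow> 'x list \<Rightarrow>\<^sub>0 'k::field"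
  shows "finsum free_alg f A = sum f A"
proof -
  interpret ring "free_alg :: ('k, 'x list \<Rightarrow>\<^sub>0 'k) module" by (rule ring_free_alg)
  show ?thesis
  proof (induction A rule: infinite_finite_induct)
    case (infinite A)
    thus ?case by (simp add: finsum_def finprod_def)
  next
    case (insert x A)
    thus ?case by (subst finsum_insert) auto
  qed simp
qed

lemma minus_free_alg:
  fixes a b :: "'x list \<Rightarrow>\<^sub>0 'k::field"
  shows "a \<ominus>\<^bsub>free_alg\<^esub> b = a - b"
proof -
  interpret ring "free_alg :: ('k, 'x list \<Rightarrow>\<^sub>0 'k) module" by (rule ring_free_alg)
  have "\<ominus>\<^bsub>free_alg\<^esub> b = - b" using minus_equality[of "- b" b] by simp
  thus ?thesis by (simp add: minus_eq)
qed

lemma ser_mult_free_alg: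
  fixes F G :: "nat \<Rightarrow> nat \<Rightarrow> 'x list \<Rightarrow>\<^sub>0 'k::field"
  shows "ser_mult free_alg F G = of_fps (to_fps F * to_fps G)"
proof (intro ext)
  fix k l
  have "ser_mult free_alg F G k l = (\<Sum>i\<le>k. \<Sum>j\<le>l. F i j * G (k - i) (l - j))"
    by (simp add: ser_mult_def finsum_free_alg)
  also have "\<dots> = (\<Sum>j\<le>l. \<Sum>i\<le>k. F i j * G (k - i) (l - j))" by (rule sum.swap)
  also have "\<dots> = of_fps (to_fps F * to_fps G) k l" by (simp add: of_fps_def mult_nth2 to_fps_def)
  finally show "ser_mult free_alg F G k l = of_fps (to_fps F * to_fps G) k l" .
qed

lemma ser_power_free_alg:
  fixes F :: "nat \<Rightarrow> nat \<Rightarrow> 'x list \<Rightarrow>\<^sub>0 'k::field"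
  shows "ser_power free_alg F m = of_fps (to_fps F ^ m)"
proof (induction m)
  case 0
  have "ser_one (free_alg :: ('k, 'x list \<Rightarrow>\<^sub>0 'k) module) = of_fps 1"
    by (intro ext) (auto simp: ser_one_def of_fps_def fps_one_nth)
  thus ?case by (simp add: ser_power_def)
next
  case (Suc m)
  thus ?case by (simp add: ser_power_def ser_mult_free_alg)
qed

lemma ser_exp_free_alg:
  fixes F :: "nat \<Rightarrow> nat \<Rightarrow> 'x list \<Rightarrow>\<^sub>0 'k::field_char_0"
  shows "ser_exp free_alg F k l = (\<Sum>m\<le>k + l. fsc (1 / fact m) (fps_nth (fps_nth (to_fps F ^ m) l) k))"
  by (simp add: ser_exp_def finsum_free_alg ser_power_free_alg of_fps_def inverse_eq_divide)

lemma ser_exp_free_alg_ev: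
  fixes F :: "nat \<Rightarrow> nat \<Rightarrow> 'x list \<Rightarrow>\<^sub>0 'k::field_char_0"
  assumes "to_fps F \<in> ordi 1" "k + l \<le> N"
  shows "ser_exp free_alg F k l = fps_nth (fps_nth (rs.ev N (fps_exp 1) (to_fps F)) l) k"
  unfolding ser_exp_free_alg ev_nth
  by (rule sum.mono_neutral_cong_left) (use assms ordiD[OF ordi_power[OF assms(1)]] in auto)

lemma ser_log_free_alg_ev:
  fixes F :: "nat \<Rightarrow> nat \<Rightarrow> 'x list \<Rightarrow>\<^sub>0 'k::field_char_0"
  assumes "to_fps F - 1 \<in> ordi 1" "k + l \<le> N"
  shows "ser_log free_alg F k l = fps_nth (fps_nth (rs.ev N (fps_ln 1) (to_fps F - 1)) l) k"
proof -
  have "to_fps (\<lambda>i j. F i j - ser_one free_alg i j) = to_fps F - 1"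
    by (rule fps2_ext) (auto simp: to_fps_def ser_one_def fps_one_nth)
  hence "ser_log free_alg F k l =
      (\<Sum>m\<in>{1..k + l}. fsc ((- 1) ^ (m + 1) / of_nat m) (fps_nth (fps_nth ((to_fps F - 1) ^ m) l) k))"
    by (simp add: ser_log_def finsum_free_alg minus_free_alg ser_power_free_alg of_fps_def)
  also have "\<dots> = (\<Sum>m\<le>N. fsc (fps_nth (fps_ln 1) m) (fps_nth (fps_nth ((to_fps F - 1) ^ m) l) k))"
  proof (rule sum.mono_neutral_cong_left)
    fix m assume "m \<in> {1..k + l}"
    thus "fsc ((- 1) ^ (m + 1) / of_nat m) (fps_nth (fps_nth ((to_fps F - 1) ^ m) l) k) =
        fsc (fps_nth (fps_ln 1) m) (fps_nth (fps_nth ((to_fps F - 1) ^ m) l) k)"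
      by (cases m) (auto simp: fps_ln_nth)
  qed (use assms ordiD[OF ordi_power[OF assms(1)]] in \<open>auto simp: not_le\<close>)
  finally show ?thesis by (simp add: ev_nth)
qed

lemma to_fps_power_single:
  fixes a :: "'a::ring_1"
  shows "fps_nth (fps_nth (to_fps (\<lambda>k l. if k = p \<and> l = q then a else 0) ^ m) l) k =
    (if k = m * p \<and> l = m * q then a ^ m else 0)"
proof (induction m arbitrary: k l)
  case 0
  show ?case by (auto simp: fps_one_nth)
next
  case (Suc m)
  have "fps_nth (fps_nth (to_fps (\<lambda>k l. if k = p \<and> l = q then a else 0) ^ Suc m) l) k =
     (\<Sum>j\<le>l. \<Sum>i\<le>k. (if i = p \<and> j = q then a else 0) * (if k - i = m * p \<and> l - j = m * q then a ^ m else 0))"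
    unfolding power_Suc mult_nth2 Suc.IH by (simp add: to_fps_def)
  also have "\<dots> = (\<Sum>j\<le>l. \<Sum>i\<le>k. if j = q then if i = p then a * (if k - p = m * p \<and> l - q = m * q then a ^ m else 0) else 0 else 0)"
    by (intro sum.cong refl) auto
  also have "\<dots> = (\<Sum>j\<le>l. if j = q then (\<Sum>i\<le>k. if i = p then a * (if k - p = m * p \<and> l - q = m * q then a ^ m else 0) else 0) else 0)"
    by (intro sum.cong refl) auto
  also have "\<dots> = (if q \<le> l \<and> p \<le> k then a * (if k - p = m * p \<and> l - q = m * q then a ^ m else 0) else 0)"
    by (simp add: sum.delta)
  also have "\<dots> = (if k = Suc m * p \<and> l = Suc m * q then a ^ Suc m else 0)"
    by auto
  finally show ?case .
qed

section \<open>The product of the exponentials and its logarithm\<close>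

definition bch_exp :: "(bch_var list \<Rightarrow>\<^sub>0 'k::field_char_0) fps fps" where
  "bch_exp = to_fps (\<lambda>k l. fsc (1 / (fact k * fact l)) (free_gen Bch_x ^ k * free_gen Bch_y ^ l))"

definition bch_log :: "(bch_var list \<Rightarrow>\<^sub>0 'k::field_char_0) fps fps" where
  "bch_log = to_fps bch_free"

lemma bch_exp_nth: "fps_nth (fps_nth bch_exp l) k = fsc (1 / (fact k * fact l)) (free_gen Bch_x ^ k * free_gen Bch_y ^ l)"
  by (simp add: bch_exp_def to_fps_def)

lemma bch_log_nth: "fps_nth (fps_nth bch_log l) k = bch_free k l"
  by (simp add: bch_log_def to_fps_def)

lemma ser_exp_single:
  assumes "p + q = 1"
  shows "ser_exp free_alg (\<lambda>k l. if k = p \<and> l = q then a else 0) k l =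
    (if p = 1 then if l = 0 then fsc (1 / fact k) (a ^ k) else 0
     else if k = 0 then fsc (1 / fact l) (a ^ l) else 0)"
proof -
  have "p = 1 \<and> q = 0 \<or> p = 0 \<and> q = 1" using assms by auto
  thus ?thesis
  proof
    assume "p = 1 \<and> q = 0"
    hence "ser_exp free_alg (\<lambda>k l. if k = p \<and> l = q then a else 0) k l =
        (\<Sum>m\<le>k + l. if m = k then if l = 0 then fsc (1 / fact k) (a ^ k) else 0 else 0)"
      unfolding ser_exp_free_alg to_fps_power_single by (intro sum.cong refl) auto
    thus ?thesis using \<open>p = 1 \<and> q = 0\<close> by (simp add: sum.delta)
  next
    assume "p = 0 \<and> q = 1"
    hence "ser_exp free_alg (\<lambda>k l. if k = p \<and> l = q then a else 0) k l =
        (\<Sum>m\<le>k + l. if m = l then if k = 0 then fsc (1 / fact l) (a ^ l) else 0 else 0)"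
      unfolding ser_exp_free_alg to_fps_power_single by (intro sum.cong refl) auto
    thus ?thesis using \<open>p = 0 \<and> q = 1\<close> by (simp add: sum.delta)
  qed
qed

lemma bch_free_eq: "bch_free = ser_log free_alg (of_fps bch_exp)"
proof -
  define E1 where "E1 = ser_exp free_alg (\<lambda>k l. if k = 1 \<and> l = 0 then free_gen Bch_x else (0 :: bch_var list \<Rightarrow>\<^sub>0 'a))"
  define E2 where "E2 = ser_exp free_alg (\<lambda>k l. if k = 0 \<and> l = 1 then free_gen Bch_y else (0 :: bch_var list \<Rightarrow>\<^sub>0 'a))"
  have E1: "E1 k l = (if l = 0 then fsc (1 / fact k) (free_gen Bch_x ^ k) else 0)"
    and E2: "E2 k l = (if k = 0 then fsc (1 / fact l) (free_gen Bch_y ^ l) else 0)" for k l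
    unfolding E1_def E2_def by (subst ser_exp_single; simp)+
  have "to_fps E1 * to_fps E2 = bch_exp"
  proof (rule fps2_ext)
    fix k l
    have "fps_nth (fps_nth (to_fps E1 * to_fps E2) l) k = (\<Sum>j\<le>l. \<Sum>i\<le>k. E1 i j * E2 (k - i) (l - j))"
      by (simp add: mult_nth2 to_fps_def)
    \<comment> \<open>The first factor has no s and the second no t, so only j = 0, i = k
      survives.\<close>
    also have "\<dots> = (\<Sum>j\<le>l. if j = 0 then (\<Sum>i\<le>k. if i = k then E1 k 0 * E2 0 l else 0) else 0)"
    proof (rule sum.cong[OF refl])
      fix j assume "j \<in> {..l}"
      have "E1 i 0 * E2 (k - i) l = (if i = k then E1 k 0 * E2 0 l else 0)" if "i \<le> k" for i
        using that by (auto simp: E2)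
      thus "(\<Sum>i\<le>k. E1 i j * E2 (k - i) (l - j)) = (if j = 0 then (\<Sum>i\<le>k. if i = k then E1 k 0 * E2 0 l else 0) else 0)"
        by (cases "j = 0") (simp_all add: E1[of _ j])
    qed
    also have "\<dots> = fps_nth (fps_nth bch_exp l) k"
      by (simp add: sum.delta bch_exp_nth E1 E2 fsc_mult_left fsc_mult_right mult.commute)
    finally show "fps_nth (fps_nth (to_fps E1 * to_fps E2) l) k = fps_nth (fps_nth bch_exp l) k" .
  qed
  thus ?thesis unfolding bch_free_def ser_mult_free_alg E1_def[symmetric] E2_def[symmetric] by simp
qed

lemma bch_exp_ordi: "bch_exp - 1 \<in> ordi 1"
  by (auto simp: ordi_def bch_exp_nth)

lemma bch_log_ev:
  "k + l \<le> N \<Longrightarrow> fps_nth (fps_nth bch_log l) k = fps_nth (fps_nth (rs.ev N (fps_ln 1) (bch_exp - 1)) l) k"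
  unfolding bch_log_nth bch_free_eq using bch_exp_ordi by (subst ser_log_free_alg_ev[of _ _ _ N]) auto

lemma bch_log_0: "bch_free 0 0 = 0"
  by (simp add: bch_free_eq ser_log_def finsum_free_alg)

lemma bch_log_ordi: "(bch_log :: (bch_var list \<Rightarrow>\<^sub>0 'k::field_char_0) fps fps) \<in> ordi 1"
  by (auto simp: ordi_def bch_log_nth bch_log_0)

lemma exp_bch_log:
  "rs.ev N (fps_exp 1) bch_log - bch_exp \<in> (ordi (Suc N) :: (bch_var list \<Rightarrow>\<^sub>0 'k::field_char_0) fps fps set)"
proof -
  interpret n: nilpotent_mod rsc "ordi (Suc N) :: (bch_var list \<Rightarrow>\<^sub>0 'k) fps fps set" N by (rule nilpotent_mod_ordi)
  have nil: "(bch_exp - 1) ^ Suc N \<in> (ordi (Suc N) :: (bch_var list \<Rightarrow>\<^sub>0 'k) fps fps set)"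
    by (rule ordi_power[OF bch_exp_ordi])
  have ev1: "n.eqm (rs.ev N (1 + fps_X) Y) (1 + Y)" if "Y \<in> ordi 1" for Y :: "(bch_var list \<Rightarrow>\<^sub>0 'k) fps fps"
  \<comment> \<open>For N = 0 the truncation drops the linear term as well, but then that term lies
    in the ideal.\<close>
  proof (cases "N = 0")
    case True
    hence e: "rs.ev N (1 + fps_X) Y - (1 + Y) = - Y" by (simp add: rs.ev_def)
    have "- Y \<in> ordi (Suc N)" using that True by (auto simp: ordi_def)
    thus ?thesis unfolding n.eqm_def e .
  next
    case False
    have "rs.ev N (1 + fps_X) Y = (\<Sum>i\<in>{0,1}. rsc (fps_nth (1 + fps_X) i) (Y ^ i))"
      unfolding rs.ev_def by (rule sum.mono_neutral_right) (use False in auto)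
    thus ?thesis by simp
  qed
  have "n.eqm bch_log (rs.ev N (fps_ln 1) (bch_exp - 1))"
    unfolding n.eqm_def by (auto simp: ordi_def bch_log_ev[of _ _ N])
  hence "n.eqm (rs.ev N (fps_exp 1) bch_log) (rs.ev N (fps_exp 1) (rs.ev N (fps_ln 1) (bch_exp - 1)))"
    by (rule n.ev_cong)
  also have "n.eqm \<dots> (rs.ev N (fps_exp 1 oo fps_ln 1) (bch_exp - 1))"
    by (rule n.ev_compose[OF nil]) simp
  also have "n.eqm \<dots> (1 + (bch_exp - 1))"
    unfolding exp_compose_ln by (rule ev1[OF bch_exp_ordi])
  finally show ?thesis by (simp add: n.eqm_def)
qed

lemma ser_exp_bch_free:
  "ser_exp free_alg bch_free k l = (fps_nth (fps_nth bch_exp l) k :: bch_var list \<Rightarrow>\<^sub>0 'k::field_char_0)"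
proof -
  have "ser_exp free_alg bch_free k l =
      (fps_nth (fps_nth (rs.ev (k + l) (fps_exp 1) bch_log) l) k :: bch_var list \<Rightarrow>\<^sub>0 'k)"
    using ser_exp_free_alg_ev[of "bch_free :: nat \<Rightarrow> nat \<Rightarrow> bch_var list \<Rightarrow>\<^sub>0 'k" k l "k + l"] bch_log_ordi[where 'k = 'k]
    by (simp add: bch_log_def)
  thus ?thesis using ordiD[OF exp_bch_log[of "k + l", where 'k = 'k], of k l] by simp
qed

text \<open>\<open>J\<close>, the series whose part without s vanishes up to t^N, reduces the
  computation to s = 0, where log (exp (t x)) = t x. These coefficients start a recursion, as a
  derivative in s does not see them.\<close>

lemma bch_free_0:
  "bch_free k 0 = (if k = 1 then free_gen Bch_x else (0 :: bch_var list \<Rightarrow>\<^sub>0 'k::field_char_0))"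
proof -
  \<comment> \<open>At least 1, so that truncation keeps the linear term of
    \<open>fps_X\<close>.\<close>
  define N where "N = Suc k"
  define J where "J = {X :: (bch_var list \<Rightarrow>\<^sub>0 'k) fps fps. \<forall>i\<le>N. fps_nth (fps_nth X 0) i = 0}"
  define T where "T = to_fps (\<lambda>k l. if k = 1 \<and> l = 0 then free_gen Bch_x else (0 :: bch_var list \<Rightarrow>\<^sub>0 'k))"
  interpret n: nilpotent_mod rsc J N
  proof unfold_locales
    show "rs.subspace J" by (simp add: rs.subspace_def J_def rsc_nth)
    show "a * x \<in> J" "x * a \<in> J" if "x \<in> J" for a x
      using that by (auto simp: J_def fps_mult_nth intro!: sum.neutral)
  qed
  have Tpow: "fps_nth (fps_nth (T ^ m) l) i = (if i = m \<and> l = 0 then free_gen Bch_x ^ m else 0)" for m i l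
    unfolding T_def to_fps_power_single by simp
  have "n.eqm bch_log (rs.ev N (fps_ln 1) (bch_exp - 1))"
    unfolding n.eqm_def by (auto simp: J_def bch_log_ev[of _ 0 N])
  also have "n.eqm (bch_exp - 1) (rs.ev N exp1 T)"
  proof -
    have "fps_nth (fps_nth (bch_exp - 1) 0) i = fps_nth (fps_nth (rs.ev N exp1 T) 0) i" if "i \<le> N" for i
    proof -
      have "fps_nth (fps_nth (rs.ev N exp1 T) 0) i =
          (\<Sum>m\<le>N. if m = i then fsc (fps_nth exp1 i) (free_gen Bch_x ^ i) else 0)"
        unfolding ev_nth by (intro sum.cong refl) (auto simp: Tpow)
      also have "\<dots> = fsc (fps_nth exp1 i) (free_gen Bch_x ^ i)" using that by (simp add: sum.delta)
      also have "\<dots> = fps_nth (fps_nth (bch_exp - 1) 0) i"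
        by (simp add: exp1_def bch_exp_nth fps_one_nth fs.scale_left_diff_distrib)
      finally show ?thesis by simp
    qed
    thus ?thesis unfolding n.eqm_def by (simp add: J_def)
  qed
  hence "n.eqm (rs.ev N (fps_ln 1) (bch_exp - 1)) (rs.ev N (fps_ln 1) (rs.ev N exp1 T))"
    by (rule n.ev_cong)
  also have "n.eqm \<dots> (rs.ev N (fps_ln 1 oo exp1) T)"
    by (rule n.ev_compose) (auto simp: J_def Tpow exp1_0 simp del: power_Suc)
  also have "rs.ev N (fps_ln 1 oo exp1) T = (\<Sum>i\<in>{1}. rsc (fps_nth fps_X i) (T ^ i))"
    unfolding ln_compose_exp rs.ev_def by (rule sum.mono_neutral_right) (auto simp: N_def)
  finally have "fps_nth (fps_nth bch_log 0) k = fps_nth (fps_nth T 0) k"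
    unfolding n.eqm_def by (simp add: J_def N_def)
  thus ?thesis by (simp add: bch_log_nth T_def to_fps_def)
qed

text \<open>The factor is 1 plus terms of positive order, so the lowest part of \<open>X\<close>
  survives in the product.\<close>

lemma bch_exp_cancel:
  fixes X :: "(bch_var list \<Rightarrow>\<^sub>0 'k::field_char_0) fps fps"
  assumes "bch_exp * X \<in> ordi n"
  shows "X \<in> ordi n"
proof -
  have "m \<le> n \<Longrightarrow> X \<in> ordi m" for m
  proof (induction m)
    case (Suc m)
    hence X: "X \<in> ordi m" by simp
    have "fps_nth (fps_nth X l) k = 0" if "k + l < Suc m" for k l
    proof (cases "k + l < m")
      case False
      have "(bch_exp - 1) * X \<in> ordi (1 + m)" by (rule ordi_mult[OF bch_exp_ordi X])
      hence "fps_nth (fps_nth ((bch_exp - 1) * X) l) k = 0" using that by (intro ordiD) auto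
      moreover have "fps_nth (fps_nth (bch_exp * X) l) k = 0"
        using that Suc.prems by (intro ordiD[OF assms]) auto
      ultimately show ?thesis by (simp add: left_diff_distrib)
    qed (use ordiD[OF X] in blast)
    thus ?case by (simp add: ordi_def)
  qed (simp add: ordi_0)
  thus ?thesis by blast
qed

lemma ad_iter_ordi: "Z \<in> ordi 1 \<Longrightarrow> ad_iter Z X j \<in> ordi j"
proof (induction j)
  case (Suc j)
  have sub: "a - b \<in> ordi m" if "a \<in> ordi m" "b \<in> ordi m" for a b :: "'a fps fps" and m
    using that by (auto simp: ordi_def)
  show ?case using ordi_mult[of "ad_iter Z X j" j Z 1] ordi_mult[of Z 1 "ad_iter Z X j" j] Suc
    by (auto intro!: sub)
qed (simp add: ordi_0)

text \<open>Modulo high order, \<open>\<Sum>\<^sub>j (- ad Z)\<^sup>j(\<partial>Z/\<partial>s) / (j + 1)! = y\<close> for \<open>Z = log (exp (t x) exp (s y))\<close>.\<close>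

lemma bch_log_deriv:
  "(\<Sum>j\<le>N. rsc (1 / fact (Suc j)) (ad_iter bch_log (fps_deriv bch_log) j)) -
     fps_const (fps_const (free_gen Bch_y)) \<in> (ordi (Suc N) :: (bch_var list \<Rightarrow>\<^sub>0 'k::field_char_0) fps fps set)"
proof -
  let ?Z = "bch_log :: (bch_var list \<Rightarrow>\<^sub>0 'k) fps fps"
  let ?y = "fps_const (fps_const (free_gen Bch_y)) :: (bch_var list \<Rightarrow>\<^sub>0 'k) fps fps"
  let ?S = "\<Sum>j\<le>N. rsc (1 / fact (Suc j)) (ad_iter ?Z (fps_deriv ?Z) j)"
  interpret n: nilpotent_mod rsc "ordi (Suc N) :: (bch_var list \<Rightarrow>\<^sub>0 'k) fps fps set" N by (rule nilpotent_mod_ordi)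
  have Ds: "fps_deriv (rsc c X) = rsc c (fps_deriv X)" for c and X :: "(bch_var list \<Rightarrow>\<^sub>0 'k) fps fps"
    by (simp add: rsc_def)
  have "n.eqm (fps_deriv (rs.ev (Suc N) (fps_exp 1) ?Z)) (rs.ev N (fps_exp 1) ?Z * ?S)"
  proof (rule n.deriv_exp)
    fix i j assume "N < i + j"
    moreover have "?Z ^ i * ad_iter ?Z (fps_deriv ?Z) j \<in> ordi (i + j)"
      by (intro ordi_mult ordi_power ad_iter_ordi bch_log_ordi)
    ultimately show "?Z ^ i * ad_iter ?Z (fps_deriv ?Z) j \<in> ordi (Suc N)"
      using ordi_mono[of "Suc N" "i + j"] by auto
  qed (simp_all add: Ds)
  also have "n.eqm (rs.ev N (fps_exp 1) ?Z * ?S) (bch_exp * ?S)"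
    using exp_bch_log[of N, where 'k = 'k] by (intro n.eqm_mult n.eqm_refl) (simp add: n.eqm_def)
  finally have 1: "n.eqm (fps_deriv (rs.ev (Suc N) (fps_exp 1) ?Z)) (bch_exp * ?S)" .
  \<comment> \<open>Differentiation costs one order, so the exponential is taken one order
    further.\<close>
  have "fps_deriv (rs.ev (Suc N) (fps_exp 1) ?Z - bch_exp) \<in> ordi (Suc N)"
  proof -
    have "fps_deriv X \<in> ordi (Suc N)" if "X \<in> ordi (Suc (Suc N))" for X :: "(bch_var list \<Rightarrow>\<^sub>0 'k) fps fps"
    proof -
      have of_nat: "of_nat m = (fps_const (of_nat m) :: (bch_var list \<Rightarrow>\<^sub>0 'k) fps)" for m
        by (simp add: fps_of_nat)
      show ?thesis using that by (auto simp: ordi_def of_nat simp del: of_nat_Suc fps_const_add)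
    qed
    thus ?thesis using exp_bch_log[where 'k = 'k] by blast
  qed
  hence "n.eqm (fps_deriv (rs.ev (Suc N) (fps_exp 1) ?Z)) (fps_deriv bch_exp)"
    unfolding n.eqm_def fps_deriv_sub .
  hence "n.eqm (fps_deriv bch_exp) (fps_deriv (rs.ev (Suc N) (fps_exp 1) ?Z))"
    by (rule n.eqm_sym)
  also note 1
  \<comment> \<open>\<open>fps_deriv\<close> differentiates in the outer variable s, which
    multiplies exp (t x) exp (s y) by y on the right.\<close>
  also have "fps_deriv bch_exp = bch_exp * ?y"
  proof (rule fps2_ext)
    fix k l
    let ?e = "\<lambda>l. free_gen Bch_x ^ k * free_gen Bch_y ^ l :: bch_var list \<Rightarrow>\<^sub>0 'k"
    have "fps_nth (fps_nth (fps_deriv bch_exp) l) k = of_nat (Suc l) * fsc (1 / (fact k * fact (Suc l))) (?e (Suc l))"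
      using fps_of_nat[of "Suc l", where 'a = "bch_var list \<Rightarrow>\<^sub>0 'k", symmetric]
      by (simp add: bch_exp_nth del: fact_Suc of_nat_Suc power_Suc)
    also have "\<dots> = fsc (of_nat (Suc l)) (fsc (1 / (fact k * fact (Suc l))) (?e (Suc l)))"
      by (simp add: fsc_def del: of_nat_Suc fact_Suc)
    also have "\<dots> = fsc (1 / (fact k * fact l)) (?e (Suc l))"
    proof -
      have "(of_nat (Suc l) :: 'k) * (1 / (fact k * fact (Suc l))) = 1 / (fact k * fact l)"
        by (simp del: of_nat_Suc)
      thus ?thesis by (simp only: fs.scale_scale)
    qed
    also have "\<dots> = fps_nth (fps_nth (bch_exp * ?y) l) k"
      by (simp add: bch_exp_nth fsc_mult_left mult.assoc power_commutes)
    finally show "fps_nth (fps_nth (fps_deriv bch_exp) l) k = fps_nth (fps_nth (bch_exp * ?y) l) k" .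
  qed
  finally have "n.eqm (bch_exp * ?S) (bch_exp * ?y)" by (rule n.eqm_sym)
  hence "bch_exp * (?S - ?y) \<in> ordi (Suc N)" by (simp add: n.eqm_def right_diff_distrib)
  thus ?thesis by (rule bch_exp_cancel)
qed

inductive hlie :: "nat \<Rightarrow> (bch_var list \<Rightarrow>\<^sub>0 'k::field_char_0) \<Rightarrow> bool" where
  var_x: "hlie 1 (free_gen Bch_x)"
| var_y: "hlie 1 (free_gen Bch_y)"
| zero: "hlie (Suc d) 0"
| add: "hlie d u \<Longrightarrow> hlie d v \<Longrightarrow> hlie d (u + v)"
| scale: "hlie d u \<Longrightarrow> hlie d (fsc c u)"
| bracket: "hlie d u \<Longrightarrow> hlie e v \<Longrightarrow> hlie (d + e) (u * v - v * u)"

lemma hlie_sum: "d > 0 \<Longrightarrow> (\<And>i. i \<in> A \<Longrightarrow> hlie d (f i)) \<Longrightarrow> hlie d (sum f A)"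
  by (induction A rule: infinite_finite_induct) (auto simp: gr0_conv_Suc intro: hlie.intros)

lemma hlie_diff: "hlie d u \<Longrightarrow> hlie d v \<Longrightarrow> hlie d (u - v)"
  using hlie.add[of d u "fsc (- 1) v"] hlie.scale[of d v "- 1"] by simp

text \<open>Recursion on the total degree by \<open>bch_log_deriv\<close>: at t^k s^l' the term j =
  0 is (l' + 1) times \<open>bch_free k (Suc l')\<close>, and the other terms are built by
  commutators from coefficients of smaller degree.\<close>

lemma hlie_bch_free:
  assumes "0 < k + l"
  shows "hlie (k + l) (bch_free k l :: bch_var list \<Rightarrow>\<^sub>0 'k::field_char_0)"
  using assms
proof (induction "k + l" arbitrary: k l rule: less_induct)
  case less
  let ?Z = "bch_log :: (bch_var list \<Rightarrow>\<^sub>0 'k) fps fps"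
  define A where "A j = ad_iter ?Z (fps_deriv ?Z) j" for j
  show ?case
  proof (cases l)
    case 0
    thus ?thesis using less.prems by (auto simp: bch_free_0 gr0_conv_Suc intro: hlie.intros hlie.intros[unfolded One_nat_def])
  next
    case (Suc l')
    define N where "N = k + l'"
    have of_nat: "of_nat m * u = fsc (of_nat m) u" for m and u :: "bch_var list \<Rightarrow>\<^sub>0 'k"
      by (simp add: fsc_def)
    have A0: "fps_nth (fps_nth (A 0) b) a = fsc (of_nat (Suc b)) (bch_free a (Suc b))" for a b
      using fps_of_nat[of "Suc b", where 'a = "bch_var list \<Rightarrow>\<^sub>0 'k", symmetric]
      by (simp add: A_def bch_log_nth of_nat del: of_nat_Suc)
    have A0_lie: "hlie (Suc (a + b)) (fps_nth (fps_nth (A 0) b) a)" if "a + b < N" for a b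
      unfolding A0 using less.hyps[of a "Suc b"] that by (auto simp: N_def Suc intro!: hlie.scale)
    \<comment> \<open>As \<open>bch_log\<close> has no constant term, a commutator with it reads
      only coefficients of \<open>A j\<close> of strictly smaller degree.\<close>
    have step: "hlie (Suc (a + b)) (fps_nth (fps_nth (A (Suc j)) b) a)"
      if IH: "\<And>i q. i + q < N \<Longrightarrow> hlie (Suc (i + q)) (fps_nth (fps_nth (A j) q) i)" and "a + b \<le> N" for a b j
    proof -
      let ?a = "\<lambda>i q. fps_nth (fps_nth (A j) q) i" and ?z = "\<lambda>i q. bch_free i q :: bch_var list \<Rightarrow>\<^sub>0 'k"
      have "fps_nth (fps_nth (A (Suc j)) b) a =
          (\<Sum>q\<le>b. \<Sum>i\<le>a. ?a i q * ?z (a - i) (b - q)) - (\<Sum>q\<le>b. \<Sum>i\<le>a. ?z (a - i) (b - q) * ?a i q)"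
        using mult_nth2[of "A j" ?Z b a] mult_nth2_rev[of ?Z "A j" b a] by (simp add: A_def bch_log_nth)
      also have "\<dots> = (\<Sum>q\<le>b. \<Sum>i\<le>a. ?a i q * ?z (a - i) (b - q) - ?z (a - i) (b - q) * ?a i q)"
        by (simp only: sum_subtractf)
      also have "hlie (Suc (a + b)) \<dots>"
      proof (intro hlie_sum)
        fix q i assume "q \<in> {..b}" "i \<in> {..a}"
        hence qi: "q \<le> b" "i \<le> a" by auto
        show "hlie (Suc (a + b)) (?a i q * ?z (a - i) (b - q) - ?z (a - i) (b - q) * ?a i q)"
        proof (cases "a - i + (b - q) = 0")
          case True
          thus ?thesis by (simp add: bch_log_0 hlie.zero)
        next
          case False
          hence "hlie (a - i + (b - q)) (?z (a - i) (b - q))"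
            using \<open>a + b \<le> N\<close> by (intro less.hyps) (auto simp: N_def Suc)
          moreover have "hlie (Suc (i + q)) (?a i q)" using False qi \<open>a + b \<le> N\<close> by (intro IH) auto
          ultimately have "hlie (Suc (i + q) + (a - i + (b - q))) (?a i q * ?z (a - i) (b - q) - ?z (a - i) (b - q) * ?a i q)"
            by (rule hlie.bracket[rotated])
          moreover have "Suc (i + q) + (a - i + (b - q)) = Suc (a + b)" using qi by simp
          ultimately show ?thesis by simp
        qed
      qed auto
      finally show ?thesis .
    qed
    have A_lie: "hlie (Suc (a + b)) (fps_nth (fps_nth (A (Suc j)) b) a)" if "a + b \<le> N" for a b j
      using that
    proof (induction j arbitrary: a b)
      case 0
      show ?case by (rule step[OF A0_lie 0])
    next
      case (Suc j)
      show ?case by (rule step[OF Suc.IH Suc.prems]) simp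
    qed
    let ?y = "fps_const (fps_const (free_gen Bch_y)) :: (bch_var list \<Rightarrow>\<^sub>0 'k) fps fps"
    have "fps_nth (fps_nth (\<Sum>j\<le>N. rsc (1 / fact (Suc j)) (A j)) l') k = fps_nth (fps_nth ?y l') k"
      using ordiD[OF bch_log_deriv[of N, where 'k = 'k], of k l'] by (simp add: N_def A_def)
    hence "(\<Sum>j\<le>N. fsc (1 / fact (Suc j)) (fps_nth (fps_nth (A j) l') k)) = fps_nth (fps_nth ?y l') k"
      by (simp add: nth2_sum rsc_nth)
    hence "fps_nth (fps_nth (A 0) l') k = fps_nth (fps_nth ?y l') k -
        (\<Sum>j<N. fsc (1 / fact (Suc (Suc j))) (fps_nth (fps_nth (A (Suc j)) l') k))"
      by (simp add: sum.atMost_shift algebra_simps)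
    also have "hlie (Suc N) \<dots>"
    proof (intro hlie_diff hlie_sum hlie.scale)
      show "hlie (Suc N) (fps_nth (fps_nth ?y l') k)"
        using hlie.var_y by (auto simp: N_def intro: hlie.zero)
      show "hlie (Suc N) (fps_nth (fps_nth (A (Suc j)) l') k)" for j
        using A_lie[of k l' j] by (simp add: N_def)
    qed auto
    \<comment> \<open>Division by l' + 1 undoes the derivative.\<close>
    finally have "hlie (Suc N) (fsc (inverse (of_nat (Suc l'))) (fsc (of_nat (Suc l')) (bch_free k (Suc l') :: bch_var list \<Rightarrow>\<^sub>0 'k)))"
      unfolding A0 by (rule hlie.scale)
    moreover have "fsc (inverse (of_nat (Suc l'))) (fsc (of_nat (Suc l')) u) = u" for u :: "bch_var list \<Rightarrow>\<^sub>0 'k"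
      by (simp del: of_nat_Suc)
    ultimately show ?thesis by (simp add: Suc N_def)
  qed
qed

section \<open>The product of powers\<close>

definition index_tuples :: "nat \<Rightarrow> nat \<Rightarrow> nat \<Rightarrow> (nat \<times> nat) list set" where
  "index_tuples m k l = {\<tau>. length \<tau> = m \<and> sum_list (map fst \<tau>) = k \<and> sum_list (map snd \<tau>) = l}"

lemma finite_index_tuples: "finite (index_tuples m k l)"
proof (rule finite_subset)
  show "index_tuples m k l \<subseteq> {\<tau>. set \<tau> \<subseteq> {..k} \<times> {..l} \<and> length \<tau> = m}"
  proof
    fix \<tau> assume \<tau>: "\<tau> \<in> index_tuples m k l"
    have "fst p \<le> k \<and> snd p \<le> l" if "p \<in> set \<tau>" for p
      using that \<tau> member_le_sum_list[of "fst p" "map fst \<tau>"] member_le_sum_list[of "snd p" "map snd \<tau>"]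
      by (auto simp: index_tuples_def)
    thus "\<tau> \<in> {\<tau>. set \<tau> \<subseteq> {..k} \<times> {..l} \<and> length \<tau> = m}"
      using \<tau> by (force simp: index_tuples_def)
  qed
qed (rule finite_lists_length_eq, simp)

lemma gen_series_power:
  fixes v :: "nat \<Rightarrow> nat \<Rightarrow> 'x"
  shows "fps_nth (fps_nth (to_fps (\<lambda>a b. word [v a b] :: 'x list \<Rightarrow>\<^sub>0 'k::field) ^ m) l) k =
    (\<Sum>\<tau>\<in>index_tuples m k l. word (map (\<lambda>(a, b). v a b) \<tau>))"
proof (induction m arbitrary: k l)
  case 0
  have "index_tuples 0 k l = (if k = 0 \<and> l = 0 then {[]} else {})" by (auto simp: index_tuples_def)
  thus ?case by (auto simp: fps_one_nth)
next
  case (Suc m)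
  let ?w = "\<lambda>\<tau>. word (map (\<lambda>(a, b). v a b) \<tau>) :: 'x list \<Rightarrow>\<^sub>0 'k"
  have "fps_nth (fps_nth (to_fps (\<lambda>a b. word [v a b] :: 'x list \<Rightarrow>\<^sub>0 'k) ^ Suc m) l) k =
     (\<Sum>j\<le>l. \<Sum>i\<le>k. \<Sum>\<tau>\<in>index_tuples m (k - i) (l - j). ?w ((i, j) # \<tau>))"
    unfolding power_Suc mult_nth2 Suc.IH by (simp add: to_fps_def sum_distrib_left word_mult)
  also have "\<dots> = (\<Sum>(j, i, \<tau>)\<in>(SIGMA j:{..l}. SIGMA i:{..k}. index_tuples m (k - i) (l - j)). ?w ((i, j) # \<tau>))"
    by (simp add: sum.Sigma finite_index_tuples split_def)
  also have "\<dots> = (\<Sum>\<tau>\<in>index_tuples (Suc m) k l. ?w \<tau>)"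
    by (rule sum.reindex_bij_witness[of _ "\<lambda>\<tau>. (snd (hd \<tau>), fst (hd \<tau>), tl \<tau>)" "\<lambda>(j, i, \<tau>). (i, j) # \<tau>"])
       (auto simp: index_tuples_def length_Suc_conv)
  finally show ?case .
qed

text \<open>Permuting the factors of the power only permutes the index tuples, so the coefficient is
  already symmetric. Hence exponentials of series of letters correspond to each other under
  symmetrisation.\<close>

lemma symm_gen_series_power:
  fixes v :: "nat \<Rightarrow> nat \<Rightarrow> 'x"
  defines "X \<equiv> to_fps (\<lambda>a b. word [v a b] :: 'x list \<Rightarrow>\<^sub>0 'k::field_char_0)"
  shows "symm (fps_nth (fps_nth (X ^ m) l) k) = fps_nth (fps_nth (X ^ m) l) k"
proof -
  let ?T = "index_tuples m k l"
  let ?v = "map (\<lambda>(a, b). v a b)"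
  let ?S = "\<Sum>\<tau>\<in>?T. word (?v \<tau>) :: 'x list \<Rightarrow>\<^sub>0 'k"
  let ?P = "{\<sigma>. \<sigma> permutes {..<m}}"
  have len: "length \<tau> = m" if "\<tau> \<in> ?T" for \<tau> using that by (simp add: index_tuples_def)
  have perm: "(\<Sum>\<tau>\<in>?T. word (?v (permute_list \<sigma> \<tau>))) = ?S" if \<sigma>: "\<sigma> \<in> ?P" for \<sigma>
  proof -
    have inT: "permute_list \<rho> \<tau> \<in> ?T" if "\<rho> permutes {..<m}" "\<tau> \<in> ?T" for \<rho> \<tau>
    proof -
      have "mset (permute_list \<rho> \<tau>) = mset \<tau>" using that len by (intro mset_permute_list) auto
      hence "mset (map f (permute_list \<rho> \<tau>)) = mset (map f \<tau>)" for f :: "nat \<times> nat \<Rightarrow> nat"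
        by (metis mset_map)
      hence "sum_list (map f (permute_list \<rho> \<tau>)) = sum_list (map f \<tau>)" for f :: "nat \<times> nat \<Rightarrow> nat"
        by (metis sum_mset_sum_list)
      thus ?thesis using that by (simp add: index_tuples_def)
    qed
    have p: "\<sigma> permutes {..<m}" using \<sigma> by simp
    have pi: "inv_into UNIV \<sigma> permutes {..<m}" by (rule permutes_inv[OF p])
    have "permute_list (inv_into UNIV \<sigma>) (permute_list \<sigma> \<tau>) = \<tau>"
         "permute_list \<sigma> (permute_list (inv_into UNIV \<sigma>) \<tau>) = \<tau>" if "\<tau> \<in> ?T" for \<tau>
      using permute_list_compose[of "inv_into UNIV \<sigma>" \<tau> \<sigma>] permute_list_compose[of \<sigma> \<tau> "inv_into UNIV \<sigma>"]
        p pi len[OF that] by (simp_all add: permutes_inv_o)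
    thus ?thesis
      by (intro sum.reindex_bij_witness[of _ "permute_list (inv_into UNIV \<sigma>)" "permute_list \<sigma>"])
         (use inT p pi in auto)
  qed
  have "symm ?S = (\<Sum>\<tau>\<in>?T. fsc (inverse (fact m)) (\<Sum>\<sigma>\<in>?P. word (?v (permute_list \<sigma> \<tau>))))"
    unfolding symm.sum symm_of_word sym_word_def
    by (intro sum.cong refl) (auto simp: len permute_list_map intro!: arg_cong2[of _ _ _ _ fsc] sum.cong)
  also have "\<dots> = fsc (inverse (fact m)) (\<Sum>\<sigma>\<in>?P. \<Sum>\<tau>\<in>?T. word (?v (permute_list \<sigma> \<tau>)))"
    unfolding fs.scale_sum_right[symmetric] by (subst sum.swap) (rule refl)
  also have "\<dots> = ?S"
    \<comment> \<open>\<open>replicate m ()\<close> merely provides a list of length m for the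
      average over permutations of m places.\<close>
    using perm_average[of "replicate m ()" "\<lambda>\<sigma>. \<Sum>\<tau>\<in>?T. word (?v (permute_list \<sigma> \<tau>))" ?S] perm by simp
  finally show ?thesis by (simp add: X_def gen_series_power)
qed

section \<open>Evaluation of Lie polynomials in enveloping algebras\<close>

definition subst2 :: "'g \<Rightarrow> 'g \<Rightarrow> (bch_var list \<Rightarrow>\<^sub>0 'k::field) \<Rightarrow> 'g list \<Rightarrow>\<^sub>0 'k" where
  "subst2 \<xi> \<eta> = lext fsc (\<lambda>w. word (map (case_bch_var \<xi> \<eta>) w))"

interpretation subst2: Vector_Spaces.linear fsc fsc "subst2 \<xi> \<eta>"
  unfolding subst2_def by (intro lext_linear fs.vector_space_axioms)

lemma subst2_word: "subst2 \<xi> \<eta> (word w) = word (map (case_bch_var \<xi> \<eta>) w)"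
  unfolding subst2_def by (intro lext_word fs.vector_space_axioms)

lemma subst2_mult: "subst2 \<xi> \<eta> (f * g) = subst2 \<xi> \<eta> f * subst2 \<xi> \<eta> g"
proof (induction f rule: free_induct)
  case (step c w f)
  have "subst2 \<xi> \<eta> (word w * g) = subst2 \<xi> \<eta> (word w) * subst2 \<xi> \<eta> g"
    by (induction g rule: free_induct)
       (simp_all add: distrib_left fsc_mult_right word_mult subst2.add subst2.scale subst2_word subst2.zero)
  with step show ?case by (simp add: distrib_right fsc_mult_left subst2.add subst2.scale)
qed (simp add: subst2.zero)

lemma subst2_gen: "subst2 \<xi> \<eta> (free_gen Bch_x) = word [\<xi>]" "subst2 \<xi> \<eta> (free_gen Bch_y) = word [\<eta>]"
  by (simp_all add: free_gen_word subst2_word)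

lemma subst2_1: "subst2 \<xi> \<eta> 1 = 1"
  using subst2_word[of \<xi> \<eta> "[]"] by simp

lemma subst2_power: "subst2 \<xi> \<eta> (f ^ n) = subst2 \<xi> \<eta> f ^ n"
  by (induction n) (simp_all add: subst2_1 subst2_mult)

lemma word_replicate: "word [x] ^ n = word (replicate n x)"
  by (induction n) (simp_all add: word_mult)

context char0_lie
begin

text \<open>In the enveloping algebra for z a commutator of letters is z times a letter, and a Lie
  monomial of degree d has d - 1 brackets. One \<open>v\<close> serves all z.\<close>

lemma hlie_eval:
  assumes "hlie d u"
  shows "d > 0 \<and> (\<exists>v. lie_eval scale br \<xi> \<eta> u v \<and>
    (\<forall>z. cg (brz z) (subst2 \<xi> \<eta> u) (fsc (z ^ (d - 1)) (word [v]))))"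
  using assms
proof (induction rule: hlie.induct)
  case var_x
  show ?case by (auto intro!: exI[of _ \<xi>] lie_eval.var_x simp: subst2_gen)
next
  case var_y
  show ?case by (auto intro!: exI[of _ \<eta>] lie_eval.var_y simp: subst2_gen)
next
  case (zero d)
  show ?case using cg_sym[OF cg_fsc[OF cg_word_zero[of _ "[]" "[]"]]]
    by (auto intro!: exI[of _ 0] lie_eval.zero simp: subst2.zero)
next
  case (add d u u')
  then obtain v v' where v: "lie_eval scale br \<xi> \<eta> u v" "lie_eval scale br \<xi> \<eta> u' v'"
    "\<And>z. cg (brz z) (subst2 \<xi> \<eta> u) (fsc (z ^ (d - 1)) (word [v]))"
    "\<And>z. cg (brz z) (subst2 \<xi> \<eta> u') (fsc (z ^ (d - 1)) (word [v']))" by blast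
  have "cg (brz z) (subst2 \<xi> \<eta> (u + u')) (fsc (z ^ (d - 1)) (word [v + v']))" for z
    using cg_trans[OF cg_add[OF v(3,4)] cg_sym[OF cg_fsc[OF gen_add, of "brz z" "z ^ (d - 1)" v v', unfolded fs.scale_right_distrib]]]
    by (simp add: subst2.add)
  thus ?case using add v(1,2) lie_eval.add by blast
next
  case (scale d u c)
  then obtain v where v: "lie_eval scale br \<xi> \<eta> u v"
    "\<And>z. cg (brz z) (subst2 \<xi> \<eta> u) (fsc (z ^ (d - 1)) (word [v]))" by blast
  have "cg (brz z) (subst2 \<xi> \<eta> (fsc c u)) (fsc (z ^ (d - 1)) (word [scale c v]))" for z
    using cg_trans[OF cg_fsc[OF v(2), of z c] cg_sym[OF cg_fsc[OF gen_scale, of "brz z" "z ^ (d - 1)" c v, unfolded fs.scale_scale mult.commute[of _ c], folded fs.scale_scale]]]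
    by (simp add: subst2.scale)
  thus ?case using scale v(1) lie_eval.scale[of scale br \<xi> \<eta> u v c] unfolding fsc_def by blast
next
  case (bracket d u e u')
  then obtain v v' where v: "lie_eval scale br \<xi> \<eta> u v" "lie_eval scale br \<xi> \<eta> u' v'"
    "\<And>z. cg (brz z) (subst2 \<xi> \<eta> u) (fsc (z ^ (d - 1)) (word [v]))"
    "\<And>z. cg (brz z) (subst2 \<xi> \<eta> u') (fsc (z ^ (e - 1)) (word [v']))" and de: "d > 0" "e > 0" by blast
  have "cg (brz z) (subst2 \<xi> \<eta> (u * u' - u' * u)) (fsc (z ^ (d + e - 1)) (word [br v v']))" for z
  proof -
    let ?c = "z ^ (d - 1) * z ^ (e - 1)"
    have "cg (brz z) (subst2 \<xi> \<eta> (u * u' - u' * u))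
       (fsc (z ^ (d - 1)) (word [v]) * fsc (z ^ (e - 1)) (word [v']) - fsc (z ^ (e - 1)) (word [v']) * fsc (z ^ (d - 1)) (word [v]))"
      unfolding subst2.diff subst2_mult by (intro cg_diff cg_mult v)
    also have "\<dots> = fsc ?c (word [v] * word [v'] - word [v'] * word [v])"
      by (simp add: fsc_mult_left fsc_mult_right fs.scale_right_diff_distrib mult.commute)
    also have "cg (brz z) \<dots> (fsc ?c (word [v'] * word [v] + word [brz z v v'] - word [v'] * word [v]))"
      by (intro cg_fsc cg_diff gen_swap cg_refl)
    also have "\<dots> = fsc ?c (word [scale z (br v v')])" by (simp add: brz_def)
    also have "cg (brz z) \<dots> (fsc ?c (fsc z (word [br v v'])))"
      by (intro cg_fsc gen_scale)
    also have "\<dots> = fsc (z ^ (d - 1 + (e - 1) + 1)) (word [br v v'])"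
      by (simp only: fs.scale_scale power_add power_one_right)
    also have "d - 1 + (e - 1) + 1 = d + e - 1" using de by simp
    finally show ?thesis .
  qed
  thus ?case using de v(1,2) lie_eval.bracket[of scale br \<xi> \<eta> u v u' v'] by auto
qed

text \<open>Substitution is an algebra homomorphism and so respects commutators. With
  \<open>gen_injective\<close> it follows that \<open>lie_eval\<close> is single-valued.\<close>

lemma lie_eval_cg: "lie_eval scale br \<xi> \<eta> u v \<Longrightarrow> cg br (subst2 \<xi> \<eta> u) (word [v])"
proof (induction rule: lie_eval.induct)
  case zero
  show ?case using cg_sym[OF cg_word_zero[of br "[]" "[]"]] by (simp add: subst2.zero)
next
  case (add u v u' v')
  show ?case unfolding subst2.add by (rule cg_trans[OF cg_add[OF add.IH] cg_sym[OF gen_add]])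
next
  case (scale u v c)
  show ?case unfolding fsc_def[symmetric] subst2.scale
    by (rule cg_trans[OF cg_fsc[OF scale.IH] cg_sym[OF gen_scale]])
next
  case (bracket u v u' v')
  have "cg br (subst2 \<xi> \<eta> (u * u' - u' * u)) (word [v] * word [v'] - word [v'] * word [v])"
    unfolding subst2.diff subst2_mult by (intro cg_diff cg_mult bracket.IH)
  also have "cg br \<dots> (word [v'] * word [v] + word [br v v'] - word [v'] * word [v])"
    by (intro cg_diff gen_swap cg_refl)
  finally show ?case by simp
qed (simp_all add: subst2_gen)

lemma bch_cg:
  "cg (brz z) (subst2 \<xi> \<eta> (bch_free a b)) (fsc (z ^ (a + b - 1)) (word [bch scale br a b \<xi> \<eta>]))"
proof -
  have ex: "\<exists>v. lie_eval scale br \<xi> \<eta> (bch_free a b) v \<and>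
    (\<forall>z. cg (brz z) (subst2 \<xi> \<eta> (bch_free a b)) (fsc (z ^ (a + b - 1)) (word [v])))"
  \<comment> \<open>Here the exponent a + b - 1 is truncated, but the coefficient of the series is
    0.\<close>
  proof (cases "a + b = 0")
    case True
    thus ?thesis using cg_sym[OF cg_word_zero[of _ "[]" "[]"]]
      by (auto intro!: exI[of _ 0] lie_eval.zero simp: bch_log_0 subst2.zero)
  next
    case False
    thus ?thesis using hlie_eval[OF hlie_bch_free[of a b]] by auto
  qed
  then obtain v where v: "lie_eval scale br \<xi> \<eta> (bch_free a b) v"
    "\<And>z. cg (brz z) (subst2 \<xi> \<eta> (bch_free a b)) (fsc (z ^ (a + b - 1)) (word [v]))" by blast
  have "bch scale br a b \<xi> \<eta> = v"
    unfolding bch_def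
  proof (rule the_equality)
    fix v' assume "lie_eval scale br \<xi> \<eta> (bch_free a b) v'"
    hence "cg br (word [v']) (word [v])"
      using cg_trans[OF cg_sym[OF lie_eval_cg] lie_eval_cg[OF v(1)]] by blast
    thus "v' = v" by (rule gen_injective)
  qed fact
  thus ?thesis using v(2) by simp
qed

text \<open>The power of z sits inside the letter, so that each coefficient is a single letter, as
  \<open>symm_gen_series_power\<close> requires.\<close>

definition bch_word :: "'k \<Rightarrow> 'g \<Rightarrow> 'g \<Rightarrow> nat \<Rightarrow> nat \<Rightarrow> 'g list \<Rightarrow>\<^sub>0 'k" where
  "bch_word z \<xi> \<eta> a b = word [scale (z ^ (a + b - 1)) (bch scale br a b \<xi> \<eta>)]"

lemma symm_ser_exp_bch_word:
  "symm (ser_exp free_alg (bch_word z \<xi> \<eta>) k l) = ser_exp free_alg (bch_word z \<xi> \<eta>) k l"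
  unfolding ser_exp_free_alg symm.sum symm.scale bch_word_def[abs_def] symm_gen_series_power ..

text \<open>Substitution carries exp (log (exp (t x) exp (s y))) to the product of the exponentials,
  while \<open>bch_cg\<close> identifies the exponent.\<close>

lemma ser_exp_bch_word_cg:
  "cg (brz z) (ser_exp free_alg (bch_word z \<xi> \<eta>) k l)
     (fsc (1 / (fact k * fact l)) (word (replicate k \<xi>) * word (replicate l \<eta>)))"
proof -
  have pow: "cg (brz z) (fps_nth (fps_nth (to_fps (bch_word z \<xi> \<eta>) ^ m) l) k) (subst2 \<xi> \<eta> (fps_nth (fps_nth (to_fps bch_free ^ m) l) k))"
    for m k l
  proof (induction m arbitrary: k l)
    case 0
    show ?case by (auto simp: fps_one_nth subst2_1 subst2.zero)
  next
    case (Suc m)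
    have "cg (brz z) (bch_word z \<xi> \<eta> a b) (subst2 \<xi> \<eta> (bch_free a b))" for a b
      unfolding bch_word_def by (rule cg_trans[OF gen_scale cg_sym[OF bch_cg]])
    hence "cg (brz z) (fps_nth (fps_nth (to_fps (bch_word z \<xi> \<eta>)) j) i) (subst2 \<xi> \<eta> (fps_nth (fps_nth (to_fps bch_free) j) i))" for i j
      by (simp add: to_fps_def)
    thus ?case unfolding power_Suc mult_nth2 subst2.sum subst2_mult
      by (intro cg_sum cg_mult Suc.IH)
  qed
  have "cg (brz z) (ser_exp free_alg (bch_word z \<xi> \<eta>) k l) (subst2 \<xi> \<eta> (ser_exp free_alg bch_free k l))"
    unfolding ser_exp_free_alg subst2.sum subst2.scale by (intro cg_sum cg_fsc pow)
  thus ?thesis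
    by (simp add: ser_exp_bch_free bch_exp_nth subst2.scale subst2_mult subst2_power subst2_gen word_replicate)
qed

text \<open>The exponential is already symmetrised, so \<open>unsymm\<close> returns it unchanged
  modulo \<open>idl0\<close>.\<close>

theorem star_powers:
  "cg0 (star z (word (replicate k \<xi>)) (word (replicate l \<eta>)))
     (fsc (fact k * fact l) (ser_exp free_alg (bch_word z \<xi> \<eta>) k l))"
proof -
  let ?E = "ser_exp free_alg (bch_word z \<xi> \<eta>) k l"
  have "cg (brz z) (fsc (fact k * fact l) ?E)
      (fsc (fact k * fact l) (fsc (1 / (fact k * fact l)) (word (replicate k \<xi>) * word (replicate l \<eta>))))"
    by (intro cg_fsc ser_exp_bch_word_cg)
  hence "cg (brz z) (fsc (fact k * fact l) ?E) (word (replicate k \<xi>) * word (replicate l \<eta>))" by simp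
  hence "cg (brz z) (word (replicate k \<xi>) * word (replicate l \<eta>)) (fsc (fact k * fact l) (symm ?E))"
    unfolding symm_ser_exp_bch_word by (rule cg_sym)
  hence "cg0 (star z (word (replicate k \<xi>)) (word (replicate l \<eta>))) (unsymm z (symm (fsc (fact k * fact l) ?E)))"
    unfolding star_def symm_power symm.scale by (rule unsymm_cong)
  thus ?thesis using unsymm_symm by (rule cg_trans)
qed

end

section \<open>Algebras presented as quotients of the free algebra\<close>

text \<open>\<open>p\<close> is the quotient map from the free algebra and \<open>K\<close> its
  kernel, so that nested cosets are only handled through representatives.\<close>

locale presentation =
  fixes B :: "('k::field, 'b) module" and p :: "('x list \<Rightarrow>\<^sub>0 'k) \<Rightarrow> 'b" and K :: "('x list \<Rightarrow>\<^sub>0 'k) set"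
  assumes carrier: "carrier B = range p"
    and p_add: "p f \<oplus>\<^bsub>B\<^esub> p g = p (f + g)" and p_mult: "p f \<otimes>\<^bsub>B\<^esub> p g = p (f * g)"
    and p_one: "\<one>\<^bsub>B\<^esub> = p 1" and p_zero: "\<zero>\<^bsub>B\<^esub> = p 0" and p_smult: "c \<odot>\<^bsub>B\<^esub> p f = p (fsc c f)"
    and p_eq_iff: "p f = p g \<longleftrightarrow> f - g \<in> K"
begin

lemma p_carrier [simp, intro]: "p f \<in> carrier B"
  by (simp add: carrier)

lemma carrierE: "x \<in> carrier B \<Longrightarrow> (\<And>f. x = p f \<Longrightarrow> P) \<Longrightarrow> P"
  by (auto simp: carrier)

sublocale ring B
proof (rule ringI)
  show "abelian_group B"
  proof (rule abelian_groupI)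
    fix x assume "x \<in> carrier B"
    then obtain f where "x = p f" by (rule carrierE)
    thus "\<exists>y\<in>carrier B. y \<oplus>\<^bsub>B\<^esub> x = \<zero>\<^bsub>B\<^esub>"
      by (intro bexI[of _ "p (- f)"]) (auto simp: p_add p_zero)
  qed (auto simp: p_add p_zero add_ac elim!: carrierE)
  show "monoid B"
    by (rule monoidI) (auto simp: p_mult p_one mult.assoc elim!: carrierE)
qed (auto simp: p_mult p_add algebra_simps elim!: carrierE)

lemma p_uminus: "\<ominus>\<^bsub>B\<^esub> p f = p (- f)"
  by (rule minus_equality) (auto simp: p_add p_zero)

lemma p_minus: "p f \<ominus>\<^bsub>B\<^esub> p g = p (f - g)"
  by (simp add: minus_eq p_uminus p_add)

lemma p_sum: "finite A \<Longrightarrow> p (sum f A) = (\<Oplus>\<^bsub>B\<^esub>i\<in>A. p (f i))"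
  by (induction A rule: finite_induct) (auto simp: p_zero simp flip: p_add)

lemma p_finsum: "finite A \<Longrightarrow> (\<And>i. i \<in> A \<Longrightarrow> f i = p (g i)) \<Longrightarrow> (\<Oplus>\<^bsub>B\<^esub>i\<in>A. f i) = p (sum g A)"
  by (subst p_sum, assumption, rule finsum_cong') auto

lemma p_eq_0: "p f = p 0 \<longleftrightarrow> f \<in> K"
  by (simp add: p_eq_iff)

lemma p_prod: "alg_prod B (map (\<lambda>x. p (word [x])) w) = p (word w)"
  by (induction w) (simp_all add: alg_prod_def p_one p_mult word_mult)

lemma p_pow: "p f [^]\<^bsub>B\<^esub> (n::nat) = p (f ^ n)"
  by (induction n) (simp_all add: p_one p_mult power_commutes)

lemma alg_linearI:
  assumes "\<And>f. Q (p f) \<in> carrier B'" "\<And>f g. Q (p (f + g)) = Q (p f) \<oplus>\<^bsub>B'\<^esub> Q (p g)"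
    "\<And>c f. Q (p (fsc c f)) = c \<odot>\<^bsub>B'\<^esub> Q (p f)"
  shows "alg_linear B B' Q"
  unfolding alg_linear_def using assms by (auto simp: p_add p_smult elim!: carrierE)

lemma alg_linearD:
  assumes "alg_linear B B' Q"
  shows "Q (p f) \<in> carrier B'" "Q (p (f + g)) = Q (p f) \<oplus>\<^bsub>B'\<^esub> Q (p g)"
    "Q (p (fsc c f)) = c \<odot>\<^bsub>B'\<^esub> Q (p f)"
  using assms unfolding alg_linear_def by (auto simp flip: p_add p_smult)

lemma image_ideal:
  assumes V: "fs.subspace V" and "\<And>a f. f \<in> V \<Longrightarrow> a * f \<in> V" "\<And>a f. f \<in> V \<Longrightarrow> f * a \<in> V"
  shows "ideal (p ` V) B"
proof (rule idealI[OF ring_axioms])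
  show "subgroup (p ` V) (add_monoid B)"
  proof (rule add.subgroupI)
    fix a b assume "a \<in> p ` V" "b \<in> p ` V"
    then obtain f g where "f \<in> V" "g \<in> V" "a = p f" "b = p g" by blast
    thus "\<ominus>\<^bsub>B\<^esub> a \<in> p ` V" "a \<oplus>\<^bsub>B\<^esub> b \<in> p ` V"
      using fs.subspace_neg[OF V] fs.subspace_add[OF V] by (auto simp: p_uminus p_add)
  qed (use fs.subspace_0[OF V] in auto)
qed (use assms in \<open>auto simp: p_mult elim!: carrierE\<close>)

lemma ideal_preimage:
  assumes "ideal J B"
  shows "fs.subspace {f. p f \<in> J}" "p f \<in> J \<Longrightarrow> p (a * f) \<in> J" "p f \<in> J \<Longrightarrow> p (f * a) \<in> J"
proof -
  interpret J: ideal J B by fact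
  show l: "p (a * f) \<in> J" if "p f \<in> J" for a f
    using J.I_l_closed[OF that p_carrier[of a]] by (simp add: p_mult)
  show "p f \<in> J \<Longrightarrow> p (f * a) \<in> J"
    using J.I_r_closed[of "p f" "p a"] by (simp add: p_mult)
  show "fs.subspace {f. p f \<in> J}"
    unfolding fs.subspace_def
  proof (intro conjI allI ballI CollectI)
    show "p 0 \<in> J" using J.zero_closed by (simp add: p_zero)
    fix f g c assume f: "f \<in> {f. p f \<in> J}"
    show "p (fsc c f) \<in> J" using l[of f "fsc c 1"] f by (simp add: fsc_mult_left)
    assume "g \<in> {f. p f \<in> J}"
    thus "p (f + g) \<in> J" using f J.a_closed[of "p f" "p g"] by (simp add: p_add)
  qed
qed

lemma quotient_presentation:
  assumes "ideal J B"
  shows "presentation (quot_alg B J) (\<lambda>f. J +>\<^bsub>B\<^esub> p f) {f. p f \<in> J}"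
proof -
  interpret J: ideal J B by fact
  note pre = ideal_preimage[OF assms]
  have Jsub: "J \<subseteq> carrier B" by (rule J.a_subset)
  show ?thesis
  proof
    show "carrier (quot_alg B J) = range (\<lambda>f. J +>\<^bsub>B\<^esub> p f)"
      by (auto simp: quot_alg_def FactRing_def A_RCOSETS_def' carrier)
    fix f g c
    show "(J +>\<^bsub>B\<^esub> p f) \<oplus>\<^bsub>quot_alg B J\<^esub> (J +>\<^bsub>B\<^esub> p g) = J +>\<^bsub>B\<^esub> p (f + g)"
      by (simp add: quot_alg_def FactRing_def J.a_rcos_sum p_add)
    show "(J +>\<^bsub>B\<^esub> p f) \<otimes>\<^bsub>quot_alg B J\<^esub> (J +>\<^bsub>B\<^esub> p g) = J +>\<^bsub>B\<^esub> p (f * g)"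
      by (simp add: quot_alg_def FactRing_def J.rcoset_mult_add p_mult)
    show "\<one>\<^bsub>quot_alg B J\<^esub> = J +>\<^bsub>B\<^esub> p 1"
      by (simp add: quot_alg_def FactRing_def p_one)
    show "\<zero>\<^bsub>quot_alg B J\<^esub> = J +>\<^bsub>B\<^esub> p 0"
      using a_coset_add_zero[OF Jsub] by (simp add: quot_alg_def FactRing_def p_zero)
    show eq: "(J +>\<^bsub>B\<^esub> p f) = (J +>\<^bsub>B\<^esub> p g) \<longleftrightarrow> f - g \<in> {f. p f \<in> J}" for f g
      using quotient_eq_iff_same_a_r_cos[OF assms p_carrier p_carrier, of f g] by (simp add: p_minus)
    show "c \<odot>\<^bsub>quot_alg B J\<^esub> (J +>\<^bsub>B\<^esub> p f) = J +>\<^bsub>B\<^esub> p (fsc c f)"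
    proof -
      \<comment> \<open>Scalar multiplication on cosets is a union over all representatives; each of
        them yields the same coset.\<close>
      have "J +>\<^bsub>B\<^esub> (c \<odot>\<^bsub>B\<^esub> x) = J +>\<^bsub>B\<^esub> p (fsc c f)" if x: "x \<in> J +>\<^bsub>B\<^esub> p f" for x
      proof -
        have "x \<in> carrier B" using x Jsub a_r_coset_subset_G[of J "p f"] by auto
        then obtain g where g: "x = p g" by (rule carrierE)
        have "J +>\<^bsub>B\<^esub> p f = J +>\<^bsub>B\<^esub> x" using J.a_repr_independence'[OF x] by simp
        hence "p (f - g) \<in> J" unfolding g eq by simp
        hence "p (fsc c (f - g)) \<in> J" using fs.subspace_scale[OF pre(1), of "f - g" c] by simp
        hence "J +>\<^bsub>B\<^esub> p (fsc c f) = J +>\<^bsub>B\<^esub> p (fsc c g)"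
          unfolding eq by (simp add: fs.scale_right_diff_distrib)
        thus ?thesis by (simp add: g p_smult)
      qed
      moreover have "p f \<in> J +>\<^bsub>B\<^esub> p f" by (rule J.a_rcos_self) simp
      ultimately show ?thesis by (auto simp: quot_alg_def)
    qed
  qed
qed

text \<open>The image of \<open>V\<close> is an ideal containing the generators, and
  \<open>K\<close> lies in \<open>V\<close>. This bounds kernels from above.\<close>

lemma ideal_generated_preimage:
  assumes V: "fs.subspace V" "\<And>a f. f \<in> V \<Longrightarrow> a * f \<in> V" "\<And>a f. f \<in> V \<Longrightarrow> f * a \<in> V"
    and "K \<subseteq> V" "X \<subseteq> p ` V" and p: "p f \<in> Idl\<^bsub>B\<^esub> X"
  shows "f \<in> V"
proof -
  have "Idl\<^bsub>B\<^esub> X \<subseteq> p ` V" by (rule genideal_minimal[OF image_ideal[OF V]]) (use assms in auto)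
  with p obtain g where "p f = p g" "g \<in> V" by blast
  hence "f - g \<in> V" using \<open>K \<subseteq> V\<close> by (auto simp: p_eq_iff)
  thus ?thesis using fs.subspace_add[OF V(1), of "f - g" g] \<open>g \<in> V\<close> by simp
qed

end

lemma free_presentation: "presentation free_alg (\<lambda>f. f) {0}"
  by unfold_locales simp_all

section \<open>Tensor, enveloping and symmetric algebra as quotients of the free algebra\<close>

context char0_space
begin

definition tensor_proj :: "('g list \<Rightarrow>\<^sub>0 'k) \<Rightarrow> ('g list \<Rightarrow>\<^sub>0 'k) set" where
  "tensor_proj f = tensor_ideal scale +>\<^bsub>free_alg\<^esub> f"

lemma ideal_tensor_ideal: "ideal (tensor_ideal scale) free_alg"
proof -
  interpret F: presentation free_alg "\<lambda>f. f" "{0} :: ('g list \<Rightarrow>\<^sub>0 'k) set" by (rule free_presentation)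
  show ?thesis unfolding tensor_ideal_def by (rule F.genideal_ideal) simp
qed

lemma tensor_presentation: "presentation (tensor_alg scale) tensor_proj (tensor_ideal scale)"
proof -
  interpret F: presentation free_alg "\<lambda>f. f" "{0} :: ('g list \<Rightarrow>\<^sub>0 'k) set" by (rule free_presentation)
  show ?thesis
    using F.quotient_presentation[OF ideal_tensor_ideal]
    by (simp add: tensor_alg_def tensor_proj_def[abs_def])
qed

lemma gen_relations:
  "word [x + y] - word [x] - word [y] \<in> idl br" "word [scale c x] - fsc c (word [x]) \<in> idl br"
  "word [x] * word [y] - word [y] * word [x] - word [br x y] \<in> idl br"
  using gen_add[of br x y] gen_scale[of br c x] gen_swap[of br x y] by (simp_all add: cg_def diff_diff_eq)

lemma tensor_ideal_subset: "tensor_ideal scale \<subseteq> idl br"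
proof
  interpret F: presentation free_alg "\<lambda>f. f" "{0} :: ('g list \<Rightarrow>\<^sub>0 'k) set" by (rule free_presentation)
  fix f assume "f \<in> tensor_ideal scale"
  thus "f \<in> idl br" unfolding tensor_ideal_def
    by (rule F.ideal_generated_preimage[OF subspace_idl idl_mult_left idl_mult_right, rotated -1])
       (auto simp: fs.subspace_0[OF subspace_idl] free_gen_word gen_relations simp flip: fsc_def)
qed

lemma tensor_ideal_gens:
  "word [x + y] - word [x] - word [y] \<in> tensor_ideal scale"
  "word [scale c x] - fsc c (word [x]) \<in> tensor_ideal scale"
proof -
  interpret F: presentation free_alg "\<lambda>f. f" "{0} :: ('g list \<Rightarrow>\<^sub>0 'k) set" by (rule free_presentation)
  show "word [x + y] - word [x] - word [y] \<in> tensor_ideal scale"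
    unfolding tensor_ideal_def by (rule subsetD[OF F.genideal_self]) (auto simp: free_gen_word)
  show "word [scale c x] - fsc c (word [x]) \<in> tensor_ideal scale"
    unfolding tensor_ideal_def by (rule subsetD[OF F.genideal_self]) (auto simp: free_gen_word fsc_def)
qed

definition univ_proj :: "('g \<Rightarrow> 'g \<Rightarrow> 'g) \<Rightarrow> 'k \<Rightarrow> ('g list \<Rightarrow>\<^sub>0 'k) \<Rightarrow> ('k, 'g) tquot" where
  "univ_proj br z f = univ_ideal scale br z +>\<^bsub>tensor_alg scale\<^esub> tensor_proj f"

lemma univ_presentation:
  "presentation (univ_alg scale br z) (univ_proj br z) (idl (\<lambda>x y. scale z (br x y)))"
proof -
  interpret T: presentation "tensor_alg scale" tensor_proj "tensor_ideal scale" by (rule tensor_presentation)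
  let ?b = "\<lambda>x y. scale z (br x y)"
  let ?r = "\<lambda>x y. word [x] * word [y] - word [y] * word [x] - word [?b x y] :: 'g list \<Rightarrow>\<^sub>0 'k"
  have gen: "tensor_gen scale x \<otimes>\<^bsub>tensor_alg scale\<^esub> tensor_gen scale y \<ominus>\<^bsub>tensor_alg scale\<^esub>
      tensor_gen scale y \<otimes>\<^bsub>tensor_alg scale\<^esub> tensor_gen scale x
      \<ominus>\<^bsub>tensor_alg scale\<^esub> z \<odot>\<^bsub>tensor_alg scale\<^esub> tensor_gen scale (br x y) = tensor_proj (?r x y)" for x y
  proof -
    have "tensor_gen scale a = tensor_proj (word [a])" for a
      by (simp add: tensor_gen_def tensor_proj_def free_gen_word)
    \<comment> \<open>The given relations carry z in front of the letter, \<open>rels\<close> inside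
      it; the tensor relations identify the two.\<close>
    moreover have "tensor_proj (fsc z (word [br x y])) = tensor_proj (word [?b x y])"
      using fs.subspace_neg[OF T.ideal_preimage(1)] T.p_eq_iff tensor_ideal_gens(2)[of z "br x y"] by metis
    ultimately show ?thesis by (simp add: T.p_mult T.p_smult flip: T.p_minus)
  qed
  define X where "X = {tensor_proj (?r x y) | x y. True}"
  have J: "univ_ideal scale br z = Idl\<^bsub>tensor_alg scale\<^esub> X"
    unfolding univ_ideal_def Let_def gen X_def ..
  have XT: "X \<subseteq> carrier (tensor_alg scale)" by (auto simp: X_def)
  have ideal: "ideal (univ_ideal scale br z) (tensor_alg scale)"
    unfolding J by (rule T.genideal_ideal[OF XT])
  note pre = T.ideal_preimage[OF ideal]
  have zero: "tensor_proj f \<in> univ_ideal scale br z" if "f \<in> tensor_ideal scale" for f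
  proof -
    have "tensor_proj f = tensor_proj 0" using that by (simp add: T.p_eq_0)
    thus ?thesis using fs.subspace_0[OF pre(1)] by simp
  qed
  have rels: "tensor_proj r \<in> univ_ideal scale br z" if "r \<in> rels ?b" for r
    using that unfolding rels_def
  proof (elim UnE)
    assume "r \<in> {word [x] * word [y] - word [y] * word [x] - word [?b x y] | x y. True}"
    thus ?thesis unfolding J using T.genideal_self[OF XT] by (auto simp: X_def)
  qed (use tensor_ideal_gens zero in auto)
  have "{f. tensor_proj f \<in> univ_ideal scale br z} = idl ?b"
  proof (intro equalityI subsetI)
    fix f assume "f \<in> {f. tensor_proj f \<in> univ_ideal scale br z}"
    hence "tensor_proj f \<in> Idl\<^bsub>tensor_alg scale\<^esub> X" by (simp add: J)
    thus "f \<in> idl ?b"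
      by (rule T.ideal_generated_preimage[OF subspace_idl idl_mult_left idl_mult_right tensor_ideal_subset, rotated -1])
         (auto simp: X_def intro!: imageI gen_relations(3))
  next
    fix f assume "f \<in> idl ?b"
    moreover have "idl ?b \<subseteq> {f. tensor_proj f \<in> univ_ideal scale br z}"
      unfolding idl_def by (rule fs.span_minimal[OF _ pre(1)]) (use rels pre(2,3) in auto)
    ultimately show "f \<in> {f. tensor_proj f \<in> univ_ideal scale br z}" by blast
  qed
  with T.quotient_presentation[OF ideal] show ?thesis
    by (simp add: univ_alg_def univ_proj_def[abs_def])
qed

lemma univ_gen_eq: "univ_gen scale br z x = univ_proj br z (word [x])"
  by (simp add: univ_gen_def univ_proj_def tensor_gen_def tensor_proj_def free_gen_word)

text \<open>At z = 0 the bracket term disappears, so S(g) inherits the presentation of the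
  enveloping algebras.\<close>

lemma sym_ideal_eq: "sym_ideal scale = univ_ideal scale br 0"
proof -
  interpret T: presentation "tensor_alg scale" tensor_proj "tensor_ideal scale" by (rule tensor_presentation)
  have gen: "tensor_gen scale a = tensor_proj (word [a])" for a
    by (simp add: tensor_gen_def tensor_proj_def free_gen_word)
  show ?thesis
    unfolding sym_ideal_def univ_ideal_def Let_def gen T.p_mult T.p_smult T.p_minus by simp
qed

definition sym_proj0 :: "('g list \<Rightarrow>\<^sub>0 'k) \<Rightarrow> ('k, 'g) tquot" where
  "sym_proj0 = univ_proj (\<lambda>_ _. 0) 0"

lemma sym_presentation: "presentation (sym_alg scale) sym_proj0 idl0"
  using univ_presentation[of "\<lambda>_ _. 0" 0]
  by (simp add: sym_alg_def univ_alg_def sym_ideal_eq[of "\<lambda>_ _. 0"] sym_proj0_def)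

lemma sym_gen_eq: "sym_gen scale x = sym_proj0 (word [x])"
  by (simp add: sym_gen_def sym_proj0_def univ_proj_def tensor_gen_def tensor_proj_def free_gen_word
      sym_ideal_eq[of "\<lambda>_ _. 0"])

end

section \<open>The three products on the symmetric algebra\<close>

context char0_space
begin

sublocale S: presentation "sym_alg scale" sym_proj0 idl0
  by (rule sym_presentation)

lemma sym_proj0_cong: "cg0 f g \<Longrightarrow> sym_proj0 f = sym_proj0 g"
  by (simp add: S.p_eq_iff cg_def)

lemma sym_proj0_eqD: "sym_proj0 f = sym_proj0 g \<Longrightarrow> cg0 f g"
  by (simp add: S.p_eq_iff cg_def)

definition sym_rep :: "('k, 'g) tquot \<Rightarrow> 'g list \<Rightarrow>\<^sub>0 'k" where
  "sym_rep x = (SOME f. sym_proj0 f = x)"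

lemma sym_rep: "cg0 (sym_rep (sym_proj0 f)) f"
  unfolding sym_rep_def by (rule sym_proj0_eqD, rule someI) (rule refl)

text \<open>Serves as the witness for the products and the bracket that are selected by
  SOME.\<close>

definition lift2 :: "(('g list \<Rightarrow>\<^sub>0 'k) \<Rightarrow> ('g list \<Rightarrow>\<^sub>0 'k) \<Rightarrow> 'g list \<Rightarrow>\<^sub>0 'k) \<Rightarrow>
    ('k, 'g) tquot \<Rightarrow> ('k, 'g) tquot \<Rightarrow> ('k, 'g) tquot" where
  "lift2 B x y = sym_proj0 (B (sym_rep x) (sym_rep y))"

lemma lift2:
  assumes "\<And>f f' g g'. cg0 f f' \<Longrightarrow> cg0 g g' \<Longrightarrow> cg0 (B f g) (B f' g')"
  shows "lift2 B (sym_proj0 f) (sym_proj0 g) = sym_proj0 (B f g)"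
  unfolding lift2_def by (rule sym_proj0_cong, rule assms) (rule sym_rep)+

lemma alg_bilinear_of_rep:
  assumes B: "\<And>f g. B' (sym_proj0 f) (sym_proj0 g) = sym_proj0 (B f g)"
    and "\<And>f. flinear (B f)" "\<And>g. flinear (\<lambda>f. B f g)"
  shows "alg_bilinear (sym_alg scale) B'"
proof -
  have L: "B f (g + h) = B f g + B f h" "B f (fsc c g) = fsc c (B f g)"
    "B (g + h) f = B g f + B h f" "B (fsc c g) f = fsc c (B g f)" for f g h c
  proof -
    interpret l: Vector_Spaces.linear fsc fsc "B f" by fact
    interpret r: Vector_Spaces.linear fsc fsc "\<lambda>g. B g f" by fact
    show "B f (g + h) = B f g + B f h" "B f (fsc c g) = fsc c (B f g)"
      "B (g + h) f = B g f + B h f" "B (fsc c g) f = fsc c (B g f)"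
      by (simp_all add: l.add l.scale r.add r.scale)
  qed
  show ?thesis unfolding alg_bilinear_def
    by (auto simp: B L S.p_add S.p_smult elim!: S.carrierE intro!: S.alg_linearI)
qed

text \<open>Polarisation in each argument. It identifies whichever map SOME has selected.\<close>

lemma alg_bilinear_eq_on_powers:
  assumes bil: "alg_bilinear (sym_alg scale) B'"
    and lin: "\<And>f. flinear (B f)" "\<And>g. flinear (\<lambda>f. B f g)"
    and idl: "\<And>f g. f \<in> idl0 \<or> g \<in> idl0 \<Longrightarrow> B f g \<in> idl0"
    and powers: "\<And>m n x y. B' (sym_proj0 (word (replicate m x))) (sym_proj0 (word (replicate n y))) =
      sym_proj0 (B (word (replicate m x)) (word (replicate n y)))"
  shows "B' (sym_proj0 f) (sym_proj0 g) = sym_proj0 (B f g)"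
proof -
  have l: "alg_linear (sym_alg scale) (sym_alg scale) (B' (sym_proj0 f))" for f
    using bil by (simp add: alg_bilinear_def)
  have r: "alg_linear (sym_alg scale) (sym_alg scale) (\<lambda>x. B' x (sym_proj0 f))" for f
    using bil by (simp add: alg_bilinear_def)
  \<comment> \<open>\<open>alg_linear\<close> does not list the value at 0; it follows from scaling
    by 0.\<close>
  have zero: "Q (sym_proj0 f) = sym_proj0 0" if Q: "alg_linear (sym_alg scale) (sym_alg scale) Q" and f: "f \<in> idl0" for Q f
  proof -
    obtain h where h: "Q (sym_proj0 0) = sym_proj0 h"
      using S.alg_linearD(1)[OF Q] by (rule S.carrierE)
    have "Q (sym_proj0 (fsc 0 0)) = sym_proj0 (fsc 0 h)"
      using S.alg_linearD(3)[OF Q, of 0 0] h by (simp add: S.p_smult)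
    moreover have "sym_proj0 f = sym_proj0 0" using f by (simp add: S.p_eq_0)
    ultimately show ?thesis by simp
  qed
  have ext: "Q (sym_proj0 f) = sym_proj0 (L f)"
    if Q: "alg_linear (sym_alg scale) (sym_alg scale) Q" and "flinear L"
      and L0: "\<And>f. f \<in> idl0 \<Longrightarrow> L f \<in> idl0"
      and "\<And>n x. Q (sym_proj0 (word (replicate n x))) = sym_proj0 (L (word (replicate n x)))" for Q L f
  proof -
    interpret L: Vector_Spaces.linear fsc fsc L by fact
    have "f \<in> {f. Q (sym_proj0 f) = sym_proj0 (L f)}"
    proof (rule powers_span)
      show "idl0 \<subseteq> {f. Q (sym_proj0 f) = sym_proj0 (L f)}"
      proof (intro subsetI CollectI)
        fix f assume f: "f \<in> idl0"
        hence "sym_proj0 (L f) = sym_proj0 0" using L0 by (simp add: S.p_eq_0)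
        thus "Q (sym_proj0 f) = sym_proj0 (L f)" using zero[OF Q f] by simp
      qed
      show "fs.subspace {f. Q (sym_proj0 f) = sym_proj0 (L f)}"
        using zero[OF Q fs.subspace_0[OF subspace_idl]]
        by (auto simp: fs.subspace_def L.zero L.add L.scale S.alg_linearD(2,3)[OF Q] S.p_add S.p_smult)
    qed (use that in auto)
    thus ?thesis by simp
  qed
  have half: "B' (sym_proj0 (word (replicate m x))) (sym_proj0 g) = sym_proj0 (B (word (replicate m x)) g)" for m x g
    by (rule ext[OF l lin(1)]) (use idl powers in auto)
  show ?thesis
    by (rule ext[OF r[of g] lin(2)[of g]]) (use idl half in auto)
qed

section \<open>The grading of the symmetric algebra\<close>

lemma sym_power_eq: "sym_power scale n = sym_proj0 ` homog n"
proof -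
  have X: "{alg_prod (sym_alg scale) (map (sym_gen scale) \<xi>s) | \<xi>s. length \<xi>s = n} = {sym_proj0 (word w) | w. length w = n}"
    unfolding sym_gen_eq[abs_def] S.p_prod ..
  show ?thesis unfolding sym_power_def X
  proof (intro equalityI subsetI)
    fix x assume "x \<in> alg_span (sym_alg scale) {sym_proj0 (word w) | w. length w = n}"
    thus "x \<in> sym_proj0 ` homog n"
    proof (induction rule: alg_span.induct)
      case zero
      show ?case using homog_0 by (auto simp: S.p_zero)
    next
      case (add_smult x v c)
      then obtain w f where wf: "x = sym_proj0 (word w)" "length w = n" "v = sym_proj0 f" "f \<in> homog n" by blast
      have "fsc c (word w) + f \<in> homog n"
        using wf by (auto intro!: fs.subspace_add fs.subspace_scale subspace_homog word_in_homog)
      thus ?case by (auto simp: wf S.p_add S.p_smult)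
    qed
  next
    fix x assume "x \<in> sym_proj0 ` homog n"
    then obtain f where "f \<in> homog n" "x = sym_proj0 f" by blast
    moreover from this(1) have "sym_proj0 f \<in> alg_span (sym_alg scale) {sym_proj0 (word w) | w. length w = n}"
    proof (induction rule: homog_induct)
      case zero
      show ?case using alg_span.zero[of "sym_alg scale"] by (simp add: S.p_zero)
    next
      case (step c w f)
      have "c \<odot>\<^bsub>sym_alg scale\<^esub> sym_proj0 (word w) \<oplus>\<^bsub>sym_alg scale\<^esub> sym_proj0 f
          \<in> alg_span (sym_alg scale) {sym_proj0 (word w) | w. length w = n}"
        by (rule alg_span.add_smult) (use step in auto)
      thus ?case by (simp add: S.p_add S.p_smult)
    qed
    ultimately show "x \<in> alg_span (sym_alg scale) {sym_proj0 (word w) | w. length w = n}" by simp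
  qed
qed

text \<open>Existence comes from word length in the free algebra, uniqueness from
  \<open>hcomp_idl0\<close>.\<close>

lemma sym_proj_eq: "sym_proj scale n (sym_proj0 h) = sym_proj0 (hcomp n h)"
proof -
  let ?S = "sym_alg scale"
  have fin: "finite {m. hcomp m h \<noteq> 0}" and hsum: "h = (\<Sum>m | hcomp m h \<noteq> 0. hcomp m h)"
  proof -
    have fin: "\<exists>N. \<forall>m>N. hcomp m f = 0" for f :: "'g list \<Rightarrow>\<^sub>0 'k"
    proof (induction f rule: free_induct)
      case (step c w f)
      then obtain N where "\<forall>m>N. hcomp m f = 0" by blast
      hence "\<forall>m>max N (length w). hcomp m (fsc c (word w) + f) = 0"
        by (auto simp: hcomp.add hcomp.scale hcomp_word)
      thus ?case by blast
    qed (simp add: hcomp.zero)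
    then obtain N where N: "\<And>m. m > N \<Longrightarrow> hcomp m h = 0" by blast
    obtain M where M: "\<And>k. k \<ge> M \<Longrightarrow> h = (\<Sum>m\<le>k. hcomp m h)" using hcomp_sum[of h] by blast
    show fin: "finite {m. hcomp m h \<noteq> 0}"
      by (rule finite_subset[of _ "{..N}"]) (use N not_le in auto)
    have "h = (\<Sum>m\<le>max M N. hcomp m h)" by (rule M) simp
    also have "\<dots> = (\<Sum>m | hcomp m h \<noteq> 0. hcomp m h)"
      by (rule sum.mono_neutral_right) (use N in \<open>auto simp: not_le[symmetric] intro: leI\<close>)
    finally show "h = (\<Sum>m | hcomp m h \<noteq> 0. hcomp m h)" .
  qed
  let ?P = "\<lambda>x. \<exists>\<phi>. (\<forall>m. \<phi> m \<in> sym_power scale m) \<and> finite {m. \<phi> m \<noteq> \<zero>\<^bsub>?S\<^esub>} \<and>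
       sym_proj0 h = (\<Oplus>\<^bsub>?S\<^esub> m \<in> {m. \<phi> m \<noteq> \<zero>\<^bsub>?S\<^esub>}. \<phi> m) \<and> x = \<phi> n"
  have ex: "?P (sym_proj0 (hcomp n h))"
  proof (intro exI conjI allI)
    let ?\<phi> = "\<lambda>m. sym_proj0 (hcomp m h)"
    show "?\<phi> m \<in> sym_power scale m" for m
      unfolding sym_power_eq by (rule imageI) (rule hcomp_in_homog)
    \<comment> \<open>A nonzero component may become 0 in the quotient, so the index set in the
      definition can be smaller.\<close>
    have sub: "{m. ?\<phi> m \<noteq> \<zero>\<^bsub>?S\<^esub>} \<subseteq> {m. hcomp m h \<noteq> 0}" by (auto simp: S.p_zero)
    show fin': "finite {m. ?\<phi> m \<noteq> \<zero>\<^bsub>?S\<^esub>}" by (rule finite_subset[OF sub fin])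
    have "cg0 (\<Sum>m | hcomp m h \<noteq> 0. hcomp m h) (\<Sum>m | ?\<phi> m \<noteq> \<zero>\<^bsub>?S\<^esub>. hcomp m h)"
    proof -
      have "(\<Sum>m | hcomp m h \<noteq> 0. hcomp m h) - (\<Sum>m | ?\<phi> m \<noteq> \<zero>\<^bsub>?S\<^esub>. hcomp m h) =
         (\<Sum>m\<in>{m. hcomp m h \<noteq> 0} - {m. ?\<phi> m \<noteq> \<zero>\<^bsub>?S\<^esub>}. hcomp m h)"
        by (rule sum_diff[OF fin sub, symmetric])
      also have "\<dots> \<in> idl0"
        by (rule fs.subspace_sum[OF subspace_idl]) (auto simp: S.p_zero S.p_eq_0)
      finally show ?thesis by (simp add: cg_def)
    qed
    hence "sym_proj0 h = sym_proj0 (\<Sum>m | ?\<phi> m \<noteq> \<zero>\<^bsub>?S\<^esub>. hcomp m h)"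
      unfolding hsum[symmetric] by (rule sym_proj0_cong)
    thus "sym_proj0 h = (\<Oplus>\<^bsub>?S\<^esub> m \<in> {m. ?\<phi> m \<noteq> \<zero>\<^bsub>?S\<^esub>}. ?\<phi> m)"
      by (simp add: S.p_sum[OF fin'])
  qed (rule refl)
  moreover have uniq: "x = sym_proj0 (hcomp n h)" if "?P x" for x
  proof -
    from that obtain \<phi> where \<phi>: "\<And>m. \<phi> m \<in> sym_power scale m" "finite {m. \<phi> m \<noteq> \<zero>\<^bsub>?S\<^esub>}"
       "sym_proj0 h = (\<Oplus>\<^bsub>?S\<^esub> m \<in> {m. \<phi> m \<noteq> \<zero>\<^bsub>?S\<^esub>}. \<phi> m)" "x = \<phi> n" by blast
    have "\<exists>f. f \<in> homog m \<and> \<phi> m = sym_proj0 f" for m using \<phi>(1)[of m] unfolding sym_power_eq by blast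
    then obtain u where u: "\<And>m. u m \<in> homog m" "\<And>m. \<phi> m = sym_proj0 (u m)" by metis
    let ?M = "{m. \<phi> m \<noteq> \<zero>\<^bsub>?S\<^esub>}"
    have "sym_proj0 h = sym_proj0 (sum u ?M)"
      unfolding \<phi>(3) by (rule S.p_finsum[OF \<phi>(2)]) (rule u(2))
    hence "h - sum u ?M \<in> idl0" by (simp add: S.p_eq_iff)
    hence "hcomp n (h - sum u ?M) \<in> idl0" by (rule hcomp_idl0)
    moreover have "hcomp n (sum u ?M) = (if n \<in> ?M then u n else 0)"
      using \<phi>(2) by (simp add: hcomp.sum hcomp_homog[OF u(1)])
    ultimately have "sym_proj0 (hcomp n h) = sym_proj0 (if n \<in> ?M then u n else 0)"
      by (simp add: S.p_eq_iff hcomp.diff)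
    also have "\<dots> = \<phi> n" by (auto simp: u(2)[symmetric] S.p_zero)
    finally show ?thesis by (simp add: \<phi>(4))
  qed
  ultimately show ?thesis
    unfolding sym_proj_def Let_def by (intro the_equality)
qed

lemma ser_power_sym:
  "ser_power (sym_alg scale) (\<lambda>a b. sym_proj0 (F a b)) m = (\<lambda>a b. sym_proj0 (ser_power free_alg F m a b))"
proof (induction m)
  case 0
  show ?case by (intro ext) (auto simp: ser_power_def ser_one_def S.p_one S.p_zero)
next
  case (Suc m)
  have mult: "ser_mult (sym_alg scale) (\<lambda>a b. sym_proj0 (F a b)) (\<lambda>a b. sym_proj0 (G a b)) =
      (\<lambda>a b. sym_proj0 (ser_mult free_alg F G a b))" for G
    by (intro ext) (simp add: ser_mult_def finsum_free_alg S.p_mult S.p_sum)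
  show ?case using Suc by (simp add: ser_power_def mult)
qed

lemma ser_exp_sym:
  "ser_exp (sym_alg scale) (\<lambda>a b. sym_proj0 (F a b)) = (\<lambda>a b. sym_proj0 (ser_exp free_alg F a b))"
  by (intro ext) (simp add: ser_exp_def ser_power_sym finsum_free_alg S.p_smult S.p_sum)

lemma ser_deriv_sym:
  "(ser_deriv1 (sym_alg scale) ^^ k) ((ser_deriv2 (sym_alg scale) ^^ l) (\<lambda>a b. sym_proj0 (F a b))) 0 0 =
     sym_proj0 (fsc (fact k * fact l) (F k l))"
proof -
  have c: "of_nat (Suc b) * (fact (b + Suc l) / fact (Suc b)) = (fact (b + Suc l) / fact b :: 'k)" for b l
    by (simp del: of_nat_Suc)
  \<comment> \<open>The factor (b + l)! / b! keeps the induction going; at b = 0 it is l!.\<close>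
  have 2: "(ser_deriv2 (sym_alg scale) ^^ l) (\<lambda>a b. sym_proj0 (F a b)) =
      (\<lambda>a b. sym_proj0 (fsc (fact (b + l) / fact b) (F a (b + l))))" for l F
  proof (induction l)
    case (Suc l)
    show ?case unfolding funpow.simps comp_def Suc
      by (simp only: ser_deriv2_def S.p_smult fs.scale_scale c add_Suc_shift)
  qed simp
  have 1: "(ser_deriv1 (sym_alg scale) ^^ k) (\<lambda>a b. sym_proj0 (F a b)) =
      (\<lambda>a b. sym_proj0 (fsc (fact (a + k) / fact a) (F (a + k) b)))" for k F
  proof (induction k)
    case (Suc k)
    show ?case unfolding funpow.simps comp_def Suc
      by (simp only: ser_deriv1_def S.p_smult fs.scale_scale c add_Suc_shift)
  qed simp
  show ?thesis unfolding 2 1 by simp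
qed

end

context char0_lie
begin

lemma univ_presentation_brz: "presentation (univ_alg scale br z) (univ_proj br z) (idl (brz z))"
  unfolding brz_alt by (rule univ_presentation)

text \<open>\<open>symm\<close> provides a candidate by \<open>symm_cg\<close>, and the prescribed
  values on words leave no other choice on the carrier.\<close>

lemma symmetrise_eq: "symmetrise scale br z (sym_proj0 f) = univ_proj br z (symm f)"
proof -
  interpret U: presentation "univ_alg scale br z" "univ_proj br z" "idl (brz z)" by (rule univ_presentation_brz)
  let ?P = "\<lambda>Q. alg_linear (sym_alg scale) (univ_alg scale br z) Q \<and>
       (\<forall>\<xi>s. Q (alg_prod (sym_alg scale) (map (sym_gen scale) \<xi>s)) =
          inverse (fact (length \<xi>s)) \<odot>\<^bsub>univ_alg scale br z\<^esub>
            (\<Oplus>\<^bsub>univ_alg scale br z\<^esub> \<sigma> \<in> {\<sigma>. \<sigma> permutes {..<length \<xi>s}}.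
               alg_prod (univ_alg scale br z) (map (univ_gen scale br z) (permute_list \<sigma> \<xi>s))))"
  have formula: "inverse (fact (length w)) \<odot>\<^bsub>univ_alg scale br z\<^esub>
            (\<Oplus>\<^bsub>univ_alg scale br z\<^esub> \<sigma> \<in> {\<sigma>. \<sigma> permutes {..<length w}}.
               alg_prod (univ_alg scale br z) (map (univ_gen scale br z) (permute_list \<sigma> w))) =
      univ_proj br z (symm (word w))" for w
    unfolding univ_gen_eq[abs_def] U.p_prod
    by (simp add: U.p_sum[OF finite_perms, symmetric] U.p_smult symm_of_word sym_word_def)
  have P: "?P Q \<longleftrightarrow> alg_linear (sym_alg scale) (univ_alg scale br z) Q \<and>
      (\<forall>w. Q (sym_proj0 (word w)) = univ_proj br z (symm (word w)))" for Q
    unfolding formula sym_gen_eq[abs_def] S.p_prod ..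
  have ex: "?P (\<lambda>x. univ_proj br z (symm (sym_rep x)))"
  proof -
    have e: "univ_proj br z (symm (sym_rep (sym_proj0 f))) = univ_proj br z (symm f)" for f
      using symm_cg[OF sym_rep[of f], of "brz z"] by (simp add: U.p_eq_iff cg_def)
    show ?thesis
      by (rule iffD2[OF P], intro conjI S.alg_linearI allI) (simp_all add: e symm.add symm.scale U.p_add U.p_smult)
  qed
  have Q: "?P (symmetrise scale br z)"
    unfolding symmetrise_def Let_def by (rule someI[of ?P, OF ex])
  have lin: "alg_linear (sym_alg scale) (univ_alg scale br z) (symmetrise scale br z)"
    and words: "\<And>w. symmetrise scale br z (sym_proj0 (word w)) = univ_proj br z (symm (word w))"
    using iffD1[OF P Q] by auto
  show ?thesis
  proof (induction f rule: free_induct)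
    case zero
    obtain h where h: "symmetrise scale br z (sym_proj0 0) = univ_proj br z h"
      using S.alg_linearD(1)[OF lin] by (rule U.carrierE)
    show ?case using S.alg_linearD(3)[OF lin, of 0 0] h by (simp add: U.p_smult symm.zero)
  next
    case (step c w f)
    thus ?case by (simp add: S.alg_linearD(2,3)[OF lin] words symm.add symm.scale U.p_add U.p_smult)
  qed
qed

lemma symmetrise_inv_eq: "symmetrise_inv scale br z (univ_proj br z f) = sym_proj0 (unsymm z f)"
proof -
  interpret U: presentation "univ_alg scale br z" "univ_proj br z" "idl (brz z)" by (rule univ_presentation_brz)
  have inj: "inj_on (symmetrise scale br z) (carrier (sym_alg scale))"
  proof (rule inj_onI)
    fix x y assume xy: "x \<in> carrier (sym_alg scale)" "y \<in> carrier (sym_alg scale)"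
      "symmetrise scale br z x = symmetrise scale br z y"
    then obtain f g where fg: "x = sym_proj0 f" "y = sym_proj0 g" by (auto elim!: S.carrierE)
    hence "symm (f - g) \<in> idl (brz z)" using xy(3) by (simp add: symmetrise_eq U.p_eq_iff symm.diff)
    thus "x = y" unfolding fg using symm_inj_z by (simp add: S.p_eq_iff)
  qed
  have "univ_proj br z f = symmetrise scale br z (sym_proj0 (unsymm z f))"
    using cg_sym[OF cg_symm_unsymm[of z f]] by (simp add: symmetrise_eq U.p_eq_iff cg_def)
  thus ?thesis unfolding symmetrise_inv_def by (simp add: inv_into_f_f[OF inj])
qed

lemma hat_star_eq: "hat_star scale br z (sym_proj0 f) (sym_proj0 g) = sym_proj0 (star z f g)"
proof -
  interpret U: presentation "univ_alg scale br z" "univ_proj br z" "idl (brz z)" by (rule univ_presentation_brz)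
  show ?thesis by (simp add: hat_star_def symmetrise_eq U.p_mult symmetrise_inv_eq star_def)
qed

lemma star_idl0: "f \<in> idl0 \<or> g \<in> idl0 \<Longrightarrow> star z f g \<in> idl0"
proof -
  assume "f \<in> idl0 \<or> g \<in> idl0"
  hence "cg0 f 0 \<or> cg0 g 0" by (simp add: cg_0)
  hence "cg0 (star z f g) (star z 0 g) \<or> cg0 (star z f g) (star z f 0)"
    using star_cong[OF _ cg_refl] star_cong[OF cg_refl] by blast
  thus ?thesis by (auto simp: star_def symm.zero unsymm.zero cg_0)
qed

lemma lift2_star: "lift2 (star z) (sym_proj0 f) (sym_proj0 g) = sym_proj0 (star z f g)"
  by (rule lift2) (rule star_cong)

lemma coef_homog: "f \<in> homog k \<Longrightarrow> g \<in> homog l \<Longrightarrow> coef n f g \<in> homog (k + l - n)"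
  unfolding coef_def by (intro low_homog homog_mult symm_homog)

text \<open>For homogeneous arguments \<open>coef n\<close> is homogeneous of degree k + l - n, so
  the projections of the product at z = 1 single out the coefficients, and weighting them by z^n
  gives the product at z.\<close>

lemma gutt_star_eq: "gutt_star scale br z (sym_proj0 f) (sym_proj0 g) = sym_proj0 (star z f g)"
proof -
  interpret U: presentation "univ_alg scale br 1" "univ_proj br 1" "idl (brz 1)" by (rule univ_presentation_brz)
  let ?P = "\<lambda>B. alg_bilinear (sym_alg scale) B \<and>
        (\<forall>k l. \<forall>f \<in> sym_power scale k. \<forall>g \<in> sym_power scale l.
           B f g = (\<Oplus>\<^bsub>sym_alg scale\<^esub> n \<in> {..k + l}. (z ^ n) \<odot>\<^bsub>sym_alg scale\<^esub>
             sym_proj scale (k + l - n) (symmetrise_inv scale br 1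
               (symmetrise scale br 1 f \<otimes>\<^bsub>univ_alg scale br 1\<^esub> symmetrise scale br 1 g))))"
  have rhs: "(\<Oplus>\<^bsub>sym_alg scale\<^esub> n \<in> {..k + l}. (z ^ n) \<odot>\<^bsub>sym_alg scale\<^esub>
             sym_proj scale (k + l - n) (symmetrise_inv scale br 1
               (symmetrise scale br 1 (sym_proj0 f) \<otimes>\<^bsub>univ_alg scale br 1\<^esub> symmetrise scale br 1 (sym_proj0 g)))) =
      sym_proj0 (star z f g)" if f: "f \<in> homog k" and g: "g \<in> homog l" for f g k l
  proof -
    note fl = star_eq[OF subsetD[OF homog_filt f] subsetD[OF homog_filt g] order_refl]
    have "hcomp (k + l - n) (star 1 f g) = coef n f g" if "n \<le> k + l" for n
    proof -
      have "hcomp (k + l - n) (star 1 f g) = (\<Sum>j\<le>k + l. if j = n then coef n f g else 0)"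
        unfolding fl hcomp.sum hcomp.scale
        by (intro sum.cong refl) (use that in \<open>auto simp: hcomp_homog[OF coef_homog[OF f g]]\<close>)
      thus ?thesis using that by simp
    qed
    hence "(\<Oplus>\<^bsub>sym_alg scale\<^esub> n \<in> {..k + l}. (z ^ n) \<odot>\<^bsub>sym_alg scale\<^esub>
             sym_proj scale (k + l - n) (symmetrise_inv scale br 1
               (symmetrise scale br 1 (sym_proj0 f) \<otimes>\<^bsub>univ_alg scale br 1\<^esub> symmetrise scale br 1 (sym_proj0 g)))) =
        sym_proj0 (\<Sum>n\<le>k + l. fsc (z ^ n) (coef n f g))"
      by (intro S.p_finsum)
         (simp_all add: symmetrise_eq U.p_mult symmetrise_inv_eq sym_proj_eq S.p_smult flip: star_def)
    thus ?thesis by (simp add: fl)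
  qed
  have ex: "?P (lift2 (star z))"
    using alg_bilinear_of_rep[OF lift2_star flinear_star] rhs
    by (auto simp: sym_power_eq lift2_star)
  have P: "?P (gutt_star scale br z)"
    unfolding gutt_star_def Let_def by (rule someI[of ?P, OF ex])
  show ?thesis
  proof (rule alg_bilinear_eq_on_powers[OF conjunct1[OF P] flinear_star star_idl0])
    fix m n x y
    have "sym_proj0 (word (replicate m x)) \<in> sym_power scale m" "sym_proj0 (word (replicate n y)) \<in> sym_power scale n"
      by (auto simp: sym_power_eq intro!: imageI word_in_homog)
    thus "gutt_star scale br z (sym_proj0 (word (replicate m x))) (sym_proj0 (word (replicate n y))) =
      sym_proj0 (star z (word (replicate m x)) (word (replicate n y)))"
      using P rhs[of "word (replicate m x)" m "word (replicate n y)" n] by (simp add: word_in_homog)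
  qed auto
qed

lemma bch_star_eq: "bch_star scale br z (sym_proj0 f) (sym_proj0 g) = sym_proj0 (star z f g)"
proof -
  let ?P = "\<lambda>B. alg_bilinear (sym_alg scale) B \<and>
       (\<forall>k l \<xi> \<eta>. B (sym_gen scale \<xi> [^]\<^bsub>sym_alg scale\<^esub> (k::nat)) (sym_gen scale \<eta> [^]\<^bsub>sym_alg scale\<^esub> (l::nat)) =
          (ser_deriv1 (sym_alg scale) ^^ k) ((ser_deriv2 (sym_alg scale) ^^ l)
            (ser_exp (sym_alg scale) (bch_series scale br z \<xi> \<eta>))) 0 0)"
  have series: "bch_series scale br z \<xi> \<eta> = (\<lambda>a b. sym_proj0 (bch_word z \<xi> \<eta> a b))" for \<xi> \<eta>
    unfolding bch_series_def bch_word_def sym_gen_eq S.p_smult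
    by (intro ext sym_proj0_cong cg_sym[OF gen_scale])
  have pow: "sym_gen scale \<xi> [^]\<^bsub>sym_alg scale\<^esub> (k::nat) = sym_proj0 (word (replicate k \<xi>))" for \<xi> k
    by (simp add: sym_gen_eq S.p_pow word_replicate)
  have rhs: "(ser_deriv1 (sym_alg scale) ^^ k) ((ser_deriv2 (sym_alg scale) ^^ l)
            (ser_exp (sym_alg scale) (bch_series scale br z \<xi> \<eta>))) 0 0 =
      sym_proj0 (star z (word (replicate k \<xi>)) (word (replicate l \<eta>)))" for k l \<xi> \<eta>
    unfolding series ser_exp_sym ser_deriv_sym by (rule sym_proj0_cong, rule cg_sym, rule star_powers)
  have ex: "?P (lift2 (star z))"
    using alg_bilinear_of_rep[OF lift2_star flinear_star] unfolding rhs pow by (simp add: lift2_star)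
  have P: "?P (bch_star scale br z)"
    unfolding bch_star_def Let_def by (rule someI[of ?P, OF ex])
  show ?thesis
    by (rule alg_bilinear_eq_on_powers[OF conjunct1[OF P] flinear_star star_idl0])
       (use P in \<open>unfold rhs pow, auto\<close>)
qed

subsection \<open>The Poisson bracket\<close>

text \<open>Induction on words by the Leibniz rule, which \<open>L\<close> satisfies only modulo
  \<open>idl0\<close>; both derivations kill 1.\<close>

lemma derivation_eq_on_gens:
  assumes D: "alg_linear (sym_alg scale) (sym_alg scale) D"
    and Dm: "\<And>f g. D (sym_proj0 f \<otimes>\<^bsub>sym_alg scale\<^esub> sym_proj0 g) =
      D (sym_proj0 f) \<otimes>\<^bsub>sym_alg scale\<^esub> sym_proj0 g \<oplus>\<^bsub>sym_alg scale\<^esub> sym_proj0 f \<otimes>\<^bsub>sym_alg scale\<^esub> D (sym_proj0 g)"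
    and L: "flinear L" and Lm: "\<And>f g. cg0 (L (f * g)) (L f * g + f * L g)"
    and gens: "\<And>x. D (sym_proj0 (word [x])) = sym_proj0 (L (word [x]))"
  shows "D (sym_proj0 f) = sym_proj0 (L f)"
proof -
  interpret L: Vector_Spaces.linear fsc fsc L by fact
  have L1: "L 1 \<in> idl0" using Lm[of 1 1] fs.subspace_neg[OF subspace_idl, of "- L 1"] by (simp add: cg_def)
  have words: "D (sym_proj0 (word w)) = sym_proj0 (L (word w))" for w
  proof (induction w)
    case Nil
    obtain d where d: "D (sym_proj0 1) = sym_proj0 d" using S.alg_linearD(1)[OF D] by (rule S.carrierE)
    have "sym_proj0 d = sym_proj0 (d + d)" using Dm[of 1 1] by (simp add: d S.p_mult S.p_add)
    hence "d \<in> idl0" using fs.subspace_neg[OF subspace_idl, of "- d"] by (simp add: S.p_eq_iff)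
    thus ?case using L1 fs.subspace_diff[OF subspace_idl, of d _ "L 1"] by (simp add: d S.p_eq_iff)
  next
    case (Cons x w)
    have "D (sym_proj0 (word [x]) \<otimes>\<^bsub>sym_alg scale\<^esub> sym_proj0 (word w)) =
        sym_proj0 (L (word [x]) * word w + word [x] * L (word w))"
      unfolding Dm gens Cons by (simp add: S.p_mult S.p_add)
    also have "\<dots> = sym_proj0 (L (word [x] * word w))"
      by (rule sym_proj0_cong[OF cg_sym[OF Lm]])
    finally show ?case by (simp add: S.p_mult word_mult)
  qed
  show ?thesis
  proof (induction f rule: free_induct)
    case zero
    obtain h where h: "D (sym_proj0 0) = sym_proj0 h"
      using S.alg_linearD(1)[OF D] by (rule S.carrierE)
    show ?case using S.alg_linearD(3)[OF D, of 0 0] h by (simp add: S.p_smult L.zero)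
  next
    case (step c w f)
    thus ?case by (simp add: S.alg_linearD(2,3)[OF D] words L.add L.scale S.p_add S.p_smult)
  qed
qed

lemma lift2_comm: "lift2 (comm n) (sym_proj0 f) (sym_proj0 g) = sym_proj0 (comm n f g)"
  by (rule lift2) (rule comm_cong)

lemma comm_antisym: "comm n f g = - comm n g f"
  by (simp add: comm_def)

text \<open>Existence of the bracket is the first-order commutator. Uniqueness extends from pairs of
  generators one argument at a time, with antisymmetry in between.\<close>

lemma sym_poisson_eq: "sym_poisson scale br (sym_proj0 f) (sym_proj0 g) = sym_proj0 (comm 1 f g)"
proof -
  let ?P = "\<lambda>P. is_poisson_bracket (sym_alg scale) P \<and>
     (\<forall>\<xi> \<eta>. P (sym_gen scale \<xi>) (sym_gen scale \<eta>) = sym_gen scale (br \<xi> \<eta>))"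
  have ex: "?P (lift2 (comm 1))"
  proof (intro conjI allI)
    show "is_poisson_bracket (sym_alg scale) (lift2 (comm 1))"
      unfolding is_poisson_bracket_def
    proof (intro conjI ballI)
      show "alg_bilinear (sym_alg scale) (lift2 (comm 1))"
        by (rule alg_bilinear_of_rep[OF lift2_comm flinear_comm])
      fix x y assume "x \<in> carrier (sym_alg scale)" "y \<in> carrier (sym_alg scale)"
      then obtain f g where xy: "x = sym_proj0 f" "y = sym_proj0 g" by (auto elim!: S.carrierE)
      show "lift2 (comm 1) x y = \<ominus>\<^bsub>sym_alg scale\<^esub> lift2 (comm 1) y x"
        unfolding xy lift2_comm S.p_uminus by (rule arg_cong[OF comm_antisym])
      fix w assume "w \<in> carrier (sym_alg scale)"
      then obtain h where w: "w = sym_proj0 h" by (rule S.carrierE)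
      show "lift2 (comm 1) x (y \<otimes>\<^bsub>sym_alg scale\<^esub> w) = lift2 (comm 1) x y \<otimes>\<^bsub>sym_alg scale\<^esub> w
          \<oplus>\<^bsub>sym_alg scale\<^esub> y \<otimes>\<^bsub>sym_alg scale\<^esub> lift2 (comm 1) x w"
        unfolding xy w lift2_comm S.p_mult S.p_add by (rule sym_proj0_cong[OF comm_leibniz])
      show "lift2 (comm 1) x (lift2 (comm 1) y w) \<oplus>\<^bsub>sym_alg scale\<^esub> lift2 (comm 1) y (lift2 (comm 1) w x)
          \<oplus>\<^bsub>sym_alg scale\<^esub> lift2 (comm 1) w (lift2 (comm 1) x y) = \<zero>\<^bsub>sym_alg scale\<^esub>"
        unfolding xy w lift2_comm S.p_add S.p_zero S.p_eq_0 by (rule comm_jacobi)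
    qed
    show "lift2 (comm 1) (sym_gen scale \<xi>) (sym_gen scale \<eta>) = sym_gen scale (br \<xi> \<eta>)" for \<xi> \<eta>
      unfolding sym_gen_eq lift2_comm by (rule sym_proj0_cong, rule comm_gen)
  qed
  define P where "P = sym_poisson scale br"
  have P: "?P P"
    unfolding P_def sym_poisson_def by (rule someI[of ?P, OF ex])
  hence pb: "is_poisson_bracket (sym_alg scale) P"
    and gens: "\<And>x y. P (sym_proj0 (word [x])) (sym_proj0 (word [y])) = sym_proj0 (word [br x y])"
    by (auto simp: sym_gen_eq)
  have lin: "alg_linear (sym_alg scale) (sym_alg scale) (P (sym_proj0 f))" for f
    using pb by (auto simp: is_poisson_bracket_def alg_bilinear_def)
  have leib: "P (sym_proj0 h) (sym_proj0 f \<otimes>\<^bsub>sym_alg scale\<^esub> sym_proj0 g) =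
      P (sym_proj0 h) (sym_proj0 f) \<otimes>\<^bsub>sym_alg scale\<^esub> sym_proj0 g \<oplus>\<^bsub>sym_alg scale\<^esub>
      sym_proj0 f \<otimes>\<^bsub>sym_alg scale\<^esub> P (sym_proj0 h) (sym_proj0 g)" for f g h
    using pb unfolding is_poisson_bracket_def by blast
  have anti: "P (sym_proj0 f) (sym_proj0 g) = \<ominus>\<^bsub>sym_alg scale\<^esub> P (sym_proj0 g) (sym_proj0 f)" for f g
    using pb unfolding is_poisson_bracket_def by blast
  have gen: "P (sym_proj0 (word [x])) (sym_proj0 g) = sym_proj0 (comm 1 (word [x]) g)" for x g
    by (rule derivation_eq_on_gens[OF lin leib flinear_comm(1) comm_leibniz])
       (unfold gens, rule sym_proj0_cong[OF cg_sym[OF comm_gen]])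
  have "P (sym_proj0 f) (sym_proj0 g) = sym_proj0 (comm 1 f g)"
  proof (rule derivation_eq_on_gens[OF lin leib flinear_comm(1) comm_leibniz])
    fix x
    have "P (sym_proj0 f) (sym_proj0 (word [x])) = sym_proj0 (- comm 1 (word [x]) f)"
      by (subst anti) (simp add: gen S.p_uminus)
    thus "P (sym_proj0 f) (sym_proj0 (word [x])) = sym_proj0 (comm 1 f (word [x]))"
      using comm_antisym[of 1 f "word [x]"] by simp
  qed
  thus ?thesis by (simp add: P_def)
qed

text \<open>\<open>st\<close> is left open, so that the three products, identified on the carrier,
  are treated at once.\<close>

lemma is_star_product_of_rep:
  assumes st: "\<And>z f g. st z (sym_proj0 f) (sym_proj0 g) = sym_proj0 (star z f g)"
  shows "is_star_product (sym_alg scale) (sym_poisson scale br) st"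
  unfolding is_star_product_def
proof (intro conjI allI ballI exI[of _ "\<lambda>n. lift2 (coef n)"])
  have C: "lift2 (coef n) (sym_proj0 f) (sym_proj0 g) = sym_proj0 (coef n f g)" for n f g
    by (rule lift2) (rule coef_cong)
  show "alg_bilinear (sym_alg scale) (st z)" for z
    by (rule alg_bilinear_of_rep[OF st flinear_star])
  show "alg_bilinear (sym_alg scale) (lift2 (coef n))" for n
    by (rule alg_bilinear_of_rep[OF C flinear_coef])
  fix x assume "x \<in> carrier (sym_alg scale)"
  then obtain f where f: "x = sym_proj0 f" by (rule S.carrierE)
  show "st z \<one>\<^bsub>sym_alg scale\<^esub> x = x" "st z x \<one>\<^bsub>sym_alg scale\<^esub> = x" for z
    unfolding f S.p_one st by (rule sym_proj0_cong, rule star_1)+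
  fix y assume "y \<in> carrier (sym_alg scale)"
  then obtain g where g: "y = sym_proj0 g" by (rule S.carrierE)
  let ?Z = "{n. lift2 (coef n) x y \<noteq> \<zero>\<^bsub>sym_alg scale\<^esub>}"
  obtain d where d: "f \<in> filt d" using in_filt by blast
  obtain e where e: "g \<in> filt e" using in_filt by blast
  have Z: "?Z \<subseteq> {..d + e}"
    using coef_eq_0[OF d e] by (auto simp: f g C S.p_zero not_le[symmetric])
  show fin: "finite ?Z" by (rule finite_subset[OF Z]) simp
  show "st z x y = (\<Oplus>\<^bsub>sym_alg scale\<^esub> n \<in> ?Z. (z ^ n) \<odot>\<^bsub>sym_alg scale\<^esub> lift2 (coef n) x y)" for z
  proof -
    \<comment> \<open>Orders outside \<open>?Z\<close> have coefficients in \<open>idl0\<close> and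
      may be dropped.\<close>
    have "(\<Sum>n\<le>d + e. fsc (z ^ n) (coef n f g)) - (\<Sum>n\<in>?Z. fsc (z ^ n) (coef n f g)) =
        (\<Sum>n\<in>{..d + e} - ?Z. fsc (z ^ n) (coef n f g))"
      by (rule sum_diff[OF _ Z, symmetric]) simp
    also have "\<dots> \<in> idl0"
      by (intro fs.subspace_sum fs.subspace_scale subspace_idl) (auto simp: f g C S.p_zero S.p_eq_0)
    finally have "cg0 (star z f g) (\<Sum>n\<in>?Z. fsc (z ^ n) (coef n f g))"
      by (simp add: star_eq[OF d e order_refl] cg_def)
    hence "st z x y = sym_proj0 (\<Sum>n\<in>?Z. fsc (z ^ n) (coef n f g))"
      unfolding f g st by (rule sym_proj0_cong)
    also have "\<dots> = (\<Oplus>\<^bsub>sym_alg scale\<^esub> n \<in> ?Z. (z ^ n) \<odot>\<^bsub>sym_alg scale\<^esub> lift2 (coef n) x y)"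
      by (rule S.p_finsum[OF fin, symmetric]) (simp add: f g C S.p_smult)
    finally show ?thesis .
  qed
  show "lift2 (coef 0) x y = x \<otimes>\<^bsub>sym_alg scale\<^esub> y"
    unfolding f g C S.p_mult by (rule sym_proj0_cong, rule coef_0)
  show "lift2 (coef 1) x y \<ominus>\<^bsub>sym_alg scale\<^esub> lift2 (coef 1) y x = sym_poisson scale br x y"
    unfolding f g C S.p_minus sym_poisson_eq comm_def ..
  fix w assume "w \<in> carrier (sym_alg scale)"
  then obtain h where h: "w = sym_proj0 h" by (rule S.carrierE)
  show "st z (st z x y) w = st z x (st z y w)" for z
    unfolding f g h st by (rule sym_proj0_cong, rule star_assoc)
qed

end

theorem theorem3p4p6:
  fixes scale :: "'k::real_or_complex \<Rightarrow> 'g::ab_group_add \<Rightarrow> 'g"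
    and bracket :: "'g \<Rightarrow> 'g \<Rightarrow> 'g"
  assumes "lie_algebra scale bracket"
  shows "(\<forall>z. \<forall>f \<in> carrier (sym_alg scale). \<forall>g \<in> carrier (sym_alg scale).
            gutt_star scale bracket z f g = hat_star scale bracket z f g \<and>
            hat_star scale bracket z f g = bch_star scale bracket z f g) \<and>
         is_star_product (sym_alg scale) (sym_poisson scale bracket) (gutt_star scale bracket) \<and>
         is_star_product (sym_alg scale) (sym_poisson scale bracket) (hat_star scale bracket) \<and>
         is_star_product (sym_alg scale) (sym_poisson scale bracket) (bch_star scale bracket)"
proof -
  interpret char0_lie scale bracket using assms by (simp add: char0_lie_def)
  show ?thesis
    by (auto simp: gutt_star_eq hat_star_eq bch_star_eq elim!: S.carrierE intro!: is_star_product_of_rep)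
qed

end
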